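(* Let $\theta(z)=\phi(z_1)\psi(z_2)$, where $\phi$ and $\psi$ are inner functions on $\mathbb{D}$. Then, with respect to the orthogonal decomposition $\mathcal{K}_\theta = \mathcal{S}^{max}_1\oplus\mathcal{S}^{min}_2$, $$S_{z_1} = \begin{bmatrix} T_{z_1}|_{\mathcal{S}^{max}_1} & 0\\ 0 & P_{\mathcal{K}^1_\phi}T_{z_1}\otimes I_{\psi H^2_2(\mathbb{D})}\end{bmatrix} : \begin{bmatrix}\mathcal{S}^{max}_1\\ \mathcal{S}^{min}_2\end{bmatrix}\to\begin{bmatrix}\mathcal{S}^{max}_1\\ \mathcal{S}^{min}_2\end{bmatrix},$$ and, with respect to the orthogonal decomposition $\mathcal{K}_\theta=\mathcal{S}^{min}_1\oplus\mathcal{S}^{max}_2$, $$S_{z_2} = \begin{bmatrix} P_{\mathcal{K}^2_\psi}T_{z_2}\otimes I_{\phi H^2_1(\mathbb{D})} & 0\\ 0 & T_{z_2}|_{\mathcal{S}^{max}_2}\end{bmatrix} : \begin{bmatrix}\mathcal{S}^{min}_1\\ \mathcal{S}^{max}_2\end{bmatrix}\to\begin{bmatrix}\mathcal{S}^{min}_1\\ \mathcal{S}^{max}_2\end{bmatrix}.$$ In particular, the spaces $\mathcal{S}^{max}_1$, $\mathcal{S}^{min}_2$ are reducing for $S_{z_1}$ and the spaces $\mathcal{S}^{min}_1$, $\mathcal{S}^{max}_2$ are reducing for $S_{z_2}$.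
   Context: $H^2(\mathbb{D}^2)$ is the Hardy space on the bidisk with variables $z=(z_1,z_2)$. For an inner function $\theta$ on $\mathbb{D}^2$ (bounded holomorphic with unimodular boundary values a.e. on $\mathbb{T}^2$), $\mathcal{K}_\theta = H^2(\mathbb{D}^2)\ominus\theta H^2(\mathbb{D}^2)$, $P_\theta$ is the orthogonal projection onto $\mathcal{K}_\theta$, $T_{z_j}$ is multiplication by $z_j$, and $S_{z_j}=P_\theta T_{z_j}|_{\mathcal{K}_\theta}$. For $j=1,2$, $\mathcal{S}^{max}_j$ is the largest closed subspace of $\mathcal{K}_\theta$ invariant under multiplication by $z_j$; $\mathcal{S}^{min}_2=\mathcal{K}_\theta\ominus\mathcal{S}^{max}_1$ and $\mathcal{S}^{min}_1=\mathcal{K}_\theta\ominus\mathcal{S}^{max}_2$. $H^2_j(\mathbb{D})$ is the one variable Hardy space in the variable $z_j$, $\mathcal{K}^1_\phi = H^2_1(\mathbb{D})\ominus\phi(z_1)H^2_1(\mathbb{D})$, $\mathcal{K}^2_\psi = H^2_2(\mathbb{D})\ominus\psi(z_2)H^2_2(\mathbb{D})$, and $P_{\mathcal{K}^1_\phi}$, $P_{\mathcal{K}^2_\psi}$ are the orthogonal projections of $H^2_1(\mathbb{D})$, $H^2_2(\mathbb{D})$ onto them. $H^2(\mathbb{D}^2)$ is identified with the Hilbert space tensor product of $H^2_1(\mathbb{D})$ and $H^2_2(\mathbb{D})$ (an elementary tensor being the pointwise product), and for closed subspaces $A$ of one of these spaces and $B$ of the other, $A\otimes B$ is the closed linear span in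 $H^2(\mathbb{D}^2)$ of products of elements of $A$ and $B$. For $\theta=\phi(z_1)\psi(z_2)$ one has $\mathcal{S}^{max}_1 = \mathcal{K}^2_\psi\otimes H^2_1(\mathbb{D})$, $\mathcal{S}^{min}_2=\mathcal{K}^1_\phi\otimes\psi H^2_2(\mathbb{D})$, $\mathcal{S}^{min}_1=\mathcal{K}^2_\psi\otimes\phi H^2_1(\mathbb{D})$, $\mathcal{S}^{max}_2=\mathcal{K}^1_\phi\otimes H^2_2(\mathbb{D})$. In the matrices, $P_{\mathcal{K}^1_\phi}T_{z_1}$ is regarded as an operator on $\mathcal{K}^1_\phi$, $P_{\mathcal{K}^2_\psi}T_{z_2}$ as an operator on $\mathcal{K}^2_\psi$, and $I_X$ is the identity on $X$. *)

theory Defs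
  imports "HOL-Analysis.Analysis" "HOL-Library.Function_Algebras"
begin

section \<open>Spaces of functions with an inner product\<close>

definition fscale :: "complex \<Rightarrow> ('a \<Rightarrow> complex) \<Rightarrow> 'a \<Rightarrow> complex" where
  "fscale c f = (\<lambda>x. c * f x)"

global_interpretation fvs: vector_space "fscale :: complex \<Rightarrow> ('a \<Rightarrow> complex) \<Rightarrow> 'a \<Rightarrow> complex"
  by unfold_locales (auto simp: fscale_def fun_eq_iff algebra_simps)

record 'a function_space =
  fspace :: "('a \<Rightarrow> complex) set"
  fip :: "('a \<Rightarrow> complex) \<Rightarrow> ('a \<Rightarrow> complex) \<Rightarrow> complex"

definition fnorm :: "'a function_space \<Rightarrow> ('a \<Rightarrow> complex) \<Rightarrow> real" where
  "fnorm H f = sqrt (Re (fip H f f))"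

definition fclosure :: "'a function_space \<Rightarrow> ('a \<Rightarrow> complex) set \<Rightarrow> ('a \<Rightarrow> complex) set" where
  "fclosure H M = {f \<in> fspace H. \<exists>s. (\<forall>n. s n \<in> M) \<and> (\<lambda>n. fnorm H (s n - f)) \<longlonglongrightarrow> 0}"

definition closed_subspace :: "'a function_space \<Rightarrow> ('a \<Rightarrow> complex) set \<Rightarrow> bool" where
  "closed_subspace H M \<longleftrightarrow> M \<subseteq> fspace H \<and> fvs.subspace M \<and> fclosure H M \<subseteq> M"

text \<open>\<open>ominus H M N\<close> is \<open>M \<ominus> N\<close>, the orthogonal complement of \<open>N\<close> relative to \<open>M\<close>.\<close>

definition ominus ::
  "'a function_space \<Rightarrow> ('a \<Rightarrow> complex) set \<Rightarrow> ('a \<Rightarrow> complex) set \<Rightarrow> ('a \<Rightarrow> complex) set" where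
  "ominus H M N = {f \<in> M. \<forall>g\<in>N. fip H f g = 0}"

definition orth_proj ::
  "'a function_space \<Rightarrow> ('a \<Rightarrow> complex) set \<Rightarrow> ('a \<Rightarrow> complex) \<Rightarrow> 'a \<Rightarrow> complex" where
  "orth_proj H M f = (THE g. g \<in> M \<and> (\<forall>h\<in>M. fip H (f - g) h = 0))"

definition orth_decomp ::
  "'a function_space \<Rightarrow> ('a \<Rightarrow> complex) set \<Rightarrow> ('a \<Rightarrow> complex) set \<Rightarrow> ('a \<Rightarrow> complex) set \<Rightarrow> bool" where
  "orth_decomp H K M N \<longleftrightarrow>
     closed_subspace H M \<and> closed_subspace H N \<and>
     (\<forall>f\<in>M. \<forall>g\<in>N. fip H f g = 0) \<and> K = {f + g |f g. f \<in> M \<and> g \<in> N}"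

definition bounded_linear_map ::
  "'a function_space \<Rightarrow> ('a \<Rightarrow> complex) set \<Rightarrow> (('a \<Rightarrow> complex) \<Rightarrow> 'a \<Rightarrow> complex) \<Rightarrow> bool" where
  "bounded_linear_map H M T \<longleftrightarrow>
     T ` M \<subseteq> fspace H \<and>
     (\<forall>f\<in>M. \<forall>g\<in>M. T (f + g) = T f + T g) \<and>
     (\<forall>c. \<forall>f\<in>M. T (fscale c f) = fscale c (T f)) \<and>
     (\<exists>C. \<forall>f\<in>M. fnorm H (T f) \<le> C * fnorm H f)"

text \<open>
  With respect to the orthogonal decomposition \<open>K = M \<oplus> N\<close>, the operator \<open>S\<close> on \<open>K\<close> has
  the block matrix with rows \<open>(A, B)\<close> and \<open>(C, D)\<close>, where \<open>A : M \<rightarrow> M\<close>, \<open>B : N \<rightarrow> M\<close>,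
  \<open>C : M \<rightarrow> N\<close> and \<open>D : N \<rightarrow> N\<close>.
\<close>

definition has_block_matrix ::
  "'a function_space \<Rightarrow> ('a \<Rightarrow> complex) set \<Rightarrow> ('a \<Rightarrow> complex) set \<Rightarrow> ('a \<Rightarrow> complex) set \<Rightarrow>
   (('a \<Rightarrow> complex) \<Rightarrow> 'a \<Rightarrow> complex) \<Rightarrow>
   (('a \<Rightarrow> complex) \<Rightarrow> 'a \<Rightarrow> complex) \<Rightarrow> (('a \<Rightarrow> complex) \<Rightarrow> 'a \<Rightarrow> complex) \<Rightarrow>
   (('a \<Rightarrow> complex) \<Rightarrow> 'a \<Rightarrow> complex) \<Rightarrow> (('a \<Rightarrow> complex) \<Rightarrow> 'a \<Rightarrow> complex) \<Rightarrow> bool" where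
  "has_block_matrix H K M N S A B C D \<longleftrightarrow>
     orth_decomp H K M N \<and>
     A ` M \<subseteq> M \<and> B ` N \<subseteq> M \<and> C ` M \<subseteq> N \<and> D ` N \<subseteq> N \<and>
     (\<forall>f\<in>M. \<forall>g\<in>N. S (f + g) = (A f + B g) + (C f + D g))"

definition reducing ::
  "'a function_space \<Rightarrow> ('a \<Rightarrow> complex) set \<Rightarrow> (('a \<Rightarrow> complex) \<Rightarrow> 'a \<Rightarrow> complex) \<Rightarrow>
   ('a \<Rightarrow> complex) set \<Rightarrow> bool" where
  "reducing H K S M \<longleftrightarrow>
     closed_subspace H M \<and> M \<subseteq> K \<and> S ` M \<subseteq> M \<and> S ` ominus H K M \<subseteq> ominus H K M"


section \<open>Hardy spaces on the disk and the bidisk\<close>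

definition l2_expansion ::
  "'a set \<Rightarrow> ('i \<Rightarrow> 'a \<Rightarrow> complex) \<Rightarrow> ('a \<Rightarrow> complex) \<Rightarrow> ('i \<Rightarrow> complex) \<Rightarrow> bool" where
  "l2_expansion D e f a \<longleftrightarrow>
     (\<lambda>i. (norm (a i))\<^sup>2) summable_on UNIV \<and>
     (\<forall>x\<in>D. ((\<lambda>i. a i * e i x) has_sum f x) UNIV)"

definition l2_coeffs ::
  "'a set \<Rightarrow> ('i \<Rightarrow> 'a \<Rightarrow> complex) \<Rightarrow> ('a \<Rightarrow> complex) \<Rightarrow> 'i \<Rightarrow> complex" where
  "l2_coeffs D e f = (THE a. l2_expansion D e f a)"

text \<open>
  The functions on \<open>D\<close> with square-summable coefficients with respect to the monomials \<open>e i\<close>,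
  the inner product being that of the coefficient families. So that an element is determined
  by its values on \<open>D\<close>, it is required to vanish off \<open>D\<close>.
\<close>

definition hardy :: "'a set \<Rightarrow> ('i \<Rightarrow> 'a \<Rightarrow> complex) \<Rightarrow> 'a function_space" where
  "hardy D e =
     \<lparr>fspace = {f. (\<forall>x. x \<notin> D \<longrightarrow> f x = 0) \<and> (\<exists>a. l2_expansion D e f a)},
      fip = (\<lambda>f g. \<Sum>\<^sub>\<infinity>i. l2_coeffs D e f i * cnj (l2_coeffs D e g i))\<rparr>"

definition disk :: "complex set" where
  "disk = ball 0 1"

definition hardy_disk :: "complex function_space" where
  "hardy_disk = hardy disk (\<lambda>n z. z ^ n)"

definition hardy_bidisk :: "(complex \<times> complex) function_space" where
  "hardy_bidisk = hardy (disk \<times> disk) (\<lambda>(m, n) (z1, z2). z1 ^ m * z2 ^ n)"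

definition mult_op :: "('a \<Rightarrow> complex) \<Rightarrow> ('a \<Rightarrow> complex) \<Rightarrow> 'a \<Rightarrow> complex" where
  "mult_op h f = (\<lambda>x. h x * f x)"

definition inner_function :: "(complex \<Rightarrow> complex) \<Rightarrow> bool" where
  "inner_function \<phi> \<longleftrightarrow>
     \<phi> holomorphic_on disk \<and> bounded (\<phi> ` disk) \<and>
     (AE t in lborel. t \<in> {0..2 * pi} \<longrightarrow>
        (\<exists>l. norm l = 1 \<and> ((\<lambda>r. \<phi> (complex_of_real r * cis t)) \<longlongrightarrow> l) (at_left 1)))"

definition model_space :: "'a function_space \<Rightarrow> ('a \<Rightarrow> complex) \<Rightarrow> ('a \<Rightarrow> complex) set" where
  "model_space H \<theta> = ominus H (fspace H) (mult_op \<theta> ` fspace H)"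

text \<open>With \<open>p\<close> the coordinate function, \<open>P T\<^sub>p\<close> for the projection \<open>P\<close> onto the model space of \<open>\<theta>\<close>.\<close>

definition compressed_mult ::
  "'a function_space \<Rightarrow> ('a \<Rightarrow> complex) \<Rightarrow> ('a \<Rightarrow> complex) \<Rightarrow> ('a \<Rightarrow> complex) \<Rightarrow> 'a \<Rightarrow> complex" where
  "compressed_mult H \<theta> p f = orth_proj H (model_space H \<theta>) (mult_op p f)"


section \<open>Subspaces of the model space on the bidisk\<close>

definition K_space :: "(complex \<times> complex \<Rightarrow> complex) \<Rightarrow> (complex \<times> complex \<Rightarrow> complex) set" where
  "K_space \<theta> = model_space hardy_bidisk \<theta>"

definition S_z1 ::
  "(complex \<times> complex \<Rightarrow> complex) \<Rightarrow> (complex \<times> complex \<Rightarrow> complex) \<Rightarrow> complex \<times> complex \<Rightarrow> complex" where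
  "S_z1 \<theta> = compressed_mult hardy_bidisk \<theta> fst"

definition S_z2 ::
  "(complex \<times> complex \<Rightarrow> complex) \<Rightarrow> (complex \<times> complex \<Rightarrow> complex) \<Rightarrow> complex \<times> complex \<Rightarrow> complex" where
  "S_z2 \<theta> = compressed_mult hardy_bidisk \<theta> snd"

definition Smax1 :: "(complex \<times> complex \<Rightarrow> complex) \<Rightarrow> (complex \<times> complex \<Rightarrow> complex) set" where
  "Smax1 \<theta> =
     (GREATEST M. closed_subspace hardy_bidisk M \<and> M \<subseteq> K_space \<theta> \<and> mult_op fst ` M \<subseteq> M)"

definition Smax2 :: "(complex \<times> complex \<Rightarrow> complex) \<Rightarrow> (complex \<times> complex \<Rightarrow> complex) set" where
  "Smax2 \<theta> =
     (GREATEST M. closed_subspace hardy_bidisk M \<and> M \<subseteq> K_space \<theta> \<and> mult_op snd ` M \<subseteq> M)"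

definition Smin1 :: "(complex \<times> complex \<Rightarrow> complex) \<Rightarrow> (complex \<times> complex \<Rightarrow> complex) set" where
  "Smin1 \<theta> = ominus hardy_bidisk (K_space \<theta>) (Smax2 \<theta>)"

definition Smin2 :: "(complex \<times> complex \<Rightarrow> complex) \<Rightarrow> (complex \<times> complex \<Rightarrow> complex) set" where
  "Smin2 \<theta> = ominus hardy_bidisk (K_space \<theta>) (Smax1 \<theta>)"


section \<open>Tensor products\<close>

text \<open>The first factor is always the one in the variable \<open>z1\<close>, the second the one in \<open>z2\<close>.\<close>

definition elem_tensor ::
  "(complex \<Rightarrow> complex) \<Rightarrow> (complex \<Rightarrow> complex) \<Rightarrow> complex \<times> complex \<Rightarrow> complex" where
  "elem_tensor f g = (\<lambda>(z1, z2). f z1 * g z2)"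

definition tensor_space ::
  "(complex \<Rightarrow> complex) set \<Rightarrow> (complex \<Rightarrow> complex) set \<Rightarrow> (complex \<times> complex \<Rightarrow> complex) set" where
  "tensor_space M N = fclosure hardy_bidisk (fvs.span {elem_tensor f g |f g. f \<in> M \<and> g \<in> N})"

text \<open>
  For \<open>A\<close> on \<open>M\<close> and \<open>B\<close> on \<open>N\<close>, the operator \<open>A \<otimes> B\<close> on \<open>M \<otimes> N\<close>: the bounded linear
  operator there that is determined by its values \<open>A f \<otimes> B g\<close> on elementary tensors.
\<close>

definition tensor_op ::
  "(complex \<Rightarrow> complex) set \<Rightarrow> (complex \<Rightarrow> complex) set \<Rightarrow>
   ((complex \<Rightarrow> complex) \<Rightarrow> complex \<Rightarrow> complex) \<Rightarrow> ((complex \<Rightarrow> complex) \<Rightarrow> complex \<Rightarrow> complex) \<Rightarrow>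
   (complex \<times> complex \<Rightarrow> complex) \<Rightarrow> complex \<times> complex \<Rightarrow> complex" where
  "tensor_op M N A B =
     (THE T. T \<in> extensional (tensor_space M N) \<and>
        bounded_linear_map hardy_bidisk (tensor_space M N) T \<and>
        (\<forall>f\<in>M. \<forall>g\<in>N. T (elem_tensor f g) = elem_tensor (A f) (B g)))"

end

theory Submission
  imports Defs "HOL-Complex_Analysis.Complex_Analysis"
begin

text \<open>
  Dominated convergence along circles \<open>|z| = r\<close>, \<open>r \<rightarrow> 1\<close>, turns the unimodular boundary values of
  an inner function \<open>\<phi>\<close> into the orthonormality of \<open>\<phi>, z \<phi>, z\<^sup>2 \<phi>, \<dots>\<close>, so multiplication by \<open>\<phi>\<close> is
  an isometry \<open>V\<close> and \<open>1 - V V\<^sup>*\<close> is the projection onto the model space of \<open>\<phi>\<close>. On the bidisk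
  the projections \<open>P\<close> and \<open>Q\<close> onto the ranges of \<open>\<phi>(z1)\<close> and \<open>\<psi>(z2)\<close> act in different variables;
  hence they commute, \<open>P\<^sub>\<theta> = 1 - P Q\<close>, and \<open>Q\<close> commutes with multiplication by \<open>z1\<close>. Then
  \<open>Smax1 = ker Q\<close> and \<open>Smin2 = ran ((1 - P) Q)\<close>, on which \<open>S_z1\<close> acts as \<open>z1\<close> and as \<open>(1 - P) z1\<close>.
  A subspace of the model space invariant under \<open>z1\<close> lies in \<open>ker Q\<close> because \<open>P z1\<^sup>n g = 0\<close> for all
  \<open>n\<close> forces \<open>g = 0\<close>: \<open>z\<^sup>N\<close> approaches the range of \<open>V\<close> as \<open>N \<rightarrow> \<infinity>\<close>.
\<close>

section \<open>Operators on spaces with an inner product\<close>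

text \<open>The inner products are defined through Taylor coefficients, so boundary values enter
  only once, to show that the Toeplitz columns of an inner function are orthonormal. After that
  everything takes place on square-summable families. There the adjoint of a bounded operator can be
  written down entry by entry, and this takes the place of the projection theorem. A family with two
  indices is a sequence of rows, so an operator in one variable acts row by row or, after exchanging
  the indices, column by column; that operators in different variables commute is then checked on
  unit families, which are elementary tensors. The greatest invariant subspace, the orthogonal
  projection and \<open>tensor_op\<close> are definite descriptions, so each needs an explicit
  candidate and a uniqueness argument. For \<open>tensor_op\<close> the candidate is the restriction
  of an operator on the whole space, and uniqueness is the density of elementary tensors. Both
  matrices come from one abstract argument about commuting projections, applied twice with the
  projections exchanged.\<close>

lemma mult_cnj: "z * cnj z = complex_of_real ((cmod z)\<^sup>2)"
  by (rule complex_norm_square[symmetric])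

text \<open>Coefficient spaces and Hardy spaces alike are carriers inside a function type, so the
  axioms are relative to \<open>fspace H\<close>. They concern the inner product alone; projections
  will be constructed as explicit operators.\<close>

locale ip_space =
  fixes H :: "'a function_space"
  assumes subspace: "fvs.subspace (fspace H)"
    and ip_add: "\<And>f g h. f \<in> fspace H \<Longrightarrow> g \<in> fspace H \<Longrightarrow> h \<in> fspace H \<Longrightarrow>
      fip H (f + g) h = fip H f h + fip H g h"
    and ip_scale: "\<And>c f h. f \<in> fspace H \<Longrightarrow> h \<in> fspace H \<Longrightarrow> fip H (fscale c f) h = c * fip H f h"
    and ip_sym: "\<And>f g. f \<in> fspace H \<Longrightarrow> g \<in> fspace H \<Longrightarrow> fip H g f = cnj (fip H f g)"
    and ip_nonneg: "\<And>f. f \<in> fspace H \<Longrightarrow> 0 \<le> Re (fip H f f)"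
    and ip_definite: "\<And>f. f \<in> fspace H \<Longrightarrow> fip H f f = 0 \<Longrightarrow> f = 0"
begin

section \<open>Calculus of the inner product and the norm\<close>

lemma mem_add [simp]: "f \<in> fspace H \<Longrightarrow> g \<in> fspace H \<Longrightarrow> f + g \<in> fspace H"
  and mem_diff [simp]: "f \<in> fspace H \<Longrightarrow> g \<in> fspace H \<Longrightarrow> f - g \<in> fspace H"
  and mem_scale [simp]: "f \<in> fspace H \<Longrightarrow> fscale c f \<in> fspace H"
  and mem_zero [simp]: "0 \<in> fspace H"
  using subspace fvs.subspace_add fvs.subspace_diff fvs.subspace_scale fvs.subspace_0 by blast+

lemma ip_diff: "f \<in> fspace H \<Longrightarrow> g \<in> fspace H \<Longrightarrow> h \<in> fspace H \<Longrightarrow>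
    fip H (f - g) h = fip H f h - fip H g h"
  by (metis add_diff_cancel_right' diff_add_cancel ip_add mem_diff)

lemma ip_zero [simp]: "f \<in> fspace H \<Longrightarrow> fip H 0 f = 0"
  using ip_diff[of f f f] by simp

lemma ip_zero_right [simp]: "f \<in> fspace H \<Longrightarrow> fip H f 0 = 0"
  by (metis complex_cnj_zero ip_sym ip_zero mem_zero)

lemma ip_add_right: "f \<in> fspace H \<Longrightarrow> g \<in> fspace H \<Longrightarrow> h \<in> fspace H \<Longrightarrow>
    fip H h (f + g) = fip H h f + fip H h g"
  by (metis complex_cnj_add ip_add ip_sym mem_add)

lemma ip_diff_right: "f \<in> fspace H \<Longrightarrow> g \<in> fspace H \<Longrightarrow> h \<in> fspace H \<Longrightarrow>
    fip H h (f - g) = fip H h f - fip H h g"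
  by (metis complex_cnj_diff ip_diff ip_sym mem_diff)

lemma ip_scale_right: "f \<in> fspace H \<Longrightarrow> h \<in> fspace H \<Longrightarrow> fip H h (fscale c f) = cnj c * fip H h f"
  by (metis complex_cnj_mult ip_scale ip_sym mem_scale)

lemma fnorm_nonneg [simp]: "f \<in> fspace H \<Longrightarrow> 0 \<le> fnorm H f"
  by (simp add: fnorm_def ip_nonneg)

lemma ip_self: "f \<in> fspace H \<Longrightarrow> fip H f f = complex_of_real ((fnorm H f)\<^sup>2)"
  using ip_sym[of f f] ip_nonneg[of f]
  by (simp add: fnorm_def complex_eq_iff)

lemma fnorm_zero [simp]: "fnorm H 0 = 0"
  by (simp add: fnorm_def)

lemma fnorm_eq_0: "f \<in> fspace H \<Longrightarrow> fnorm H f = 0 \<Longrightarrow> f = 0"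
  by (rule ip_definite) (simp_all add: ip_self)

lemma fnorm_scale: "f \<in> fspace H \<Longrightarrow> fnorm H (fscale c f) = cmod c * fnorm H f"
proof -
  assume f: "f \<in> fspace H"
  have "fip H (fscale c f) (fscale c f) = (c * cnj c) * fip H f f"
    using f by (simp add: ip_scale ip_scale_right)
  also have "\<dots> = complex_of_real ((cmod c * fnorm H f)\<^sup>2)"
    using f by (simp add: ip_self complex_norm_square[symmetric] power_mult_distrib
        flip: of_real_power)
  finally have "Re (fip H (fscale c f) (fscale c f)) = (cmod c * fnorm H f)\<^sup>2"
    by (metis Re_complex_of_real)
  then show ?thesis
    unfolding fnorm_def[of H "fscale c f"] using f by simp
qed

lemma fnorm_minus_commute: "f \<in> fspace H \<Longrightarrow> g \<in> fspace H \<Longrightarrow> fnorm H (f - g) = fnorm H (g - f)"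
proof -
  assume "f \<in> fspace H" "g \<in> fspace H"
  moreover have "f - g = fscale (-1) (g - f)" by (simp add: fscale_def fun_eq_iff)
  ultimately show ?thesis using fnorm_scale[of "g - f" "-1"] by simp
qed

lemma Cauchy_Schwarz:
  assumes f: "f \<in> fspace H" and g: "g \<in> fspace H"
  shows "cmod (fip H f g) \<le> fnorm H f * fnorm H g"
proof (cases "g = 0")
  case True
  then show ?thesis using f by simp
next
  case False
  define N where "N = (fnorm H g)\<^sup>2"
  have N: "N > 0" using False g fnorm_eq_0 unfolding N_def by force
  \<comment> \<open>\<open>fscale c g\<close> is the orthogonal projection of \<open>f\<close> onto
    the line through \<open>g\<close>. The inequality says that the squared norm of the remainder
    \<open>?h\<close> is nonnegative.\<close>
  define c where "c = fip H f g / N"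
  let ?h = "f - fscale c g"
  have gf: "fip H g f = cnj (fip H f g)" using f g by (rule ip_sym)
  have "fip H ?h ?h = fip H f f - cnj c * fip H f g - c * cnj (fip H f g) + c * cnj c * N"
    using f g ip_self[of g]
    by (simp add: ip_diff[of f "fscale c g"] ip_diff_right[of f "fscale c g"] ip_scale ip_scale_right gf N_def algebra_simps
        del: of_real_power)
  also have "\<dots> = fip H f f - (fip H f g * cnj (fip H f g)) / N"
    using N by (simp add: c_def field_simps)
  also have "\<dots> = complex_of_real ((fnorm H f)\<^sup>2 - (cmod (fip H f g))\<^sup>2 / N)"
    using f by (simp add: ip_self mult_cnj)
  finally have "0 \<le> (fnorm H f)\<^sup>2 - (cmod (fip H f g))\<^sup>2 / N"
    using ip_nonneg[of ?h] f g by (metis Re_complex_of_real mem_diff mem_scale)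
  then have "(cmod (fip H f g))\<^sup>2 \<le> (fnorm H f * fnorm H g)\<^sup>2"
    using N by (simp add: field_simps power_mult_distrib N_def)
  then show ?thesis using f g by (meson fnorm_nonneg mult_nonneg_nonneg power2_le_imp_le)
qed

lemma fnorm_triangle:
  assumes f: "f \<in> fspace H" and g: "g \<in> fspace H"
  shows "fnorm H (f + g) \<le> fnorm H f + fnorm H g"
proof -
  have "fip H (f + g) (f + g) = fip H f f + fip H g g + (fip H f g + cnj (fip H f g))"
    using f g ip_sym[of f g] by (simp add: ip_add ip_add_right)
  then have "Re (fip H (f + g) (f + g)) = (fnorm H f)\<^sup>2 + (fnorm H g)\<^sup>2 + 2 * Re (fip H f g)"
    using f g by (simp add: ip_self)
  moreover have "Re (fip H f g) \<le> fnorm H f * fnorm H g"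
    using Cauchy_Schwarz[OF f g] complex_Re_le_cmod order_trans by blast
  moreover have "Re (fip H (f + g) (f + g)) = (fnorm H (f + g))\<^sup>2"
    using f g by (simp add: ip_self)
  ultimately have "(fnorm H (f + g))\<^sup>2 \<le> (fnorm H f + fnorm H g)\<^sup>2"
    by (simp add: power2_sum)
  then show ?thesis
    using f g by (meson add_nonneg_nonneg fnorm_nonneg power2_le_imp_le)
qed

lemma fnorm_diff_triangle:
  assumes "f \<in> fspace H" "g \<in> fspace H" "h \<in> fspace H"
  shows "fnorm H (f - h) \<le> fnorm H (f - g) + fnorm H (g - h)"
  using fnorm_triangle[of "f - g" "g - h"] assms by simp

lemma ip_sum:
  assumes "finite F" "\<And>i. i \<in> F \<Longrightarrow> v i \<in> fspace H" "h \<in> fspace H"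
  shows "fip H (\<Sum>i\<in>F. v i) h = (\<Sum>i\<in>F. fip H (v i) h)" (is "?ip F")
    and mem_sum: "(\<Sum>i\<in>F. v i) \<in> fspace H"
proof -
  have "?ip F \<and> (\<Sum>i\<in>F. v i) \<in> fspace H"
    using assms by (induction F rule: finite_induct) (auto simp: ip_add)
  then show "?ip F" "(\<Sum>i\<in>F. v i) \<in> fspace H" by auto
qed

lemma ip_sum_right:
  assumes "finite F" "\<And>i. i \<in> F \<Longrightarrow> v i \<in> fspace H" "h \<in> fspace H"
  shows "fip H h (\<Sum>i\<in>F. v i) = (\<Sum>i\<in>F. fip H h (v i))"
proof -
  have "fip H h (\<Sum>i\<in>F. v i) = cnj (\<Sum>i\<in>F. fip H (v i) h)"
    using ip_sum[OF assms] ip_sym[of "\<Sum>i\<in>F. v i" h] mem_sum[OF assms] assms by simp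
  also have "\<dots> = (\<Sum>i\<in>F. fip H h (v i))"
    using assms ip_sym[of _ h] by (simp add: ip_sym[of _ h])
  finally show ?thesis .
qed

lemma limit_unique:
  assumes "f \<in> fspace H" "g \<in> fspace H" "\<And>n. s n \<in> fspace H"
    and "(\<lambda>n. fnorm H (s n - f)) \<longlonglongrightarrow> 0" "(\<lambda>n. fnorm H (s n - g)) \<longlonglongrightarrow> 0"
  shows "f = g"
proof -
  have "(\<lambda>n. fnorm H (s n - f) + fnorm H (s n - g)) \<longlonglongrightarrow> 0 + 0"
    using assms by (intro tendsto_add)
  moreover have "fnorm H (f - g) \<le> fnorm H (s n - f) + fnorm H (s n - g)" for n
    using fnorm_diff_triangle[of f "s n" g] assms fnorm_minus_commute[of f "s n"] by simp
  ultimately have "fnorm H (f - g) \<le> 0"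
    by (simp add: LIMSEQ_le_const)
  then have "f - g = 0"
    using assms by (intro fnorm_eq_0) (auto intro: antisym)
  then show ?thesis by simp
qed

lemma ip_limit:
  assumes "f \<in> fspace H" "g \<in> fspace H" "\<And>n. s n \<in> fspace H"
    and "(\<lambda>n. fnorm H (s n - f)) \<longlonglongrightarrow> 0"
  shows "(\<lambda>n. fip H (s n) g) \<longlonglongrightarrow> fip H f g"
proof -
  have "(\<lambda>n. fip H (s n) g - fip H f g) \<longlonglongrightarrow> 0"
  proof (rule Lim_null_comparison)
    show "\<forall>\<^sub>F n in sequentially. norm (fip H (s n) g - fip H f g) \<le> fnorm H (s n - f) * fnorm H g"
      using assms Cauchy_Schwarz[of "s _ - f" g] by (simp add: ip_diff)
    show "(\<lambda>n. fnorm H (s n - f) * fnorm H g) \<longlonglongrightarrow> 0"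
      using tendsto_mult_right[OF assms(4), of "fnorm H g"] by simp
  qed
  then show ?thesis by (simp add: LIM_zero_iff)
qed

lemma ip_limit_right:
  assumes "f \<in> fspace H" "g \<in> fspace H" "\<And>n. s n \<in> fspace H"
    and "(\<lambda>n. fnorm H (s n - f)) \<longlonglongrightarrow> 0"
  shows "(\<lambda>n. fip H g (s n)) \<longlonglongrightarrow> fip H g f"
proof -
  have "(\<lambda>n. cnj (fip H (s n) g)) \<longlonglongrightarrow> cnj (fip H f g)"
    using ip_limit[OF assms] by (rule tendsto_cnj)
  then show ?thesis
    using assms ip_sym[of f g] ip_sym[of "s _" g] by simp
qed

section \<open>Algebra and continuity of bounded operators\<close>

abbreviation operator :: "(('a \<Rightarrow> complex) \<Rightarrow> 'a \<Rightarrow> complex) \<Rightarrow> bool" where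
  "operator \<equiv> bounded_linear_map H (fspace H)"

lemma operatorD:
  assumes "operator T"
  shows op_mem: "f \<in> fspace H \<Longrightarrow> T f \<in> fspace H"
    and op_add: "f \<in> fspace H \<Longrightarrow> g \<in> fspace H \<Longrightarrow> T (f + g) = T f + T g"
    and op_scale: "f \<in> fspace H \<Longrightarrow> T (fscale c f) = fscale c (T f)"
  using assms by (auto simp: bounded_linear_map_def)

text \<open>On a trivial space the constant in \<open>bounded_linear_map\<close> may be negative.
  Replacing it by \<open>max C 0\<close> allows bounds to be composed by monotonicity of
  multiplication.\<close>

lemma op_bound:
  assumes "operator T"
  obtains C where "C \<ge> 0" "\<And>f. f \<in> fspace H \<Longrightarrow> fnorm H (T f) \<le> C * fnorm H f"
proof -
  obtain C where C: "\<And>f. f \<in> fspace H \<Longrightarrow> fnorm H (T f) \<le> C * fnorm H f"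
    using assms unfolding bounded_linear_map_def by metis
  show ?thesis
  proof (rule that[of "max C 0"])
    fix f assume f: "f \<in> fspace H"
    have "C * fnorm H f \<le> max C 0 * fnorm H f"
      using f by (intro mult_right_mono) auto
    then show "fnorm H (T f) \<le> max C 0 * fnorm H f" using C[OF f] by linarith
  qed simp
qed

lemma operatorI:
  assumes "\<And>f. f \<in> fspace H \<Longrightarrow> T f \<in> fspace H"
    and "\<And>f g. f \<in> fspace H \<Longrightarrow> g \<in> fspace H \<Longrightarrow> T (f + g) = T f + T g"
    and "\<And>c f. f \<in> fspace H \<Longrightarrow> T (fscale c f) = fscale c (T f)"
    and "\<And>f. f \<in> fspace H \<Longrightarrow> fnorm H (T f) \<le> C * fnorm H f"
  shows "operator T"
  unfolding bounded_linear_map_def using assms by blast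

lemma op_diff:
  assumes "operator T" "f \<in> fspace H" "g \<in> fspace H"
  shows "T (f - g) = T f - T g"
  using op_add[OF assms(1), of "f - g" g] assms by simp

lemma op_zero: "operator T \<Longrightarrow> T 0 = 0"
  using op_diff[of T 0 0] by simp

lemma op_sum:
  assumes T: "operator T" and F: "finite F" and v: "\<And>i. i \<in> F \<Longrightarrow> v i \<in> fspace H"
  shows "T (\<Sum>i\<in>F. fscale (c i) (v i)) = (\<Sum>i\<in>F. fscale (c i) (T (v i)))"
proof -
  have "(\<Sum>i\<in>F. fscale (c i) (v i)) \<in> fspace H \<and> ?thesis"
    using F v operatorD[OF T] op_zero[OF T] by (induction F rule: finite_induct) auto
  then show ?thesis ..
qed

lemma operator_id: "operator (\<lambda>f. f)"
  by (rule operatorI[where C = 1]) auto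

lemma operator_comp:
  assumes T: "operator T" and U: "operator U"
  shows "operator (\<lambda>f. T (U f))"
proof -
  obtain C where C: "C \<ge> 0" "\<And>f. f \<in> fspace H \<Longrightarrow> fnorm H (T f) \<le> C * fnorm H f"
    using op_bound[OF T] by blast
  obtain D where D: "D \<ge> 0" "\<And>f. f \<in> fspace H \<Longrightarrow> fnorm H (U f) \<le> D * fnorm H f"
    using op_bound[OF U] by blast
  show ?thesis
  proof (rule operatorI[where C = "C * D"])
    fix f assume f: "f \<in> fspace H"
    have "fnorm H (T (U f)) \<le> C * fnorm H (U f)" using C op_mem[OF U f] by blast
    also have "\<dots> \<le> C * (D * fnorm H f)" using C D f by (intro mult_left_mono) auto
    finally show "fnorm H (T (U f)) \<le> C * D * fnorm H f" by (simp add: mult.assoc)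
  qed (use operatorD[OF T] operatorD[OF U] in auto)
qed

lemma operator_diff:
  assumes T: "operator T" and U: "operator U"
  shows "operator (\<lambda>f. T f - U f)"
proof -
  obtain C where C: "C \<ge> 0" "\<And>f. f \<in> fspace H \<Longrightarrow> fnorm H (T f) \<le> C * fnorm H f"
    using op_bound[OF T] by blast
  obtain D where D: "D \<ge> 0" "\<And>f. f \<in> fspace H \<Longrightarrow> fnorm H (U f) \<le> D * fnorm H f"
    using op_bound[OF U] by blast
  show ?thesis
  proof (rule operatorI[where C = "C + D"])
    fix f assume f: "f \<in> fspace H"
    have "fnorm H (T f - U f) \<le> fnorm H (T f - 0) + fnorm H (0 - U f)"
      using f op_mem[OF T] op_mem[OF U] by (intro fnorm_diff_triangle) auto
    also have "\<dots> = fnorm H (T f) + fnorm H (U f)"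
      using fnorm_minus_commute[of 0 "U f"] f op_mem[OF U] by simp
    finally show "fnorm H (T f - U f) \<le> (C + D) * fnorm H f"
      using C(2)[OF f] D(2)[OF f] by (simp add: algebra_simps)
  next
    fix c f assume f: "f \<in> fspace H"
    show "T (fscale c f) - U (fscale c f) = fscale c (T f - U f)"
      using f operatorD[OF T] operatorD[OF U] by (simp add: fvs.scale_right_diff_distrib)
  qed (use operatorD[OF T] operatorD[OF U] in auto)
qed

lemma op_limit:
  assumes T: "operator T" and f: "f \<in> fspace H" and s: "\<And>n. s n \<in> fspace H"
    and lim: "(\<lambda>n. fnorm H (s n - f)) \<longlonglongrightarrow> 0"
  shows "(\<lambda>n. fnorm H (T (s n) - T f)) \<longlonglongrightarrow> 0"
proof -
  obtain C where C: "C \<ge> 0" "\<And>f. f \<in> fspace H \<Longrightarrow> fnorm H (T f) \<le> C * fnorm H f"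
    using op_bound[OF T] by blast
  show ?thesis
  proof (rule Lim_null_comparison)
    show "\<forall>\<^sub>F n in sequentially. norm (fnorm H (T (s n) - T f)) \<le> C * fnorm H (s n - f)"
      using C f s op_mem[OF T] by (simp add: op_diff[OF T, symmetric])
    show "(\<lambda>n. C * fnorm H (s n - f)) \<longlonglongrightarrow> 0"
      using tendsto_mult_left[OF lim, of C] by simp
  qed
qed

text \<open>The model space and both summands of it will be written as kernels of operators, so this
  is the source of all closedness claims.\<close>

lemma closed_subspace_kernel:
  assumes T: "operator T"
  shows "closed_subspace H {f \<in> fspace H. T f = 0}"
  unfolding closed_subspace_def
proof (intro conjI)
  show "fvs.subspace {f \<in> fspace H. T f = 0}"
    using operatorD[OF T] op_zero[OF T] by (auto simp: fvs.subspace_def)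
  show "fclosure H {f \<in> fspace H. T f = 0} \<subseteq> {f \<in> fspace H. T f = 0}"
  proof
    fix f assume "f \<in> fclosure H {f \<in> fspace H. T f = 0}"
    then obtain s where f: "f \<in> fspace H" and s: "\<And>n. s n \<in> fspace H" "\<And>n. T (s n) = 0"
      and lim: "(\<lambda>n. fnorm H (s n - f)) \<longlonglongrightarrow> 0"
      by (auto simp: fclosure_def)
    have "T f = 0"
      using limit_unique[of "T f" 0 "\<lambda>n. T (s n)"] op_limit[OF T f s(1) lim] f s op_mem[OF T]
      by simp
    then show "f \<in> {f \<in> fspace H. T f = 0}" using f by simp
  qed
qed auto

text \<open>The set where \<open>T\<close> and \<open>U\<close> agree is the kernel of
  \<open>T - U\<close>, a closed subspace, so it absorbs the span of \<open>M\<close> and its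
  closure.\<close>

lemma op_eq_on_closure:
  assumes T: "operator T" and U: "operator U" and M: "M \<subseteq> fspace H"
    and eq: "\<And>f. f \<in> M \<Longrightarrow> T f = U f" and f: "f \<in> fclosure H (fvs.span M)"
  shows "T f = U f"
proof -
  let ?K = "{f \<in> fspace H. T f - U f = 0}"
  have K: "closed_subspace H ?K"
    using closed_subspace_kernel[OF operator_diff[OF T U]] .
  then have "fvs.span M \<subseteq> ?K"
    using M eq by (intro fvs.span_minimal) (auto simp: closed_subspace_def)
  then have "fclosure H (fvs.span M) \<subseteq> fclosure H ?K"
    unfolding fclosure_def by blast
  then have "f \<in> ?K" using K f by (auto simp: closed_subspace_def)
  then show ?thesis by simp
qed

text \<open>Two candidates for the projection differ by an element of \<open>M\<close> that is
  orthogonal to itself. This resolves the definite description in \<open>orth_proj\<close>.\<close>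

lemma orth_proj_eq:
  assumes M: "M \<subseteq> fspace H" and f: "f \<in> fspace H" and g: "g \<in> M"
    and orth: "\<And>h. h \<in> M \<Longrightarrow> fip H (f - g) h = 0"
    and sub: "fvs.subspace M"
  shows "orth_proj H M f = g"
  unfolding orth_proj_def
proof (rule the_equality)
  fix g' assume g': "g' \<in> M \<and> (\<forall>h\<in>M. fip H (f - g') h = 0)"
  have d: "g - g' \<in> M" using g g' sub fvs.subspace_diff by blast
  have mem: "g \<in> fspace H" "g' \<in> fspace H" using g g' M by auto
  have "fip H (g - g') (g - g') = fip H (f - g') (g - g') - fip H (f - g) (g - g')"
    using mem f by (simp add: ip_diff ip_diff_right)
  also have "\<dots> = 0" using orth[OF d] g' d by auto
  finally show "g' = g" using ip_definite[of "g - g'"] mem by simp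
qed (use assms in auto)

end

section \<open>Square-summable families\<close>

text \<open>The record of the Hardy spaces is reused, with the index type in the role of the domain,
  so that one theory of operators covers coefficients and functions.\<close>

definition ell2 :: "'i function_space" where
  "ell2 = \<lparr>fspace = {a. (\<lambda>i. (norm (a i))\<^sup>2) summable_on UNIV},
           fip = (\<lambda>a b. \<Sum>\<^sub>\<infinity>i. a i * cnj (b i))\<rparr>"

lemma mem_ell2: "a \<in> fspace ell2 \<longleftrightarrow> (\<lambda>i. (norm (a i))\<^sup>2) summable_on UNIV"
  by (simp add: ell2_def)

lemma fip_ell2: "fip ell2 a b = (\<Sum>\<^sub>\<infinity>i. a i * cnj (b i))"
  by (simp add: ell2_def)

lemma ell2_abs_summable:
  assumes "a \<in> fspace ell2" "b \<in> fspace ell2"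
  shows "(\<lambda>i. norm (a i * cnj (b i))) summable_on UNIV"
proof (rule abs_summable_product)
  show "(\<lambda>i. norm (a i * a i)) summable_on UNIV"
    using assms(1) unfolding mem_ell2 power2_eq_square norm_mult .
  show "(\<lambda>i. norm (cnj (b i) * cnj (b i))) summable_on UNIV"
    using assms(2) unfolding mem_ell2 power2_eq_square norm_mult complex_mod_cnj .
qed

lemma ell2_has_sum:
  assumes "a \<in> fspace ell2" "b \<in> fspace ell2"
  shows "((\<lambda>i. a i * cnj (b i)) has_sum fip ell2 a b) UNIV"
  unfolding fip_ell2 using abs_summable_summable[OF ell2_abs_summable[OF assms]] by simp

lemma ell2_norm_has_sum:
  assumes "a \<in> fspace ell2"
  shows "((\<lambda>i. (norm (a i))\<^sup>2) has_sum Re (fip ell2 a a)) UNIV"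
  using has_sum_Re[OF ell2_has_sum[OF assms assms]] by (simp add: mult_cnj flip: of_real_power)

lemma ell2_add:
  assumes "a \<in> fspace ell2" "b \<in> fspace ell2"
  shows "a + b \<in> fspace ell2"
proof -
  have "(\<lambda>i. 2 * (norm (a i))\<^sup>2 + 2 * (norm (b i))\<^sup>2) summable_on UNIV"
    using assms by (intro summable_on_add summable_on_cmult_right) (auto simp: mem_ell2)
  moreover have "(norm ((a + b) i))\<^sup>2 \<le> 2 * (norm (a i))\<^sup>2 + 2 * (norm (b i))\<^sup>2" for i
  proof -
    have "(norm ((a + b) i))\<^sup>2 \<le> (norm (a i) + norm (b i))\<^sup>2"
      by (simp add: norm_triangle_ineq power_mono)
    also have "\<dots> \<le> 2 * (norm (a i))\<^sup>2 + 2 * (norm (b i))\<^sup>2"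
      using sum_squares_bound[of "norm (a i)" "norm (b i)"] by (simp add: power2_sum)
    finally show ?thesis .
  qed
  ultimately show ?thesis
    unfolding mem_ell2 by (rule summable_on_comparison_test) auto
qed

lemma ell2_scale:
  assumes "a \<in> fspace ell2"
  shows "fscale c a \<in> fspace ell2"
  using assms summable_on_cmult_right[of "\<lambda>i. (norm (a i))\<^sup>2" UNIV "(norm c)\<^sup>2"]
  by (simp add: mem_ell2 fscale_def norm_mult power_mult_distrib)

interpretation ell2: ip_space "ell2 :: 'i function_space"
proof
  show "fvs.subspace (fspace (ell2 :: 'i function_space))"
    by (auto simp: fvs.subspace_def ell2_add ell2_scale) (simp add: mem_ell2)
next
  fix f g h :: "'i \<Rightarrow> complex" assume *: "f \<in> fspace ell2" "g \<in> fspace ell2" "h \<in> fspace ell2"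
  show "fip ell2 (f + g) h = fip ell2 f h + fip ell2 g h"
    using has_sum_add[OF ell2_has_sum[OF *(1,3)] ell2_has_sum[OF *(2,3)]] *
      ell2_has_sum[OF ell2_add[OF *(1,2)] *(3)]
    by (intro has_sum_unique) (auto simp: algebra_simps)
next
  fix c and f h :: "'i \<Rightarrow> complex" assume *: "f \<in> fspace ell2" "h \<in> fspace ell2"
  show "fip ell2 (fscale c f) h = c * fip ell2 f h"
    using has_sum_cmult_right[OF ell2_has_sum[OF *], of c]
      ell2_has_sum[OF ell2_scale[OF *(1)] *(2)]
    by (intro has_sum_unique) (auto simp: fscale_def algebra_simps)
next
  fix f g :: "'i \<Rightarrow> complex"
  show "fip ell2 g f = cnj (fip ell2 f g)"
    by (simp add: fip_ell2 mult.commute flip: infsum_cnj)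
next
  fix f :: "'i \<Rightarrow> complex" assume *: "f \<in> fspace ell2"
  show "0 \<le> Re (fip ell2 f f)"
    using ell2_norm_has_sum[OF *] by (rule has_sum_nonneg) auto
  assume "fip ell2 f f = 0"
  then show "f = 0"
    using nonneg_has_sum_le_0D[OF ell2_norm_has_sum[OF *]] by (auto simp: fun_eq_iff)
qed

lemma ell2_fnorm_has_sum:
  assumes "a \<in> fspace ell2"
  shows "((\<lambda>i. (norm (a i))\<^sup>2) has_sum (fnorm ell2 a)\<^sup>2) UNIV"
  using ell2_norm_has_sum[OF assms] by (simp add: ell2.ip_self[OF assms] flip: of_real_power)

lemma ell2_fnormI:
  assumes "((\<lambda>i. (norm (a i))\<^sup>2) has_sum s) UNIV"
  shows "a \<in> fspace ell2" "(fnorm ell2 a)\<^sup>2 = s"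
proof -
  show "a \<in> fspace ell2" using assms by (auto simp: mem_ell2 has_sum_imp_summable)
  then show "(fnorm ell2 a)\<^sup>2 = s" using assms ell2_fnorm_has_sum has_sum_unique by blast
qed

text \<open>Membership and norm bound come together. For adjoints, convolutions and the coefficients
  of inner functions, finite partial sums are what can be estimated before membership is
  known.\<close>

lemma ell2_bounded_partial_sums:
  assumes "\<And>F. finite F \<Longrightarrow> (\<Sum>i\<in>F. (norm (a i))\<^sup>2) \<le> C\<^sup>2" and "0 \<le> C"
  shows "a \<in> fspace ell2" "fnorm ell2 a \<le> C"
proof -
  show a: "a \<in> fspace ell2"
    unfolding mem_ell2
  proof (rule nonneg_bdd_above_summable_on)
    show "bdd_above (sum (\<lambda>i. (norm (a i))\<^sup>2) ` {F. F \<subseteq> UNIV \<and> finite F})"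
      using assms(1) by (intro bdd_aboveI2[where M = "C\<^sup>2"]) simp
  qed simp
  have "(fnorm ell2 a)\<^sup>2 \<le> C\<^sup>2"
    using ell2_fnorm_has_sum[OF a] by (rule has_sum_le_finite_sums) (use assms in auto)
  then show "fnorm ell2 a \<le> C" using assms(2) by (rule power2_le_imp_le)
qed

section \<open>Finitely supported families and adjoints\<close>

definition unit_fam :: "'i \<Rightarrow> 'i \<Rightarrow> complex" where
  "unit_fam i = (\<lambda>j. if j = i then 1 else 0)"

definition cut_fam :: "'i set \<Rightarrow> ('i \<Rightarrow> complex) \<Rightarrow> 'i \<Rightarrow> complex" where
  "cut_fam F a = (\<lambda>i. if i \<in> F then a i else 0)"

lemma cut_fam_has_sum:
  assumes "finite F"
  shows "((\<lambda>i. (norm (cut_fam F a i))\<^sup>2) has_sum (\<Sum>i\<in>F. (norm (a i))\<^sup>2)) UNIV"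
  using assms by (intro has_sum_finite_neutralI[of F]) (auto simp: cut_fam_def)

lemmas cut_fam_mem [simp] = ell2_fnormI(1)[OF cut_fam_has_sum]
  and fnorm_cut_fam = ell2_fnormI(2)[OF cut_fam_has_sum]

lemma unit_fam_mem [simp]: "unit_fam i \<in> fspace ell2"
  using cut_fam_mem[of "{i}" "\<lambda>_. 1"] by (simp add: cut_fam_def unit_fam_def)

lemma cut_fam_eq_sum:
  assumes "finite F"
  shows "cut_fam F a = (\<Sum>i\<in>F. fscale (a i) (unit_fam i))"
proof
  fix x
  have "(\<Sum>i\<in>F. fscale (a i) (unit_fam i)) x = (\<Sum>i\<in>F. fscale (a i) (unit_fam i) x)"
    using assms by (induction F rule: finite_induct) auto
  also have "\<dots> = cut_fam F a x"
    using assms by (simp add: fscale_def unit_fam_def cut_fam_def if_distrib cong: if_cong)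
  finally show "cut_fam F a x = (\<Sum>i\<in>F. fscale (a i) (unit_fam i)) x" ..
qed

lemma fip_unit_fam:
  assumes "a \<in> fspace ell2"
  shows "fip ell2 a (unit_fam i) = a i"
proof -
  have "((\<lambda>j. a j * cnj (unit_fam i j)) has_sum a i) UNIV"
    by (rule has_sum_finite_neutralI[of "{i}"]) (auto simp: unit_fam_def)
  then show ?thesis using ell2_has_sum[OF assms unit_fam_mem] has_sum_unique by blast
qed

lemma fip_unit_fam_left:
  assumes "a \<in> fspace ell2"
  shows "fip ell2 (unit_fam i) a = cnj (a i)"
  using ell2.ip_sym[of a "unit_fam i"] assms by (simp add: fip_unit_fam)

lemma ell2_approx:
  assumes a: "a \<in> fspace ell2"
  obtains F where "\<And>n. finite (F n)" "(\<lambda>n. fnorm ell2 (cut_fam (F n) a - a)) \<longlonglongrightarrow> 0"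
proof -
  have ex: "\<exists>F. finite F \<and> (fnorm ell2 (cut_fam F a - a))\<^sup>2 \<le> inverse (real (Suc n))" for n
  proof -
    obtain F where F: "finite F" "dist (\<Sum>i\<in>F. (norm (a i))\<^sup>2) ((fnorm ell2 a)\<^sup>2) \<le> inverse (real (Suc n))"
      using has_sum_finite_approximation[OF ell2_fnorm_has_sum[OF a], of "inverse (real (Suc n))"] by auto
    \<comment> \<open>The truncation and the remainder have disjoint supports, so the squared norm
      of the remainder is that of \<open>a\<close> minus the partial sum.\<close>
    have eq: "(\<lambda>i. (norm (a i))\<^sup>2 + - (norm (cut_fam F a i))\<^sup>2) = (\<lambda>i. (norm ((cut_fam F a - a) i))\<^sup>2)"
      by (auto simp: cut_fam_def)
    have "(fnorm ell2 (cut_fam F a - a))\<^sup>2 = (fnorm ell2 a)\<^sup>2 + - (\<Sum>i\<in>F. (norm (a i))\<^sup>2)"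
      using has_sum_add[OF ell2_fnorm_has_sum[OF a] has_sum_uminusI[OF cut_fam_has_sum[OF F(1), of a]]]
      unfolding eq by (rule ell2_fnormI(2))
    then show ?thesis using F by (auto simp: dist_real_def intro!: exI[of _ F])
  qed
  then obtain F where F: "\<And>n. finite (F n)"
    and le: "\<And>n. (fnorm ell2 (cut_fam (F n) a - a))\<^sup>2 \<le> inverse (real (Suc n))"
    by metis
  have "(\<lambda>n. (fnorm ell2 (cut_fam (F n) a - a))\<^sup>2) \<longlonglongrightarrow> 0"
    by (rule Lim_null_comparison[OF _ LIMSEQ_inverse_real_of_nat]) (use le in auto)
  then have "(\<lambda>n. sqrt ((fnorm ell2 (cut_fam (F n) a - a))\<^sup>2)) \<longlonglongrightarrow> sqrt 0"
    by (rule tendsto_real_sqrt)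
  then have "(\<lambda>n. fnorm ell2 (cut_fam (F n) a - a)) \<longlonglongrightarrow> 0"
    using a F by simp
  then show ?thesis using that F by blast
qed

lemma span_unit_fam_dense:
  "fclosure ell2 (fvs.span (range unit_fam)) = fspace (ell2 :: 'i function_space)"
proof
  show "fspace ell2 \<subseteq> fclosure ell2 (fvs.span (range (unit_fam :: 'i \<Rightarrow> _)))"
  proof
    fix a :: "'i \<Rightarrow> complex" assume a: "a \<in> fspace ell2"
    then obtain F where F: "\<And>n. finite (F n)"
      and lim: "(\<lambda>n. fnorm ell2 (cut_fam (F n) a - a)) \<longlonglongrightarrow> 0"
      using ell2_approx by blast
    have "cut_fam (F n) a \<in> fvs.span (range unit_fam)" for n
      using F by (auto simp: cut_fam_eq_sum intro!: fvs.span_sum fvs.span_scale intro: fvs.span_base)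
    then show "a \<in> fclosure ell2 (fvs.span (range unit_fam))"
      unfolding fclosure_def using a lim by (auto intro!: exI[of _ "\<lambda>n. cut_fam (F n) a"])
  qed
qed (auto simp: fclosure_def)

text \<open>Reduces operator identities to unit families. It yields \<open>V\<^sup>* V = 1\<close>
  and the commutation of operators in different variables.\<close>

lemma ell2_op_eq:
  assumes "ell2.operator T" "ell2.operator U" "\<And>i. T (unit_fam i) = U (unit_fam i)" "a \<in> fspace ell2"
  shows "T a = U a"
proof (rule ell2.op_eq_on_closure[OF assms(1,2)])
  show "a \<in> fclosure ell2 (fvs.span (range unit_fam))"
    using assms(4) by (simp add: span_unit_fam_dense)
qed (use assms(3) in auto)

text \<open>The entries are forced: coordinate \<open>i\<close> of the adjoint at \<open>a\<close>
  is its inner product with \<open>unit_fam i\<close>. Writing them down avoids a representation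
  theorem for functionals.\<close>

definition adj :: "(('i \<Rightarrow> complex) \<Rightarrow> 'i \<Rightarrow> complex) \<Rightarrow> ('i \<Rightarrow> complex) \<Rightarrow> 'i \<Rightarrow> complex" where
  "adj T a = (\<lambda>i. fip ell2 a (T (unit_fam i)))"

text \<open>Each partial sum of the squares of \<open>adj T a\<close> is at most
  \<open>C * fnorm ell2 a\<close> times its own square root, which gives the bound. The adjoint
  relation holds for truncations of \<open>b\<close> by linearity and passes to the limit.\<close>

lemma
  fixes T :: "('i \<Rightarrow> complex) \<Rightarrow> 'i \<Rightarrow> complex"
  assumes T: "ell2.operator T"
  shows operator_adj: "ell2.operator (adj T)"
    and adj: "\<And>a b. a \<in> fspace ell2 \<Longrightarrow> b \<in> fspace ell2 \<Longrightarrow> fip ell2 (adj T a) b = fip ell2 a (T b)"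
proof -
  obtain C where C: "C \<ge> 0" "\<And>f. f \<in> fspace ell2 \<Longrightarrow> fnorm ell2 (T f) \<le> C * fnorm ell2 f"
    using ell2.op_bound[OF T] by blast
  note mem = ell2.op_mem[OF T]
  have trunc: "fip ell2 a (T (cut_fam F b)) = (\<Sum>i\<in>F. cnj (b i) * adj T a i)"
    if "a \<in> fspace ell2" "finite F" for a b F
    using that mem
    by (simp add: cut_fam_eq_sum ell2.op_sum[OF T] ell2.ip_sum_right ell2.ip_scale_right adj_def)
  have part: "(\<Sum>i\<in>F. (norm (adj T a i))\<^sup>2) \<le> (C * fnorm ell2 a)\<^sup>2"
    if a: "a \<in> fspace ell2" and F: "finite F" for a F
  proof -
    \<comment> \<open>Testing \<open>T\<close> on the truncation of \<open>adj T a\<close> itself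
      makes the inner product with \<open>a\<close> equal to the partial sum to be
      estimated.\<close>
    let ?b = "cut_fam F (adj T a)"
    have "complex_of_real ((fnorm ell2 ?b)\<^sup>2) = fip ell2 a (T ?b)"
      using trunc[OF a F] F by (simp add: fnorm_cut_fam mult_cnj mult.commute)
    then have "(fnorm ell2 ?b)\<^sup>2 = cmod (fip ell2 a (T ?b))"
      by (metis norm_of_real abs_of_nonneg zero_le_power2)
    also have "\<dots> \<le> fnorm ell2 a * fnorm ell2 (T ?b)"
      using a F mem by (intro ell2.Cauchy_Schwarz) auto
    also have "\<dots> \<le> fnorm ell2 a * (C * fnorm ell2 ?b)"
      using a F C by (intro mult_left_mono) auto
    finally have "fnorm ell2 ?b * fnorm ell2 ?b \<le> (C * fnorm ell2 a) * fnorm ell2 ?b"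
      by (simp add: power2_eq_square mult_ac)
    moreover have "fnorm ell2 ?b \<ge> 0" "C * fnorm ell2 a \<ge> 0" using F a C by auto
    ultimately have "fnorm ell2 ?b \<le> C * fnorm ell2 a"
      by (metis mult_right_le_imp_le order_le_less)
    then have "(fnorm ell2 ?b)\<^sup>2 \<le> (C * fnorm ell2 a)\<^sup>2"
      using F by (intro power_mono) auto
    then show ?thesis using F by (simp add: fnorm_cut_fam)
  qed
  have nn: "0 \<le> C * fnorm ell2 a" if "a \<in> fspace ell2" for a
    using that C by auto
  show op: "ell2.operator (adj T)"
  proof (rule ell2.operatorI[where C = C])
    fix c and a b :: "'i \<Rightarrow> complex"
    assume a: "a \<in> fspace ell2" and b: "b \<in> fspace ell2"
    show "adj T a \<in> fspace ell2" "fnorm ell2 (adj T a) \<le> C * fnorm ell2 a"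
      using ell2_bounded_partial_sums[OF part[OF a] nn[OF a]] by auto
    show "adj T (a + b) = adj T a + adj T b"
      using a b mem by (auto simp: adj_def ell2.ip_add fun_eq_iff)
    show "adj T (fscale c a) = fscale c (adj T a)"
      using a mem by (simp add: adj_def ell2.ip_scale) (simp add: fscale_def)
  qed
  fix a b :: "'i \<Rightarrow> complex" assume a: "a \<in> fspace ell2" and b: "b \<in> fspace ell2"
  obtain F where F: "\<And>n. finite (F n)" and lim: "(\<lambda>n. fnorm ell2 (cut_fam (F n) b - b)) \<longlonglongrightarrow> 0"
    using ell2_approx[OF b] by blast
  have "(\<lambda>n. fip ell2 (adj T a) (cut_fam (F n) b)) \<longlonglongrightarrow> fip ell2 (adj T a) b"
    using a b F lim ell2.op_mem[OF op] by (intro ell2.ip_limit_right) auto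
  moreover have "(\<lambda>n. fip ell2 a (T (cut_fam (F n) b))) \<longlonglongrightarrow> fip ell2 a (T b)"
    using a b F lim mem by (intro ell2.ip_limit_right ell2.op_limit[OF T]) auto
  moreover have "fip ell2 (adj T a) (cut_fam (F n) b) = fip ell2 a (T (cut_fam (F n) b))" for n
    using a F ell2.op_mem[OF op a]
    by (simp add: trunc) (simp add: cut_fam_eq_sum ell2.ip_sum_right ell2.ip_scale_right fip_unit_fam)
  ultimately show "fip ell2 (adj T a) b = fip ell2 a (T b)"
    using LIMSEQ_unique by auto
qed

section \<open>Operators on families with two indices\<close>

text \<open>In the bidisk, row \<open>m\<close> collects the powers of \<open>z2\<close> that
  accompany \<open>z1 ^ m\<close>.\<close>

definition fam_row :: "('i \<times> 'j \<Rightarrow> complex) \<Rightarrow> 'i \<Rightarrow> 'j \<Rightarrow> complex" where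
  "fam_row a m = (\<lambda>n. a (m, n))"

lemma row_add: "fam_row (a + b) m = fam_row a m + fam_row b m"
  and row_scale: "fam_row (fscale c a) m = fscale c (fam_row a m)"
  by (auto simp: fam_row_def fscale_def)

lemma row_eqI: "(\<And>m. fam_row a m = fam_row b m) \<Longrightarrow> a = b"
  by (auto simp: fam_row_def fun_eq_iff)

text \<open>Fubini for the squared moduli, summed along each row before summing over the
  rows.\<close>

lemma
  assumes a: "a \<in> fspace ell2"
  shows row_mem [simp]: "fam_row a m \<in> fspace ell2"
    and row_norm_has_sum: "((\<lambda>m. (fnorm ell2 (fam_row a m))\<^sup>2) has_sum (fnorm ell2 a)\<^sup>2) UNIV"
proof -
  have s: "((\<lambda>p. (norm (a p))\<^sup>2) has_sum (fnorm ell2 a)\<^sup>2) (Sigma UNIV (\<lambda>_. UNIV))"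
    using ell2_fnorm_has_sum[OF a] by simp
  have r: "fam_row a m \<in> fspace ell2" for m
    using summable_on_SigmaD1[of "\<lambda>m n. (norm (a (m, n)))\<^sup>2" UNIV "\<lambda>_. UNIV" m]
      has_sum_imp_summable[OF s]
    by (simp add: mem_ell2 fam_row_def case_prod_unfold)
  then show "fam_row a m \<in> fspace ell2" .
  show "((\<lambda>m. (fnorm ell2 (fam_row a m))\<^sup>2) has_sum (fnorm ell2 a)\<^sup>2) UNIV"
    using s by (rule has_sum_SigmaD) (use ell2_fnorm_has_sum[OF r] in \<open>simp add: fam_row_def\<close>)
qed

text \<open>Tonelli: nonnegative terms may be summed row by row to establish summability over the
  product.\<close>

lemma ell2_rowsI:
  assumes "\<And>m. fam_row a m \<in> fspace ell2" "(\<lambda>m. (fnorm ell2 (fam_row a m))\<^sup>2) summable_on UNIV"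
  shows "a \<in> fspace ell2"
proof -
  have "(\<lambda>p. (norm (a p))\<^sup>2) summable_on (Sigma UNIV (\<lambda>_. UNIV))"
    by (rule summable_on_SigmaI[where g = "\<lambda>m. (fnorm ell2 (fam_row a m))\<^sup>2"])
      (use ell2_fnorm_has_sum[OF assms(1)] assms(2) in \<open>auto simp: fam_row_def\<close>)
  then show ?thesis by (simp add: mem_ell2)
qed

lemma fip_rows_has_sum:
  assumes "a \<in> fspace ell2" "b \<in> fspace ell2"
  shows "((\<lambda>m. fip ell2 (fam_row a m) (fam_row b m)) has_sum fip ell2 a b) UNIV"
proof -
  have "((\<lambda>p. a p * cnj (b p)) has_sum fip ell2 a b) (Sigma UNIV (\<lambda>_. UNIV))"
    using ell2_has_sum[OF assms] by simp
  then show ?thesis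
    by (rule has_sum_SigmaD)
      (use ell2_has_sum[OF row_mem[OF assms(1)] row_mem[OF assms(2)]] in \<open>simp add: fam_row_def\<close>)
qed

text \<open>This is \<open>1 \<otimes> W\<close>, the operator \<open>W\<close> in the second
  variable.\<close>

definition lift2 :: "(('j \<Rightarrow> complex) \<Rightarrow> 'j \<Rightarrow> complex) \<Rightarrow> ('i \<times> 'j \<Rightarrow> complex) \<Rightarrow> 'i \<times> 'j \<Rightarrow> complex" where
  "lift2 W a = (\<lambda>(m, n). W (fam_row a m) n)"

lemma row_lift2 [simp]: "fam_row (lift2 W a) m = W (fam_row a m)"
  by (simp add: fam_row_def lift2_def)

lemma lift2_lift2: "lift2 W (lift2 U a) = lift2 (\<lambda>b. W (U b)) a"
  by (rule row_eqI) simp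

text \<open>A bound for \<open>W\<close> holds in every row with the same constant, so the squares
  add up to the same bound for the lift.\<close>

lemma operator_lift2:
  fixes W :: "('j \<Rightarrow> complex) \<Rightarrow> 'j \<Rightarrow> complex"
  assumes W: "ell2.operator W"
  shows "ell2.operator (lift2 W :: ('i \<times> 'j \<Rightarrow> complex) \<Rightarrow> _)"
proof -
  obtain C where C: "C \<ge> 0" "\<And>f. f \<in> fspace ell2 \<Longrightarrow> fnorm ell2 (W f) \<le> C * fnorm ell2 f"
    using ell2.op_bound[OF W] by blast
  show ?thesis
  proof (rule ell2.operatorI[where C = C])
    fix c and a b :: "'i \<times> 'j \<Rightarrow> complex"
    assume a: "a \<in> fspace ell2" and b: "b \<in> fspace ell2"
    have le: "(fnorm ell2 (fam_row (lift2 W a) m))\<^sup>2 \<le> C\<^sup>2 * (fnorm ell2 (fam_row a m))\<^sup>2" for m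
      using C(2)[OF row_mem[OF a], of m] ell2.op_mem[OF W row_mem[OF a], of m]
      unfolding power_mult_distrib[symmetric] row_lift2 by (intro power_mono) auto
    have s: "((\<lambda>m. C\<^sup>2 * (fnorm ell2 (fam_row a m))\<^sup>2) has_sum C\<^sup>2 * (fnorm ell2 a)\<^sup>2) UNIV"
      using row_norm_has_sum[OF a] by (rule has_sum_cmult_right)
    show mem: "lift2 W a \<in> fspace ell2"
    proof (rule ell2_rowsI)
      show "(\<lambda>m. (fnorm ell2 (fam_row (lift2 W a) m))\<^sup>2) summable_on UNIV"
        by (rule summable_on_comparison_test[OF has_sum_imp_summable[OF s]]) (use le in auto)
    qed (simp add: ell2.op_mem[OF W row_mem[OF a]])
    have "(fnorm ell2 (lift2 W a))\<^sup>2 \<le> (C * fnorm ell2 a)\<^sup>2"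
      using has_sum_mono[OF row_norm_has_sum[OF mem] s] le by (simp add: power_mult_distrib)
    then show "fnorm ell2 (lift2 W a) \<le> C * fnorm ell2 a"
      by (rule power2_le_imp_le) (use C(1) ell2.fnorm_nonneg[OF a] in simp)
    show "lift2 W (a + b) = lift2 W a + lift2 W b" "lift2 W (fscale c a) = fscale c (lift2 W a)"
      using ell2.operatorD[OF W] a b by (auto intro!: row_eqI simp: row_add row_scale)
  qed
qed

lemma fip_lift2:
  assumes "ell2.operator W" "ell2.operator U" "a \<in> fspace ell2" "b \<in> fspace ell2"
    and "\<And>u v. u \<in> fspace ell2 \<Longrightarrow> v \<in> fspace ell2 \<Longrightarrow> fip ell2 (W u) v = fip ell2 u (U v)"
  shows "fip ell2 (lift2 W a) b = fip ell2 a (lift2 U b)"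
  using fip_rows_has_sum[of "lift2 W a" b] fip_rows_has_sum[of a "lift2 U b"]
    ell2.op_mem[OF operator_lift2] assms by (auto dest: has_sum_unique)

text \<open>The flip of the two tensor factors. Conjugation with it carries every fact about the
  second index over to the first.\<close>

definition swap_fam :: "('i \<times> 'j \<Rightarrow> complex) \<Rightarrow> 'j \<times> 'i \<Rightarrow> complex" where
  "swap_fam a = a \<circ> prod.swap"

lemma swap_swap_fam [simp]: "swap_fam (swap_fam a) = a"
  by (auto simp: swap_fam_def)

lemma has_sum_swap_fam:
  fixes f :: "'i \<times> 'j \<Rightarrow> 'a :: topological_comm_monoid_add"
  shows "((\<lambda>p. f (prod.swap p)) has_sum s) UNIV \<longleftrightarrow> (f has_sum s) UNIV"
  by (rule has_sum_reindex_bij_betw) simp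

lemma swap_fam_mem_iff [simp]: "swap_fam a \<in> fspace ell2 \<longleftrightarrow> a \<in> fspace ell2"
proof -
  have "swap_fam a \<in> fspace ell2" if "a \<in> fspace ell2" for a :: "'k \<times> 'l \<Rightarrow> complex"
    using ell2_fnorm_has_sum[OF that]
    by (intro ell2_fnormI(1)[of _ "(fnorm ell2 a)\<^sup>2"]) (simp add: swap_fam_def has_sum_swap_fam[of "\<lambda>p. (norm (a p))\<^sup>2"])
  from this[of a] this[of "swap_fam a"] show ?thesis by auto
qed

lemma fip_swap_fam [simp]:
  assumes "a \<in> fspace ell2" "b \<in> fspace ell2"
  shows "fip ell2 (swap_fam a) (swap_fam b) = fip ell2 a b"
proof (rule has_sum_unique)
  show "((\<lambda>p. swap_fam a p * cnj (swap_fam b p)) has_sum fip ell2 (swap_fam a) (swap_fam b)) UNIV"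
    using assms by (intro ell2_has_sum) auto
  show "((\<lambda>p. swap_fam a p * cnj (swap_fam b p)) has_sum fip ell2 a b) UNIV"
    using ell2_has_sum[OF assms] has_sum_swap_fam[of "\<lambda>p. a p * cnj (b p)"]
    by (simp add: swap_fam_def)
qed

lemma swap_fam_add: "swap_fam (a + b) = swap_fam a + swap_fam b"
  and swap_fam_scale: "swap_fam (fscale c a) = fscale c (swap_fam a)"
  by (auto simp: swap_fam_def fscale_def)

text \<open>This is \<open>W \<otimes> 1\<close>, obtained from \<open>1 \<otimes> W\<close> by the
  flip.\<close>

definition lift1 :: "(('i \<Rightarrow> complex) \<Rightarrow> 'i \<Rightarrow> complex) \<Rightarrow> ('i \<times> 'j \<Rightarrow> complex) \<Rightarrow> 'i \<times> 'j \<Rightarrow> complex" where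
  "lift1 W a = swap_fam (lift2 W (swap_fam a))"

lemma lift1_lift1: "lift1 W (lift1 U a) = lift1 (\<lambda>b. W (U b)) a"
  by (simp add: lift1_def lift2_lift2)

lemma operator_lift1:
  fixes W :: "('i \<Rightarrow> complex) \<Rightarrow> 'i \<Rightarrow> complex"
  assumes W: "ell2.operator W"
  shows "ell2.operator (lift1 W :: ('i \<times> 'j \<Rightarrow> complex) \<Rightarrow> _)"
proof -
  have L: "ell2.operator (lift2 W :: ('j \<times> 'i \<Rightarrow> complex) \<Rightarrow> _)"
    using W by (rule operator_lift2)
  obtain C where C: "C \<ge> 0" "\<And>f :: 'j \<times> 'i \<Rightarrow> complex. f \<in> fspace ell2 \<Longrightarrow> fnorm ell2 (lift2 W f) \<le> C * fnorm ell2 f"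
    using ell2.op_bound[OF L] by blast
  have n: "fnorm ell2 (swap_fam f) = fnorm ell2 f" if "f \<in> fspace ell2" for f :: "'k \<times> 'l \<Rightarrow> complex"
    using that by (simp add: fnorm_def)
  show ?thesis
  proof (rule ell2.operatorI[where C = C])
    fix f :: "'i \<times> 'j \<Rightarrow> complex" assume f: "f \<in> fspace ell2"
    show "fnorm ell2 (lift1 W f) \<le> C * fnorm ell2 f"
      using C(2)[of "swap_fam f"] f by (simp add: lift1_def n ell2.op_mem[OF L])
  qed (use ell2.operatorD[OF L] in \<open>auto simp: lift1_def swap_fam_add swap_fam_scale\<close>)
qed

lemma fip_lift1:
  assumes "ell2.operator W" "ell2.operator U" "a \<in> fspace ell2" "b \<in> fspace ell2"
    and "\<And>u v. u \<in> fspace ell2 \<Longrightarrow> v \<in> fspace ell2 \<Longrightarrow> fip ell2 (W u) v = fip ell2 u (U v)"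
  shows "fip ell2 (lift1 W a) b = fip ell2 a (lift1 U b)"
proof -
  have "fip ell2 (lift1 W a) b = fip ell2 (lift2 W (swap_fam a)) (swap_fam b)"
    using fip_swap_fam[of "lift2 W (swap_fam a)" "swap_fam b"] assms
      ell2.op_mem[OF operator_lift2[OF assms(1)], of "swap_fam a"] by (simp add: lift1_def)
  also have "\<dots> = fip ell2 (swap_fam a) (lift2 U (swap_fam b))"
    using assms by (intro fip_lift2) auto
  also have "\<dots> = fip ell2 a (lift1 U b)"
    using fip_swap_fam[of "swap_fam a" "lift2 U (swap_fam b)"] assms
      ell2.op_mem[OF operator_lift2[OF assms(2)], of "swap_fam b"] by (simp add: lift1_def)
  finally show ?thesis .
qed

definition tensor_fam :: "('i \<Rightarrow> complex) \<Rightarrow> ('j \<Rightarrow> complex) \<Rightarrow> 'i \<times> 'j \<Rightarrow> complex" where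
  "tensor_fam u v = (\<lambda>(m, n). u m * v n)"

lemma row_tensor_fam: "fam_row (tensor_fam u v) m = fscale (u m) v"
  by (simp add: fam_row_def tensor_fam_def fscale_def)

lemma swap_tensor_fam: "swap_fam (tensor_fam u v) = tensor_fam v u"
  by (auto simp: swap_fam_def tensor_fam_def fun_eq_iff)

text \<open>Unit families on a product are elementary tensors, and on these both lifts can be
  evaluated.\<close>

lemma unit_fam_pair: "unit_fam (m, n) = tensor_fam (unit_fam m) (unit_fam n)"
  by (auto simp: unit_fam_def tensor_fam_def fun_eq_iff)

lemma tensor_fam_mem [simp]:
  assumes u: "u \<in> fspace ell2" and v: "v \<in> fspace ell2"
  shows "tensor_fam u v \<in> fspace ell2"
proof (rule ell2_rowsI)
  show "(\<lambda>m. (fnorm ell2 (fam_row (tensor_fam u v) m))\<^sup>2) summable_on UNIV"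
    using summable_on_cmult_left[of "\<lambda>m. (norm (u m))\<^sup>2" UNIV "(fnorm ell2 v)\<^sup>2"] u
    by (simp add: row_tensor_fam ell2.fnorm_scale[OF v] power_mult_distrib mem_ell2)
qed (use v in \<open>simp add: row_tensor_fam\<close>)

lemma lift2_tensor_fam:
  assumes "ell2.operator W" "v \<in> fspace ell2"
  shows "lift2 W (tensor_fam u v) = tensor_fam u (W v)"
  using assms by (intro row_eqI) (simp add: row_tensor_fam ell2.op_scale)

lemma lift1_tensor_fam:
  assumes "ell2.operator W" "u \<in> fspace ell2"
  shows "lift1 W (tensor_fam u v) = tensor_fam (W u) v"
  using assms by (simp add: lift1_def swap_tensor_fam lift2_tensor_fam)

text \<open>Both compositions send an elementary tensor of \<open>u\<close> and \<open>v\<close> to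
  that of \<open>W u\<close> and \<open>U v\<close>, and unit families are such tensors. All
  commutation laws on the bidisk are instances of this.\<close>

lemma lift1_lift2_commute:
  assumes W: "ell2.operator W" and U: "ell2.operator U" and a: "a \<in> fspace ell2"
  shows "lift1 W (lift2 U a) = lift2 U (lift1 W a)"
proof (rule ell2_op_eq[OF _ _ _ a])
  show "ell2.operator (\<lambda>a. lift1 W (lift2 U a))"
    by (rule ell2.operator_comp[OF operator_lift1[OF W] operator_lift2[OF U]])
  show "ell2.operator (\<lambda>a. lift2 U (lift1 W a))"
    by (rule ell2.operator_comp[OF operator_lift2[OF U] operator_lift1[OF W]])
  fix p :: "'a \<times> 'b"
  show "lift1 W (lift2 U (unit_fam p)) = lift2 U (lift1 W (unit_fam p))"
    using W U by (cases p) (simp add: unit_fam_pair lift1_tensor_fam lift2_tensor_fam ell2.op_mem)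
qed

section \<open>Taylor coefficients of inner functions\<close>

definition arc_integral :: "(real \<Rightarrow> complex) \<Rightarrow> complex" where
  "arc_integral f = (LINT t|lborel. indicator {0..2 * pi} t *\<^sub>R f t)"

lemma integrable_arc:
  fixes f :: "real \<Rightarrow> 'a :: {banach, second_countable_topology}"
  assumes "continuous_on {0..2 * pi} f"
  shows "integrable lborel (\<lambda>t. indicator {0..2 * pi} t *\<^sub>R f t)"
  using borel_integrable_atLeastAtMost'[OF assms] by (simp add: set_integrable_def)

text \<open>For nonzero \<open>k\<close> the antiderivative \<open>?F\<close> takes the same value
  at both ends of the interval. Negative \<open>k\<close> occur later as differences of
  exponents.\<close>

lemma arc_integral_cis: "arc_integral (\<lambda>t. cis (real_of_int k * t)) = (if k = 0 then 2 * pi else 0)"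
proof (cases "k = 0")
  case True
  have "arc_integral (\<lambda>t. cis (real_of_int k * t)) = complex_of_real (2 * pi) - complex_of_real 0"
    unfolding arc_integral_def using True
    by (intro integral_FTC_atLeastAtMost) (auto intro!: derivative_eq_intros)
  then show ?thesis using True by simp
next
  case False
  let ?F = "\<lambda>t. cis (real_of_int k * t) / (\<i> * k)"
  have "arc_integral (\<lambda>t. cis (real_of_int k * t)) = ?F (2 * pi) - ?F 0"
    unfolding arc_integral_def
  proof (intro integral_FTC_atLeastAtMost)
    fix x :: real
    show "(?F has_vector_derivative cis (real_of_int k * x)) (at x within {0..2 * pi})"
    proof -
      have "((\<lambda>z. exp (\<i> * (of_int k * z)) / (\<i> * k)) has_field_derivative exp (\<i> * (of_int k * complex_of_real x)))
          (at (complex_of_real x))"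
        using False by (auto intro!: derivative_eq_intros simp: field_simps)
      from has_vector_derivative_real_field[OF this] show ?thesis
        by (simp add: cis_conv_exp)
    qed
  qed (auto intro!: continuous_intros)
  moreover have "cis (real_of_int k * (2 * pi)) = 1"
    using cis_multiple_2pi[of "real_of_int k"] by (simp add: mult_ac)
  ultimately show ?thesis using False by simp
qed

text \<open>Termwise integration, justified by absolute summability of \<open>d\<close> and
  boundedness of \<open>g\<close>. The frequencies are arbitrary because the series of
  \<open>\<phi>\<close> and that of its conjugate are both integrated, the latter with frequencies
  \<open>- n\<close>; \<open>g\<close> holds the remaining factors.\<close>

lemma arc_integral_series:
  fixes d :: "nat \<Rightarrow> complex" and \<nu> :: "nat \<Rightarrow> real"
  assumes g: "continuous_on {0..2 * pi} g" and d: "summable (\<lambda>n. norm (d n))"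
  shows "(\<lambda>n. d n * arc_integral (\<lambda>t. g t * cis (\<nu> n * t))) sums
     arc_integral (\<lambda>t. g t * (\<Sum>n. d n * cis (\<nu> n * t)))"
proof -
  obtain B where B: "\<forall>t\<in>{0..2 * pi}. norm (g t) \<le> B"
    using compact_imp_bounded[OF compact_continuous_image[OF g]] by (auto simp: bounded_iff)
  let ?f = "\<lambda>n t. indicator {0..2 * pi} t *\<^sub>R (d n * (g t * cis (\<nu> n * t)))"
  have int: "integrable lborel (?f n)" for n
    by (intro integrable_arc continuous_intros g)
  have le: "norm (?f n t) \<le> indicator {0..2 * pi} t *\<^sub>R (norm (d n) * B)" for n t
    using B by (auto simp: norm_mult indicator_def intro!: mult_left_mono)
  have "(\<lambda>n. integral\<^sup>L lborel (?f n)) sums (LINT t|lborel. (\<Sum>n. ?f n t))"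
  proof (rule sums_integral[OF int])
    show "AE t in lborel. summable (\<lambda>n. norm (?f n t))"
    proof (rule AE_I2)
      fix t
      have "summable (\<lambda>n. indicator {0..2 * pi} t *\<^sub>R (norm (d n) * B))"
        using d by (intro summable_scaleR_right summable_mult2)
      then show "summable (\<lambda>n. norm (?f n t))"
        by (rule summable_comparison_test'[where N = 0]) (use le in auto)
    qed
    have "norm (LINT t|lborel. norm (?f n t)) \<le> 2 * pi * (norm (d n) * B)" for n
    proof -
      have "(LINT t|lborel. norm (?f n t)) \<le> (LINT t|lborel. indicator {0..2 * pi} t *\<^sub>R (norm (d n) * B))"
        using le by (intro integral_mono integrable_norm int integrable_arc continuous_intros)
      also have "\<dots> = 2 * pi * (norm (d n) * B)" by simp
      finally show ?thesis by simp
    qed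
    moreover have "summable (\<lambda>n. 2 * pi * (norm (d n) * B))"
      using d by (intro summable_mult summable_mult2)
    ultimately show "summable (\<lambda>n. LINT t|lborel. norm (?f n t))"
      by (rule summable_comparison_test'[where N = 0, rotated])
  qed
  moreover have "integral\<^sup>L lborel (?f n) = d n * arc_integral (\<lambda>t. g t * cis (\<nu> n * t))" for n
  proof -
    have "?f n = (\<lambda>t. d n * (indicator {0..2 * pi} t *\<^sub>R (g t * cis (\<nu> n * t))))"
      by (auto simp: fun_eq_iff)
    then show ?thesis unfolding arc_integral_def by (simp only: integral_mult_right_zero)
  qed
  moreover have "(\<Sum>n. ?f n t) = indicator {0..2 * pi} t *\<^sub>R (g t * (\<Sum>n. d n * cis (\<nu> n * t)))" for t
  proof -
    have s: "summable (\<lambda>n. d n * cis (\<nu> n * t))"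
      using d by (intro summable_norm_cancel[of "\<lambda>n. d n * cis (\<nu> n * t)"]) (simp add: norm_mult)
    show ?thesis using suminf_mult[OF s, of "g t"]
      by (cases "t \<in> {0..2 * pi}") (simp_all add: mult.left_commute)
  qed
  ultimately show ?thesis unfolding arc_integral_def by simp
qed

section \<open>Fourier coefficients on circles inside the disk\<close>

context
  fixes \<phi> :: "complex \<Rightarrow> complex" and c :: "nat \<Rightarrow> complex"
  assumes power_series: "\<And>z. z \<in> disk \<Longrightarrow> (\<lambda>n. c n * z ^ n) sums \<phi> z"
begin

lemma coeffs_abs_summable:
  assumes "0 \<le> r" "r < 1"
  shows "summable (\<lambda>n. norm (c n * complex_of_real r ^ n))"
proof (rule powser_insidea)
  \<comment> \<open>The midpoint of \<open>r\<close> and \<open>1\<close> still lies in the disk but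
    strictly outside the circle of radius \<open>r\<close>, which gives absolute convergence on that
    circle.\<close>
  show "summable (\<lambda>n. c n * complex_of_real ((1 + r) / 2) ^ n)"
    using assms by (intro sums_summable[OF power_series]) (auto simp: disk_def simp del: of_real_divide of_real_add)
  show "norm (complex_of_real r) < norm (complex_of_real ((1 + r) / 2))"
    using assms by (simp del: of_real_divide of_real_add)
qed

lemma circle_series:
  assumes "0 \<le> r" "r < 1"
  shows "\<phi> (r * cis t) = (\<Sum>n. (c n * complex_of_real r ^ n) * cis (real n * t))"
proof -
  have "complex_of_real r * cis t \<in> disk"
    using assms by (simp add: disk_def norm_mult)
  from power_series[OF this] show ?thesis
    by (simp add: sums_iff power_mult_distrib Complex.DeMoivre mult.assoc)
qed

lemma circle_continuous:
  assumes "0 \<le> r" "r < 1"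
  shows "continuous_on A (\<lambda>t. \<phi> (complex_of_real r * cis t))"
proof -
  have "\<phi> holomorphic_on ball 0 1"
    by (rule power_series_holomorphic[where a = c]) (use power_series in \<open>auto simp: disk_def\<close>)
  then have "continuous_on (ball 0 1) \<phi>" by (rule holomorphic_on_imp_continuous_on)
  then show ?thesis
    by (rule continuous_on_compose2)
      (use assms in \<open>auto intro!: continuous_intros simp: norm_mult\<close>)
qed

text \<open>Cauchy's coefficient formula: only the term with exponent \<open>m\<close> survives the
  integration.\<close>

lemma arc_integral_coeff:
  assumes r: "0 \<le> r" "r < 1"
  shows "arc_integral (\<lambda>t. cis (- real m * t) * \<phi> (r * cis t)) = 2 * pi * (c m * complex_of_real r ^ m)"
proof -
  have "(\<lambda>n. (c n * complex_of_real r ^ n) * arc_integral (\<lambda>t. cis (- real m * t) * cis (real n * t)))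
      sums arc_integral (\<lambda>t. cis (- real m * t) * \<phi> (r * cis t))"
    unfolding circle_series[OF r]
    by (intro arc_integral_series coeffs_abs_summable r continuous_intros)
  moreover have "(c n * complex_of_real r ^ n) * arc_integral (\<lambda>t. cis (- real m * t) * cis (real n * t)) =
      (if n = m then 2 * pi * (c m * complex_of_real r ^ m) else 0)" for n
    using arc_integral_cis[of "int n - int m"] by (auto simp: cis_mult algebra_simps)
  ultimately have "(\<lambda>n. if n = m then 2 * pi * (c m * complex_of_real r ^ m) else 0)
      sums arc_integral (\<lambda>t. cis (- real m * t) * \<phi> (r * cis t))"
    by (simp only:)
  from sums_unique2[OF this sums_single[of m "\<lambda>_. 2 * pi * (c m * complex_of_real r ^ m)"]]
  show ?thesis .
qed

text \<open>The \<open>k\<close>-th Fourier coefficient of the squared modulus of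
  \<open>\<phi>\<close> on the circle of radius \<open>r\<close>. Expanding only the conjugate
  factor leaves coefficients of \<open>\<phi>\<close>; the exponent \<open>2 * n + k\<close> is
  \<open>n\<close> from the conjugate and \<open>n + k\<close> from the coefficient.\<close>

lemma arc_integral_autocorrelation:
  assumes r: "0 \<le> r" "r < 1"
  shows "(\<lambda>n. 2 * pi * (c (n + k) * cnj (c n) * complex_of_real r ^ (2 * n + k))) sums
    arc_integral (\<lambda>t. cis (- real k * t) * \<phi> (r * cis t) * cnj (\<phi> (r * cis t)))"
proof -
  have s: "summable (\<lambda>n. norm (cnj (c n * complex_of_real r ^ n)))"
    using coeffs_abs_summable[OF r] by (simp add: norm_mult norm_power)
  have cnj_series: "cnj (\<phi> (r * cis t)) = (\<Sum>n. cnj (c n * complex_of_real r ^ n) * cis (- real n * t))" for t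
  proof -
    have "summable (\<lambda>n. c n * complex_of_real r ^ n * cis (real n * t))"
      by (rule summable_norm_cancel) (use coeffs_abs_summable[OF r] in \<open>simp add: norm_mult\<close>)
    then have "(\<lambda>n. cnj (c n * complex_of_real r ^ n * cis (real n * t))) sums cnj (\<phi> (r * cis t))"
      unfolding circle_series[OF r] sums_cnj by (rule summable_sums)
    then show ?thesis by (simp add: sums_iff cis_cnj)
  qed
  have sums: "(\<lambda>n. cnj (c n * complex_of_real r ^ n) *
        arc_integral (\<lambda>t. cis (- real k * t) * \<phi> (r * cis t) * cis (- real n * t))) sums
      arc_integral (\<lambda>t. cis (- real k * t) * \<phi> (r * cis t) * cnj (\<phi> (r * cis t)))"
    unfolding cnj_series
    by (intro arc_integral_series s continuous_intros circle_continuous r)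
  have arc: "arc_integral (\<lambda>t. cis (- real k * t) * \<phi> (r * cis t) * cis (- real n * t)) =
      2 * pi * (c (n + k) * complex_of_real r ^ (n + k))" for n
  proof -
    have "cis (- real (n + k) * t) = cis (- real k * t) * cis (- real n * t)" for t
      unfolding cis_mult by (simp add: algebra_simps)
    then have "cis (- real k * t) * \<phi> (r * cis t) * cis (- real n * t) = cis (- real (n + k) * t) * \<phi> (r * cis t)" for t
      by (simp only: mult_ac)
    then have "arc_integral (\<lambda>t. cis (- real k * t) * \<phi> (r * cis t) * cis (- real n * t)) =
        arc_integral (\<lambda>t. cis (- real (n + k) * t) * \<phi> (r * cis t))"
      by (simp only:)
    also have "\<dots> = 2 * pi * (c (n + k) * complex_of_real r ^ (n + k))"
      by (rule arc_integral_coeff[OF r])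
    finally show ?thesis .
  qed
  have eq: "cnj (c n * complex_of_real r ^ n) *
        arc_integral (\<lambda>t. cis (- real k * t) * \<phi> (r * cis t) * cis (- real n * t)) =
      2 * pi * (c (n + k) * cnj (c n) * complex_of_real r ^ (2 * n + k))" for n
  proof -
    have "complex_of_real r ^ (2 * n + k) = complex_of_real r ^ n * complex_of_real r ^ (n + k)"
      by (simp add: mult_2 add.assoc flip: power_add)
    then show ?thesis unfolding arc by (simp add: mult_ac)
  qed
  show ?thesis
    using sums by (rule sums_cong[OF eq, THEN iffD1])
qed

section \<open>Passage to the boundary\<close>

context
  assumes bdd: "bounded (\<phi> ` disk)"
    and radial: "AE t in lborel. t \<in> {0..2 * pi} \<longrightarrow>
        (\<exists>l. norm l = 1 \<and> ((\<lambda>r. \<phi> (complex_of_real r * cis t)) \<longlongrightarrow> l) (at_left 1))"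
begin

lemma autocorrelation_limit:
  fixes r :: "nat \<Rightarrow> real"
  assumes r: "\<And>j. 0 \<le> r j" "\<And>j. r j < 1" "r \<longlonglongrightarrow> 1"
  shows "(\<lambda>j. arc_integral (\<lambda>t. cis (- real k * t) * \<phi> (r j * cis t) * cnj (\<phi> (r j * cis t))))
    \<longlonglongrightarrow> (if k = 0 then 2 * pi else 0)"
proof -
  obtain B where B: "\<And>z. z \<in> disk \<Longrightarrow> norm (\<phi> z) \<le> B"
    using bdd by (auto simp: bounded_iff)
  let ?f = "\<lambda>j t. cis (- real k * t) * \<phi> (r j * cis t) * cnj (\<phi> (r j * cis t))"
  have cont: "continuous_on {0..2 * pi} (?f j)" for j
    by (intro continuous_intros circle_continuous r)
  \<comment> \<open>Radial limits are taken along \<open>at_left 1\<close>, so \<open>r j\<close>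
    has to approach \<open>1\<close> without reaching it.\<close>
  have at_left: "filterlim r (at_left 1) sequentially"
    using r by (auto simp: filterlim_at intro!: always_eventually less_imp_neq)
  have "(\<lambda>j. LINT t|lborel. indicator {0..2 * pi} t *\<^sub>R ?f j t) \<longlonglongrightarrow>
      (LINT t|lborel. indicator {0..2 * pi} t *\<^sub>R cis (- real k * t))"
  proof (rule integral_dominated_convergence)
    show "integrable lborel (\<lambda>t. indicator {0..2 * pi} t *\<^sub>R (B * B))"
      by (intro integrable_arc continuous_intros)
    show "(\<lambda>t. indicator {0..2 * pi} t *\<^sub>R cis (- real k * t)) \<in> borel_measurable lborel"
      by (intro borel_measurable_integrable integrable_arc continuous_intros)
    show "(\<lambda>t. indicator {0..2 * pi} t *\<^sub>R ?f j t) \<in> borel_measurable lborel" for j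
      by (intro borel_measurable_integrable integrable_arc cont)
    show "AE t in lborel. norm (indicator {0..2 * pi} t *\<^sub>R ?f j t) \<le> indicator {0..2 * pi} t *\<^sub>R (B * B)" for j
    proof (rule AE_I2)
      fix t
      have "norm (\<phi> (r j * cis t)) \<le> B"
        using r by (intro B) (simp add: disk_def norm_mult)
      then have "norm (?f j t) \<le> B * B"
        by (auto simp: norm_mult intro!: mult_mono intro: order_trans[OF norm_ge_zero])
      then show "norm (indicator {0..2 * pi} t *\<^sub>R ?f j t) \<le> indicator {0..2 * pi} t *\<^sub>R (B * B)"
        by (auto simp: indicator_def)
    qed
    \<comment> \<open>Where the radial limit \<open>l\<close> exists, \<open>\<phi>\<close> times
      its conjugate tends to \<open>l * cnj l = 1\<close>, and the bare character remains.\<close>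
    show "AE t in lborel. (\<lambda>j. indicator {0..2 * pi} t *\<^sub>R ?f j t) \<longlonglongrightarrow>
        indicator {0..2 * pi} t *\<^sub>R cis (- real k * t)"
      using radial
    proof eventually_elim
      case (elim t)
      show ?case
      proof (cases "t \<in> {0..2 * pi}")
        case True
        then obtain l where l: "norm l = 1" "((\<lambda>r. \<phi> (complex_of_real r * cis t)) \<longlongrightarrow> l) (at_left 1)"
          using elim by auto
        have "(\<lambda>j. \<phi> (r j * cis t)) \<longlonglongrightarrow> l"
          using filterlim_compose[OF l(2) at_left] .
        then have "(\<lambda>j. ?f j t) \<longlonglongrightarrow> cis (- real k * t) * l * cnj l"
          by (intro tendsto_intros)
        moreover have "l * cnj l = 1" using l(1) by (simp add: mult_cnj)
        ultimately show ?thesis using True by (simp add: mult.assoc)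
      qed auto
    qed
  qed
  then show ?thesis
    using arc_integral_cis[of "- int k"] by (simp add: arc_integral_def)
qed

text \<open>Taking the limit inside the series relies on absolute summability, which comes from
  \<open>c \<in> fspace ell2\<close>. Membership is therefore obtained beforehand from
  \<open>k = 0\<close>, where all terms are nonnegative and partial sums cannot exceed the
  limit.\<close>

lemma coeffs_orthonormal:
  shows "c \<in> fspace ell2"
    and "((\<lambda>n. c (n + k) * cnj (c n)) has_sum (if k = 0 then 1 else 0)) UNIV"
proof -
  define r :: "nat \<Rightarrow> real" where "r = (\<lambda>j. 1 - inverse (real (Suc j)))"
  have r: "0 \<le> r j" "r j < 1" for j
    by (auto simp: r_def inverse_le_1_iff)
  have lim: "r \<longlonglongrightarrow> 1"
    using tendsto_diff[OF tendsto_const LIMSEQ_inverse_real_of_nat, of 1] by (simp add: r_def)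
  define x where "x = (\<lambda>k n. c (n + k) * cnj (c n))"
  have sums: "(\<lambda>n. 2 * pi * (x k n * complex_of_real (r j) ^ (2 * n + k))) sums
      arc_integral (\<lambda>t. cis (- real k * t) * \<phi> (r j * cis t) * cnj (\<phi> (r j * cis t)))" for k j
    unfolding x_def using arc_integral_autocorrelation[OF r] .
  have ilim: "(\<lambda>j. \<Sum>n. 2 * pi * (x k n * complex_of_real (r j) ^ (2 * n + k)))
      \<longlonglongrightarrow> (if k = 0 then 2 * pi else 0)" for k
    using autocorrelation_limit[OF r lim, of k] sums[of k] by (simp add: sums_iff)
  have xlim: "(\<lambda>j. 2 * pi * (x k n * complex_of_real (r j) ^ (2 * n + k))) \<longlonglongrightarrow> 2 * pi * x k n" for k n
  proof -
    have "(\<lambda>j. 2 * pi * (x k n * complex_of_real (r j) ^ (2 * n + k))) \<longlonglongrightarrow> 2 * pi * (x k n * complex_of_real 1 ^ (2 * n + k))"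
      by (intro tendsto_intros lim)
    then show ?thesis by simp
  qed
  \<comment> \<open>With \<open>N\<close> fixed, a finite sum passes to the limit along
    \<open>r\<close>. It is dominated by the full series, whose limit divided by
    \<open>2 * pi\<close> is \<open>1\<close>.\<close>
  have part: "(\<Sum>n<N. (norm (c n))\<^sup>2) \<le> 1" for N
  proof (rule tendsto_le[OF sequentially_bot])
    show "(\<lambda>j. (\<Sum>n<N. Re (2 * pi * (x 0 n * complex_of_real (r j) ^ (2 * n + 0)))) / (2 * pi)) \<longlonglongrightarrow> (\<Sum>n<N. (norm (c n))\<^sup>2)"
    proof -
      have "(\<lambda>j. (\<Sum>n<N. Re (2 * pi * (x 0 n * complex_of_real (r j) ^ (2 * n + 0)))) / (2 * pi)) \<longlonglongrightarrow> (\<Sum>n<N. Re (2 * pi * x 0 n)) / (2 * pi)"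
        by (intro tendsto_intros xlim) simp
      moreover have "Re (2 * pi * x 0 n) = 2 * pi * (norm (c n))\<^sup>2" for n
        by (simp add: x_def mult_cnj cmod_power2 flip: of_real_power)
      ultimately show ?thesis by (simp add: sum_distrib_left[symmetric])
    qed
    show "(\<lambda>j. Re (\<Sum>n. 2 * pi * (x 0 n * complex_of_real (r j) ^ (2 * n + 0))) / (2 * pi)) \<longlonglongrightarrow> 1"
      using tendsto_divide[OF tendsto_Re[OF ilim[of 0]] tendsto_const, of "2 * pi"] by simp
    have "(\<Sum>n<N. Re (2 * pi * (x 0 n * complex_of_real (r j) ^ (2 * n + 0)))) \<le>
        Re (\<Sum>n. 2 * pi * (x 0 n * complex_of_real (r j) ^ (2 * n + 0)))" for j
    proof -
      have "(\<lambda>n. Re (2 * pi * (x 0 n * complex_of_real (r j) ^ (2 * n + 0)))) sums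
          Re (\<Sum>n. 2 * pi * (x 0 n * complex_of_real (r j) ^ (2 * n + 0)))"
        using sums[of 0 j] by (intro sums_Re) (simp add: sums_iff)
      moreover have "0 \<le> Re (2 * pi * (x 0 n * complex_of_real (r j) ^ (2 * n + 0)))" for n
        using r[of j] by (simp add: x_def mult_cnj flip: of_real_power)
      ultimately show ?thesis by (intro sum_le_suminf[THEN order_trans]) (auto simp: sums_iff)
    qed
    then show "\<forall>\<^sub>F j in sequentially. (\<Sum>n<N. Re (2 * pi * (x 0 n * complex_of_real (r j) ^ (2 * n + 0)))) / (2 * pi)
        \<le> Re (\<Sum>n. 2 * pi * (x 0 n * complex_of_real (r j) ^ (2 * n + 0))) / (2 * pi)"
      by (intro always_eventually allI divide_right_mono) auto
  qed
  have "(\<Sum>n\<in>F. (norm (c n))\<^sup>2) \<le> 1\<^sup>2" if "finite F" for F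
  proof -
    obtain N where "F \<subseteq> {..<N}" using finite_nat_bounded[OF \<open>finite F\<close>] by blast
    then have "(\<Sum>n\<in>F. (norm (c n))\<^sup>2) \<le> (\<Sum>n<N. (norm (c n))\<^sup>2)"
      by (intro sum_mono2) auto
    then show ?thesis using part[of N] by simp
  qed
  then show c: "c \<in> fspace ell2" by (rule ell2_bounded_partial_sums) auto
  \<comment> \<open>The shifted family is square-summable as well, and products of two
    square-summable families are absolutely summable.\<close>
  have "(\<lambda>n. (norm (c (n + k)))\<^sup>2) summable_on UNIV"
    using c by (simp add: mem_ell2 summable_on_UNIV_nonneg_real_iff
        summable_iff_shift[of "\<lambda>i. (norm (c i))\<^sup>2" k])
  then have abs: "summable (\<lambda>n. norm (x k n))"
    using ell2_abs_summable[of "\<lambda>n. c (n + k)" c] c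
    by (simp add: mem_ell2 x_def summable_on_UNIV_nonneg_real_iff)
  have "(\<lambda>j. \<Sum>n. 2 * pi * (x k n * complex_of_real (r j) ^ (2 * n + k))) \<longlonglongrightarrow> (\<Sum>n. 2 * pi * x k n)"
  \<comment> \<open>Dominated convergence for series: powers of \<open>r j\<close> are at most
    \<open>1\<close>, so the terms at \<open>r = 1\<close> are a summable majorant.\<close>
  proof (rule tannerys_theorem[THEN conjunct2, THEN conjunct2])
    show "summable (\<lambda>n. 2 * pi * norm (x k n))" using abs by (rule summable_mult)
    have "r j ^ m \<le> 1" for j m
      using r[of j] by (simp add: power_le_one)
    then have "norm (2 * pi * (x k n * complex_of_real (r j) ^ (2 * n + k))) \<le> 2 * pi * norm (x k n)" for n j
      using r[of j] by (simp add: norm_mult norm_power mult_left_le)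
    then show "\<forall>\<^sub>F (n, j) in sequentially \<times>\<^sub>F sequentially.
        norm (2 * pi * (x k n * complex_of_real (r j) ^ (2 * n + k))) \<le> 2 * pi * norm (x k n)"
      by (intro always_eventually) auto
    show "(\<lambda>j. 2 * pi * (x k n * complex_of_real (r j) ^ (2 * n + k))) \<longlonglongrightarrow> 2 * pi * x k n" for n
      by (rule xlim)
  qed simp
  then have "(\<Sum>n. 2 * pi * x k n) = (if k = 0 then 2 * pi else 0)"
    by (rule LIMSEQ_unique) (rule ilim)
  moreover have "(\<Sum>n. 2 * pi * x k n) = 2 * pi * (\<Sum>n. x k n)"
    by (rule suminf_mult[OF summable_norm_cancel[OF abs]])
  ultimately have "(\<Sum>n. x k n) = (if k = 0 then 1 else 0)"
    by (auto split: if_splits)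
  then have "x k sums (if k = 0 then 1 else 0)"
    using summable_sums[OF summable_norm_cancel[OF abs]] by simp
  then show "((\<lambda>n. c (n + k) * cnj (c n)) has_sum (if k = 0 then 1 else 0)) UNIV"
    using norm_summable_imp_has_sum[OF abs] by (simp add: x_def)
qed

end

end

section \<open>Multiplication by an inner function\<close>

text \<open>The lower triangular Toeplitz matrix of multiplication by the function with coefficients
  \<open>c\<close>. Each entry of the result is a finite sum, so linearity holds on all families,
  before boundedness is known.\<close>

definition conv :: "(nat \<Rightarrow> complex) \<Rightarrow> (nat \<Rightarrow> complex) \<Rightarrow> nat \<Rightarrow> complex" where
  "conv c a = (\<lambda>m. \<Sum>i\<le>m. a i * c (m - i))"

lemma conv_add: "conv c (a + b) = conv c a + conv c b"
  and conv_scale: "conv c (fscale x a) = fscale x (conv c a)"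
  by (auto simp: conv_def fscale_def algebra_simps sum.distrib sum_distrib_left)

lemma conv_sum:
  assumes "finite F"
  shows "conv c (\<Sum>i\<in>F. fscale (x i) (v i)) = (\<Sum>i\<in>F. fscale (x i) (conv c (v i)))"
  using assms
proof (induction F rule: finite_induct)
  case empty
  show ?case by (simp add: conv_def fun_eq_iff)
qed (simp only: sum.insert conv_add conv_scale not_False_eq_True)

lemma conv_unit_fam: "conv c (unit_fam i) = (\<lambda>m. if i \<le> m then c (m - i) else 0)"
proof
  fix m
  have "conv c (unit_fam i) m = (\<Sum>j\<le>m. if j = i then c (m - j) else 0)"
    unfolding conv_def unit_fam_def by (intro sum.cong) auto
  then show "conv c (unit_fam i) m = (if i \<le> m then c (m - i) else 0)" by simp
qed

text \<open>Meant for Toeplitz columns: column \<open>j\<close> vanishes before index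
  \<open>j\<close>, so sums along it are re-indexed from there.\<close>

lemma has_sum_shift:
  fixes x :: "nat \<Rightarrow> 'a :: real_normed_vector"
  assumes "\<And>m. m < j \<Longrightarrow> x m = 0" and "((\<lambda>n. x (n + j)) has_sum s) UNIV"
  shows "(x has_sum s) UNIV"
proof -
  have "(x has_sum s) (range (\<lambda>n. n + j))"
    using assms(2) by (subst has_sum_reindex) (auto simp: o_def)
  moreover have "x m = 0" if "m \<notin> range (\<lambda>n. n + j)" for m
    using that assms(1)[of m] by (metis le_add_diff_inverse2 not_less rangeI)
  ultimately show ?thesis
    by (subst has_sum_cong_neutral[where S = "range (\<lambda>n. n + j)" and g = x, symmetric]) auto
qed

text \<open>The second axiom is orthonormality of the Toeplitz columns, that is, of the functions
  \<open>z ^ i * \<phi> z\<close>; \<open>k\<close> is the distance of two columns.\<close>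

locale isometric_coeffs =
  fixes c :: "nat \<Rightarrow> complex"
  assumes mem: "c \<in> fspace ell2"
    and autocorrelation: "\<And>k. ((\<lambda>n. c (n + k) * cnj (c n)) has_sum (if k = 0 then 1 else 0)) UNIV"
begin

lemma conv_unit_mem: "conv c (unit_fam i) \<in> fspace ell2"
proof (rule ell2_fnormI(1))
  show "((\<lambda>m. (norm (conv c (unit_fam i) m))\<^sup>2) has_sum (fnorm ell2 c)\<^sup>2) UNIV"
    by (rule has_sum_shift[where j = i]) (use ell2_fnorm_has_sum[OF mem] in \<open>auto simp: conv_unit_fam\<close>)
qed

text \<open>For \<open>i \<le> j\<close> the common support begins at \<open>j\<close>, and
  re-indexing from there gives the autocorrelation at \<open>j - i\<close>. The other order follows
  by conjugation.\<close>

lemma fip_conv_unit: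
  "fip ell2 (conv c (unit_fam i)) (conv c (unit_fam j)) = (if i = j then 1 else 0)"
proof -
  have le: "fip ell2 (conv c (unit_fam i)) (conv c (unit_fam j)) = (if i = j then 1 else 0)"
    if "i \<le> j" for i j
  proof (rule has_sum_unique[OF ell2_has_sum[OF conv_unit_mem conv_unit_mem]])
    show "((\<lambda>m. conv c (unit_fam i) m * cnj (conv c (unit_fam j) m)) has_sum (if i = j then 1 else 0)) UNIV"
      by (rule has_sum_shift[where j = j])
        (use that autocorrelation[of "j - i"] in \<open>auto simp: conv_unit_fam\<close>)
  qed
  show ?thesis
  proof (cases "i \<le> j")
    case False
    then have "fip ell2 (conv c (unit_fam i)) (conv c (unit_fam j)) =
        cnj (fip ell2 (conv c (unit_fam j)) (conv c (unit_fam i)))"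
      by (intro ell2.ip_sym conv_unit_mem)
    then show ?thesis using le[of j i] False by simp
  qed (rule le)
qed

text \<open>Pythagoras for finitely many orthonormal columns.\<close>

lemma conv_cut_fam:
  assumes F: "finite F"
  shows "conv c (cut_fam F a) \<in> fspace ell2"
    and "(fnorm ell2 (conv c (cut_fam F a)))\<^sup>2 = (\<Sum>i\<in>F. (norm (a i))\<^sup>2)"
proof -
  let ?v = "\<lambda>i. fscale (a i) (conv c (unit_fam i))"
  have eq: "conv c (cut_fam F a) = (\<Sum>i\<in>F. ?v i)"
    using F by (simp add: cut_fam_eq_sum conv_sum)
  have v: "?v i \<in> fspace ell2" for i
    by (simp add: conv_unit_mem)
  show m: "conv c (cut_fam F a) \<in> fspace ell2"
    unfolding eq by (rule ell2.mem_sum[OF F v ell2.mem_zero])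
  have "fip ell2 (conv c (cut_fam F a)) (conv c (cut_fam F a)) = (\<Sum>i\<in>F. \<Sum>j\<in>F. fip ell2 (?v i) (?v j))"
    unfolding eq ell2.ip_sum[OF F v m[unfolded eq]]
    by (intro sum.cong refl ell2.ip_sum_right[OF F v v])
  also have "\<dots> = (\<Sum>i\<in>F. \<Sum>j\<in>F. if j = i then complex_of_real ((norm (a i))\<^sup>2) else 0)"
    by (intro sum.cong)
      (auto simp: ell2.ip_scale ell2.ip_scale_right conv_unit_mem fip_conv_unit mult_cnj
          mult.commute[of "cnj _"])
  also have "\<dots> = complex_of_real (\<Sum>i\<in>F. (norm (a i))\<^sup>2)"
    using F by simp
  finally show "(fnorm ell2 (conv c (cut_fam F a)))\<^sup>2 = (\<Sum>i\<in>F. (norm (a i))\<^sup>2)"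
    unfolding ell2.ip_self[OF m] of_real_eq_iff .
qed

text \<open>By triangularity, entries of \<open>conv c a\<close> up to \<open>N\<close> depend only
  on entries of \<open>a\<close> up to \<open>N\<close>. A partial sum can thus be computed from a
  truncation of \<open>a\<close>, where the norm is known exactly.\<close>

lemma conv_bounded:
  assumes a: "a \<in> fspace ell2"
  shows "conv c a \<in> fspace ell2" "fnorm ell2 (conv c a) \<le> fnorm ell2 a"
proof -
  have "(\<Sum>i\<in>G. (norm (conv c a i))\<^sup>2) \<le> (fnorm ell2 a)\<^sup>2" if G: "finite G" for G
  proof -
    obtain N where N: "G \<subseteq> {..N}" using finite_nat_iff_bounded_le[of G] G by auto
    let ?b = "cut_fam {..N} a"
    have "(\<Sum>i\<in>G. (norm (conv c a i))\<^sup>2) = (\<Sum>i\<in>G. (norm (conv c ?b i))\<^sup>2)"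
      using N by (intro sum.cong) (auto simp: conv_def cut_fam_def intro!: arg_cong[where f = norm] sum.cong)
    also have "\<dots> \<le> (fnorm ell2 (conv c ?b))\<^sup>2"
      by (rule finite_sum_le_has_sum[OF ell2_fnorm_has_sum[OF conv_cut_fam(1)]]) (use G in auto)
    also have "\<dots> = (\<Sum>i\<le>N. (norm (a i))\<^sup>2)" by (simp add: conv_cut_fam)
    also have "\<dots> \<le> (fnorm ell2 a)\<^sup>2"
      by (rule finite_sum_le_has_sum[OF ell2_fnorm_has_sum[OF a]]) auto
    finally show ?thesis .
  qed
  note * = ell2_bounded_partial_sums[OF this ell2.fnorm_nonneg[OF a]]
  show "conv c a \<in> fspace ell2" "fnorm ell2 (conv c a) \<le> fnorm ell2 a"
    using * by auto
qed

lemma operator_conv: "ell2.operator (conv c)"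
  by (rule ell2.operatorI[where C = 1]) (auto simp: conv_add conv_scale conv_bounded)

text \<open>On unit families the left side produces the rows of the Gram matrix of the columns,
  which is the identity.\<close>

lemma adj_conv_conv:
  assumes "a \<in> fspace ell2"
  shows "adj (conv c) (conv c a) = a"
proof (rule ell2_op_eq[OF _ ell2.operator_id _ assms])
  show "ell2.operator (\<lambda>a. adj (conv c) (conv c a))"
    by (rule ell2.operator_comp[OF operator_adj[OF operator_conv] operator_conv])
  show "adj (conv c) (conv c (unit_fam i)) = unit_fam i" for i
    unfolding adj_def fip_conv_unit by (auto simp: unit_fam_def)
qed

lemma fnorm_conv:
  assumes "a \<in> fspace ell2"
  shows "fnorm ell2 (conv c a) = fnorm ell2 a"
proof -
  have "fip ell2 (conv c a) (conv c a) = fip ell2 (adj (conv c) (conv c a)) a"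
    using assms by (intro adj[OF operator_conv, symmetric] conv_bounded)
  then show ?thesis using assms by (simp add: adj_conv_conv fnorm_def)
qed

definition range_proj :: "(nat \<Rightarrow> complex) \<Rightarrow> nat \<Rightarrow> complex" where
  "range_proj a = conv c (adj (conv c) a)"

lemma operator_range_proj: "ell2.operator range_proj"
  unfolding range_proj_def[abs_def]
  by (rule ell2.operator_comp[OF operator_conv operator_adj[OF operator_conv]])

lemma adj_mem: "a \<in> fspace ell2 \<Longrightarrow> adj (conv c) a \<in> fspace ell2"
  by (rule ell2.op_mem[OF operator_adj[OF operator_conv]])

lemma fip_range_proj:
  assumes "a \<in> fspace ell2" "b \<in> fspace ell2"
  shows "fip ell2 (range_proj a) b = fip ell2 (adj (conv c) a) (adj (conv c) b)"
proof -
  have "fip ell2 b (range_proj a) = fip ell2 (adj (conv c) b) (adj (conv c) a)"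
    unfolding range_proj_def using assms by (intro adj[OF operator_conv, symmetric] adj_mem)
  then show ?thesis
    using assms ell2.ip_sym[of b "range_proj a"] ell2.op_mem[OF operator_range_proj]
      ell2.ip_sym[of "adj (conv c) b" "adj (conv c) a"] by (simp add: adj_mem)
qed

lemma range_proj_selfadjoint:
  assumes "a \<in> fspace ell2" "b \<in> fspace ell2"
  shows "fip ell2 (range_proj a) b = fip ell2 a (range_proj b)"
proof -
  have "fip ell2 a (range_proj b) = cnj (fip ell2 (range_proj b) a)"
    using assms ell2.op_mem[OF operator_range_proj] by (intro ell2.ip_sym) auto
  also have "\<dots> = cnj (fip ell2 (adj (conv c) b) (adj (conv c) a))"
    using assms by (simp add: fip_range_proj)
  also have "\<dots> = fip ell2 (range_proj a) b"
    using assms ell2.ip_sym[of "adj (conv c) b" "adj (conv c) a"]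
    by (simp add: fip_range_proj adj_mem)
  finally show ?thesis ..
qed

lemma range_proj_conv: "a \<in> fspace ell2 \<Longrightarrow> range_proj (conv c a) = conv c a"
  by (simp add: range_proj_def adj_conv_conv)

lemma range_proj_idem: "a \<in> fspace ell2 \<Longrightarrow> range_proj (range_proj a) = range_proj a"
  unfolding range_proj_def[of a] by (intro range_proj_conv adj_mem)

text \<open>\<open>z\<^sup>N\<close> is asymptotically in the range, since the adjoint maps it to the truncation of
  \<open>cnj \<circ> c\<close> (reversed), whose norm tends to \<open>1\<close>.\<close>

lemma unit_fam_range_proj_limit:
  "(\<lambda>N. fnorm ell2 (unit_fam N - range_proj (unit_fam N))) \<longlonglongrightarrow> 0"
proof -
  note pm = ell2.op_mem[OF operator_range_proj]
  have "(fnorm ell2 (unit_fam N - range_proj (unit_fam N)))\<^sup>2 = 1 - (\<Sum>j<Suc N. (norm (c j))\<^sup>2)" for N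
  proof -
    let ?u = "unit_fam N :: nat \<Rightarrow> complex"
    have "fip ell2 (?u - range_proj ?u) (?u - range_proj ?u) =
        fip ell2 ?u ?u - fip ell2 ?u (range_proj ?u) - fip ell2 (range_proj ?u) ?u +
        fip ell2 (range_proj ?u) (range_proj ?u)"
      by (simp add: ell2.ip_diff ell2.ip_diff_right pm)
    \<comment> \<open>By self-adjointness and idempotence the last term equals the second one and
      cancels it.\<close>
    also have "\<dots> = fip ell2 ?u ?u - fip ell2 (range_proj ?u) ?u"
      by (simp add: range_proj_selfadjoint pm range_proj_idem)
    also have "fip ell2 ?u ?u = 1"
      by (simp add: fip_unit_fam) (simp add: unit_fam_def)
    also have "fip ell2 (range_proj ?u) ?u = complex_of_real ((fnorm ell2 (adj (conv c) ?u))\<^sup>2)"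
      by (simp add: fip_range_proj ell2.ip_self adj_mem)
    also have "(fnorm ell2 (adj (conv c) ?u))\<^sup>2 = (\<Sum>j<Suc N. (norm (c j))\<^sup>2)"
    proof (rule ell2_fnormI(2))
      have eq: "adj (conv c) ?u m = (if m \<le> N then cnj (c (N - m)) else 0)" for m
        by (simp add: adj_def fip_unit_fam_left conv_unit_mem) (simp add: conv_unit_fam)
      have "(\<Sum>m\<in>{..N}. (norm (adj (conv c) ?u m))\<^sup>2) = (\<Sum>j<Suc N. (norm (c (N - j)))\<^sup>2)"
        by (simp add: eq lessThan_Suc_atMost)
      also have "\<dots> = (\<Sum>j<Suc N. (norm (c j))\<^sup>2)"
        using sum.nat_diff_reindex[of "\<lambda>j. (norm (c j))\<^sup>2" "Suc N"] by simp
      finally show "((\<lambda>m. (norm (adj (conv c) ?u m))\<^sup>2) has_sum (\<Sum>j<Suc N. (norm (c j))\<^sup>2)) UNIV"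
        by (intro has_sum_finite_neutralI[where B = "{..N}"]) (auto simp: eq)
    qed
    finally have "complex_of_real ((fnorm ell2 (?u - range_proj ?u))\<^sup>2) =
        complex_of_real (1 - (\<Sum>j<Suc N. (norm (c j))\<^sup>2))"
      unfolding ell2.ip_self[OF ell2.mem_diff[OF unit_fam_mem pm[OF unit_fam_mem]]] by simp
    then show ?thesis by (simp only: of_real_eq_iff)
  qed
  moreover have "(\<lambda>N. 1 - (\<Sum>j<Suc N. (norm (c j))\<^sup>2)) \<longlonglongrightarrow> 1 - 1"
  proof -
    have "((\<lambda>n. complex_of_real ((norm (c n))\<^sup>2)) has_sum 1) UNIV"
      using autocorrelation[of 0] by (simp add: mult_cnj del: of_real_power)
    then have "((\<lambda>n. (norm (c n))\<^sup>2) has_sum 1) UNIV"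
      using has_sum_Re by fastforce
    then have "(\<lambda>n. (norm (c n))\<^sup>2) sums 1" by (rule has_sum_imp_sums)
    then show ?thesis
      unfolding sums_def by (intro tendsto_diff tendsto_const) (rule LIMSEQ_Suc)
  qed
  ultimately have "(\<lambda>N. sqrt ((fnorm ell2 (unit_fam N - range_proj (unit_fam N)))\<^sup>2)) \<longlonglongrightarrow> sqrt 0"
    by (intro tendsto_real_sqrt) simp
  then show ?thesis using pm by simp
qed

end

text \<open>The coordinate function is itself inner, so the shift inherits boundedness, isometry and
  its description as a multiplication from the general case.\<close>

lemma isometric_coeffs_monomial: "isometric_coeffs (unit_fam (Suc 0))"
proof
  fix k
  show "((\<lambda>n. unit_fam (Suc 0) (n + k) * cnj (unit_fam (Suc 0) n)) has_sum (if k = 0 then 1 else 0)) UNIV"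
    by (rule has_sum_finite_neutralI[where B = "{Suc 0}"]) (auto simp: unit_fam_def)
qed simp

abbreviation shift :: "(nat \<Rightarrow> complex) \<Rightarrow> nat \<Rightarrow> complex" where
  "shift \<equiv> conv (unit_fam (Suc 0))"

interpretation shift: isometric_coeffs "unit_fam (Suc 0)"
  by (rule isometric_coeffs_monomial)

lemma shift_Suc: "shift a (Suc n) = a n"
proof -
  have "shift a (Suc n) = (\<Sum>i\<le>Suc n. if i = n then a i else 0)"
    unfolding conv_def unit_fam_def by (intro sum.cong) auto
  then show ?thesis by simp
qed

lemma shift_funpow: "(shift ^^ n) a (n + k) = a k"
  by (induction n) (simp_all add: shift_Suc)

lemma shift_funpow_mem: "a \<in> fspace ell2 \<Longrightarrow> (shift ^^ n) a \<in> fspace ell2"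
  and fnorm_shift_funpow: "a \<in> fspace ell2 \<Longrightarrow> fnorm ell2 ((shift ^^ n) a) = fnorm ell2 a"
  by (induction n) (simp_all add: shift.conv_bounded shift.fnorm_conv)

context isometric_coeffs
begin

text \<open>Entry \<open>k\<close> of \<open>g\<close> is entry \<open>n + k\<close> of the
  \<open>n\<close>-fold shift of \<open>g\<close>, for every \<open>n\<close>. As the projection
  kills that shift, the unit family at \<open>n + k\<close> may be replaced by its distance vector
  from the range, whose norm tends to \<open>0\<close>, while the shifts keep the norm of
  \<open>g\<close>.\<close>

lemma eq_0_if_shifts_orthogonal:
  assumes g: "g \<in> fspace ell2" and orth: "\<And>n. range_proj ((shift ^^ n) g) = 0"
  shows "g = 0"
proof
  fix k
  note pm = ell2.op_mem[OF operator_range_proj]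
  have "norm (g k) \<le> fnorm ell2 g * fnorm ell2 (unit_fam (n + k) - range_proj (unit_fam (n + k)))" for n
  proof -
    let ?h = "(shift ^^ n) g" and ?u = "unit_fam (n + k) :: nat \<Rightarrow> complex"
    have h: "?h \<in> fspace ell2" using g by (rule shift_funpow_mem)
    have "g k = fip ell2 ?h ?u"
      using h by (simp add: fip_unit_fam shift_funpow)
    also have "\<dots> = fip ell2 ?h (?u - range_proj ?u)"
      using h range_proj_selfadjoint[OF h unit_fam_mem[of "n + k"]]
      by (simp add: ell2.ip_diff_right pm orth)
    finally have "norm (g k) \<le> fnorm ell2 ?h * fnorm ell2 (?u - range_proj ?u)"
      using ell2.Cauchy_Schwarz[OF h, of "?u - range_proj ?u"] pm by simp
    then show ?thesis using g by (simp add: fnorm_shift_funpow)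
  qed
  moreover have "(\<lambda>n. fnorm ell2 g * fnorm ell2 (unit_fam (n + k) - range_proj (unit_fam (n + k)))) \<longlonglongrightarrow> fnorm ell2 g * 0"
    by (intro tendsto_mult_left LIMSEQ_ignore_initial_segment unit_fam_range_proj_limit)
  ultimately have "norm (g k) \<le> fnorm ell2 g * 0"
    by (intro LIMSEQ_le_const) auto
  then show "g k = 0 k" by simp
qed

end

section \<open>Hardy spaces in terms of coefficients\<close>

text \<open>Common core of disk and bidisk. The first axiom makes point evaluations bounded, the
  second makes coefficients well defined.\<close>

locale hardy_basis =
  fixes D :: "'a set" and e :: "'i \<Rightarrow> 'a \<Rightarrow> complex"
  assumes basis_ell2: "\<And>x. x \<in> D \<Longrightarrow> (\<lambda>i. e i x) \<in> fspace ell2"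
    and expansion_unique: "\<And>f a b. l2_expansion D e f a \<Longrightarrow> l2_expansion D e f b \<Longrightarrow> a = b"
begin

text \<open>The family \<open>cnj (e i x)\<close> is the coefficient family of the reproducing
  kernel at \<open>x\<close>. Writing evaluation as an inner product makes linearity of
  \<open>synth\<close> immediate.\<close>

definition synth :: "('i \<Rightarrow> complex) \<Rightarrow> 'a \<Rightarrow> complex" where
  "synth a = (\<lambda>x. if x \<in> D then fip ell2 a (\<lambda>i. cnj (e i x)) else 0)"

lemma cnj_basis_ell2: "x \<in> D \<Longrightarrow> (\<lambda>i. cnj (e i x)) \<in> fspace ell2"
  using basis_ell2 by (simp add: mem_ell2)

lemma synth_has_sum:
  assumes "a \<in> fspace ell2" "x \<in> D"
  shows "((\<lambda>i. a i * e i x) has_sum synth a x) UNIV"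
  using ell2_has_sum[OF assms(1) cnj_basis_ell2[OF assms(2)]] assms(2) by (simp add: synth_def)

lemma expansion_synth: "a \<in> fspace ell2 \<Longrightarrow> l2_expansion D e (synth a) a"
  by (simp add: l2_expansion_def synth_has_sum) (simp add: mem_ell2)

lemma coeffs_synth: "a \<in> fspace ell2 \<Longrightarrow> l2_coeffs D e (synth a) = a"
  unfolding l2_coeffs_def by (rule the_equality) (auto intro: expansion_synth expansion_unique)

lemma synth_inj: "a \<in> fspace ell2 \<Longrightarrow> b \<in> fspace ell2 \<Longrightarrow> synth a = synth b \<longleftrightarrow> a = b"
  using coeffs_synth by metis

lemma synth_add: "a \<in> fspace ell2 \<Longrightarrow> b \<in> fspace ell2 \<Longrightarrow> synth (a + b) = synth a + synth b"
  by (rule ext) (simp add: synth_def ell2.ip_add cnj_basis_ell2)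

lemma synth_diff: "a \<in> fspace ell2 \<Longrightarrow> b \<in> fspace ell2 \<Longrightarrow> synth (a - b) = synth a - synth b"
  by (rule ext) (simp add: synth_def ell2.ip_diff cnj_basis_ell2)

lemma synth_scale: "a \<in> fspace ell2 \<Longrightarrow> synth (fscale c a) = fscale c (synth a)"
  by (rule ext) (simp add: synth_def ell2.ip_scale cnj_basis_ell2, simp add: fscale_def synth_def)

lemma synth_zero: "synth 0 = 0"
  by (rule ext) (simp add: synth_def cnj_basis_ell2)

text \<open>A Hardy function vanishes off \<open>D\<close> and equals its series on
  \<open>D\<close>, so it is recovered from its coefficients. Elements are written as
  \<open>synth a\<close> from here on.\<close>

lemma fspace_hardy: "fspace (hardy D e) = synth ` fspace ell2"
proof (intro equalityI subsetI)
  fix f assume "f \<in> fspace (hardy D e)"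
  then obtain a where f: "\<And>x. x \<notin> D \<Longrightarrow> f x = 0" and a: "l2_expansion D e f a"
    by (auto simp: hardy_def)
  then have m: "a \<in> fspace ell2" by (simp add: l2_expansion_def mem_ell2)
  have "f = synth a"
  proof
    fix x show "f x = synth a x"
    proof (cases "x \<in> D")
      case True
      then have "((\<lambda>i. a i * e i x) has_sum f x) UNIV" using a by (auto simp: l2_expansion_def)
      then show ?thesis using synth_has_sum[OF m True] by (rule has_sum_unique)
    qed (simp add: f synth_def)
  qed
  then show "f \<in> synth ` fspace ell2" using m by blast
next
  fix f assume "f \<in> synth ` fspace ell2"
  then show "f \<in> fspace (hardy D e)"
    using expansion_synth by (auto simp: hardy_def) (auto simp: synth_def)
qed

lemma synth_mem [simp]: "a \<in> fspace ell2 \<Longrightarrow> synth a \<in> fspace (hardy D e)"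
  by (simp add: fspace_hardy)

lemma fip_synth:
  "a \<in> fspace ell2 \<Longrightarrow> b \<in> fspace ell2 \<Longrightarrow> fip (hardy D e) (synth a) (synth b) = fip ell2 a b"
  by (simp add: hardy_def coeffs_synth fip_ell2)

sublocale ip_space "hardy D e"
proof
  show "fvs.subspace (fspace (hardy D e))"
    unfolding fspace_hardy fvs.subspace_def
  proof (intro conjI ballI allI)
    show "0 \<in> synth ` fspace ell2"
      using synth_zero ell2.mem_zero by (metis image_eqI)
    show "f + g \<in> synth ` fspace ell2" if "f \<in> synth ` fspace ell2" "g \<in> synth ` fspace ell2" for f g
    proof -
      obtain a b where "a \<in> fspace ell2" "b \<in> fspace ell2" "f = synth a" "g = synth b"
        using \<open>f \<in> synth ` fspace ell2\<close> \<open>g \<in> synth ` fspace ell2\<close> by blast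
      then show ?thesis by (simp only: synth_add[symmetric] ell2.mem_add imageI)
    qed
    show "fscale c f \<in> synth ` fspace ell2" if "f \<in> synth ` fspace ell2" for c f
    proof -
      obtain a where "a \<in> fspace ell2" "f = synth a"
        using \<open>f \<in> synth ` fspace ell2\<close> by blast
      then show ?thesis by (simp only: synth_scale[symmetric] ell2.mem_scale imageI)
    qed
  qed
next
  fix f g h assume "f \<in> fspace (hardy D e)" "g \<in> fspace (hardy D e)" "h \<in> fspace (hardy D e)"
  then obtain a b c where *: "a \<in> fspace ell2" "b \<in> fspace ell2" "c \<in> fspace ell2"
    and "f = synth a" "g = synth b" "h = synth c"
    by (auto simp: fspace_hardy)
  then show "fip (hardy D e) (f + g) h = fip (hardy D e) f h + fip (hardy D e) g h"
    using fip_synth[OF ell2.mem_add[OF *(1,2)] *(3)] by (simp add: synth_add[symmetric] fip_synth ell2.ip_add)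
next
  fix x f h assume "f \<in> fspace (hardy D e)" "h \<in> fspace (hardy D e)"
  then obtain a b where *: "a \<in> fspace ell2" "b \<in> fspace ell2"
    and "f = synth a" "h = synth b"
    by (auto simp: fspace_hardy)
  then show "fip (hardy D e) (fscale x f) h = x * fip (hardy D e) f h"
    by (simp add: synth_scale[symmetric] fip_synth ell2.ip_scale)
next
  fix f g assume "f \<in> fspace (hardy D e)" "g \<in> fspace (hardy D e)"
  then show "fip (hardy D e) g f = cnj (fip (hardy D e) f g)"
    using ell2.ip_sym by (auto simp: fspace_hardy fip_synth)
next
  fix f assume "f \<in> fspace (hardy D e)"
  then show "0 \<le> Re (fip (hardy D e) f f)"
    using ell2.ip_nonneg by (auto simp: fspace_hardy fip_synth)
next
  fix f assume f: "f \<in> fspace (hardy D e)" "fip (hardy D e) f f = 0"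
  then obtain a where a: "a \<in> fspace ell2" "f = synth a"
    by (auto simp: fspace_hardy)
  then have "a = 0"
    using f(2) ell2.ip_definite[OF a(1)] by (simp add: fip_synth)
  then show "f = 0"
    using a(2) synth_zero by (simp only:)
qed

lemma fnorm_synth: "a \<in> fspace ell2 \<Longrightarrow> fnorm (hardy D e) (synth a) = fnorm ell2 a"
  by (simp add: fnorm_def fip_synth)

text \<open>Conjugation of \<open>T\<close> by the unitary \<open>synth\<close>.\<close>

definition transport :: "(('i \<Rightarrow> complex) \<Rightarrow> 'i \<Rightarrow> complex) \<Rightarrow> ('a \<Rightarrow> complex) \<Rightarrow> 'a \<Rightarrow> complex" where
  "transport T f = synth (T (l2_coeffs D e f))"

lemma transport_synth [simp]: "a \<in> fspace ell2 \<Longrightarrow> transport T (synth a) = synth (T a)"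
  by (simp add: transport_def coeffs_synth)

text \<open>Also serves operators with a definition of their own, such as multiplication by a
  coordinate, once they are known to correspond to \<open>T\<close> on coefficients.\<close>

lemma operatorI_synth:
  assumes T: "ell2.operator T" and U: "\<And>a. a \<in> fspace ell2 \<Longrightarrow> U (synth a) = synth (T a)"
  shows "operator U"
proof -
  obtain C where C: "C \<ge> 0" "\<And>f. f \<in> fspace ell2 \<Longrightarrow> fnorm ell2 (T f) \<le> C * fnorm ell2 f"
    using ell2.op_bound[OF T] by blast
  note T' = ell2.operatorD[OF T]
  show ?thesis
  proof (rule operatorI[where C = C])
    fix f g x assume "f \<in> fspace (hardy D e)" "g \<in> fspace (hardy D e)"
    then obtain a b where *: "a \<in> fspace ell2" "b \<in> fspace ell2" and f: "f = synth a" "g = synth b"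
      by (auto simp: fspace_hardy)
    show "U f \<in> fspace (hardy D e)" using * T' by (simp add: f U)
    show "fnorm (hardy D e) (U f) \<le> C * fnorm (hardy D e) f"
      using * T' C by (simp add: f U fnorm_synth)
    show "U (f + g) = U f + U g"
      using *
      by (simp only: f synth_add[OF *, symmetric] synth_add[OF T'(1)[OF *(1)] T'(1)[OF *(2)], symmetric]
          T' U ell2.mem_add)
    show "U (fscale x f) = fscale x (U f)"
      using *
      by (simp only: f synth_scale[OF *(1), symmetric] synth_scale[OF T'(1)[OF *(1)], symmetric]
          T' U ell2.mem_scale)
  qed
qed

lemma operator_transport: "ell2.operator T \<Longrightarrow> operator (transport T)"
  by (rule operatorI_synth) simp_all

lemma span_basis_dense:
  "fclosure (hardy D e) (fvs.span (range (\<lambda>i. synth (unit_fam i)))) = fspace (hardy D e)"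
proof
  show "fspace (hardy D e) \<subseteq> fclosure (hardy D e) (fvs.span (range (\<lambda>i. synth (unit_fam i))))"
  proof
    fix f assume f: "f \<in> fspace (hardy D e)"
    then obtain a where a: "a \<in> fspace ell2" "f = synth a"
      by (auto simp: fspace_hardy)
    obtain F where F: "\<And>n. finite (F n)" and lim: "(\<lambda>n. fnorm ell2 (cut_fam (F n) a - a)) \<longlonglongrightarrow> 0"
      using ell2_approx[OF a(1)] by blast
    have "synth (\<Sum>i\<in>G. fscale (a i) (unit_fam i)) \<in> fvs.span (range (\<lambda>i. synth (unit_fam i)))"
      if "finite G" for G
      using that
    proof (induction G rule: finite_induct)
      case empty
      show ?case by (simp only: sum.empty synth_zero fvs.span_zero)
    next
      case (insert i G)
      have "synth (\<Sum>i\<in>insert i G. fscale (a i) (unit_fam i)) =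
          fscale (a i) (synth (unit_fam i)) + synth (\<Sum>i\<in>G. fscale (a i) (unit_fam i))"
        unfolding sum.insert[OF insert.hyps]
        using insert.hyps ell2.mem_sum[of G "\<lambda>i. fscale (a i) (unit_fam i)" 0]
        by (subst synth_add) (simp_all only: synth_scale unit_fam_mem ell2.mem_scale ell2.mem_zero)
      then show ?case
        using fvs.span_add[OF fvs.span_scale[OF fvs.span_base[OF rangeI]] insert.IH] by (simp only:)
    qed
    then have "synth (cut_fam (F n) a) \<in> fvs.span (range (\<lambda>i. synth (unit_fam i)))" for n
      using F by (simp only: cut_fam_eq_sum)
    moreover have "fnorm (hardy D e) (synth (cut_fam (F n) a) - f) = fnorm ell2 (cut_fam (F n) a - a)" for n
      unfolding a(2) synth_diff[OF cut_fam_mem[OF F] a(1), symmetric]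
      using F a by (intro fnorm_synth) auto
    ultimately show "f \<in> fclosure (hardy D e) (fvs.span (range (\<lambda>i. synth (unit_fam i))))"
      unfolding fclosure_def using f lim by (auto intro!: exI[of _ "\<lambda>n. synth (cut_fam (F n) a)"])
  qed
qed (auto simp: fclosure_def)

end

section \<open>The disk and the bidisk as instances\<close>

lemma power_series_unique:
  assumes "\<And>z. z \<in> disk \<Longrightarrow> (\<lambda>n. a n * z ^ n) sums f z"
    and "\<And>z. z \<in> disk \<Longrightarrow> (\<lambda>n. b n * z ^ n) sums f z"
  shows "a = b"
proof
  fix n
  have ev: "eventually (\<lambda>z. z \<in> disk) (nhds 0)"
    by (rule eventually_nhds_in_open) (auto simp: disk_def)
  have "f has_fps_expansion Abs_fps a" "f has_fps_expansion Abs_fps b"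
    by (rule has_fps_expansionI, use ev in eventually_elim, use assms in simp)+
  then have "fps_nth (Abs_fps a) n = fps_nth (Abs_fps b) n"
    by (simp only: fps_nth_fps_expansion)
  then show "a n = b n" by simp
qed

lemma monomials_ell2:
  assumes "z \<in> disk"
  shows "(\<lambda>n. z ^ n) \<in> fspace ell2"
proof -
  have "norm ((norm z)\<^sup>2) < 1" using assms by (simp add: disk_def abs_square_less_1)
  then have "summable (\<lambda>n. ((norm z)\<^sup>2) ^ n)" by (rule summable_geometric)
  then show ?thesis
    by (simp add: mem_ell2 summable_on_UNIV_nonneg_real_iff norm_power power_mult[symmetric] mult.commute)
qed

interpretation disk: hardy_basis disk "\<lambda>n z. z ^ n"
  rewrites "hardy disk (\<lambda>n z. z ^ n) = hardy_disk"
proof -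
  show "hardy_basis disk (\<lambda>n z. z ^ n)"
  proof
    fix f a b assume "l2_expansion disk (\<lambda>n z. z ^ n) f a" "l2_expansion disk (\<lambda>n z. z ^ n) f b"
    then show "a = b"
      by (intro power_series_unique[of a f b]) (auto simp: l2_expansion_def intro: has_sum_imp_sums)
  qed (rule monomials_ell2)
qed (simp add: hardy_disk_def)

lemma basis_pair: "(\<lambda>i. (case i of (m, n) \<Rightarrow> \<lambda>(z1, z2). z1 ^ m * z2 ^ n) (z1, z2)) =
    tensor_fam (\<lambda>m. z1 ^ m) (\<lambda>n. z2 ^ n)" for z1 z2 :: complex
  by (auto simp: tensor_fam_def)

text \<open>Summing over the powers of \<open>z2\<close> before those of \<open>z1\<close> presents
  \<open>f\<close> as a power series in \<open>z1\<close> whose coefficients are Hardy functions of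
  \<open>z2\<close>. This is how the bidisk is reduced to the disk.\<close>

lemma expansion_rows:
  assumes "l2_expansion (disk \<times> disk) (\<lambda>(m, n) (z1, z2). z1 ^ m * z2 ^ n) f a"
    and "z1 \<in> disk" "z2 \<in> disk"
  shows "a \<in> fspace ell2" "((\<lambda>m. disk.synth (fam_row a m) z2 * z1 ^ m) has_sum f (z1, z2)) UNIV"
proof -
  show a: "a \<in> fspace ell2" using assms by (simp add: l2_expansion_def mem_ell2)
  have "((\<lambda>(m, n). a (m, n) * (z1 ^ m * z2 ^ n)) has_sum f (z1, z2)) (Sigma UNIV (\<lambda>_. UNIV))"
    using assms by (auto simp: l2_expansion_def case_prod_unfold)
  then show "((\<lambda>m. disk.synth (fam_row a m) z2 * z1 ^ m) has_sum f (z1, z2)) UNIV"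
  proof (rule has_sum_SigmaD)
    fix m
    show "((\<lambda>n. case (m, n) of (m, n) \<Rightarrow> a (m, n) * (z1 ^ m * z2 ^ n)) has_sum disk.synth (fam_row a m) z2 * z1 ^ m) UNIV"
      using has_sum_cmult_left[OF disk.synth_has_sum[OF row_mem[OF a] assms(3)], of m "z1 ^ m"]
      by (simp add: fam_row_def mult_ac)
  qed
qed

interpretation bidisk: hardy_basis "disk \<times> disk" "\<lambda>(m, n) (z1, z2). z1 ^ m * z2 ^ n"
  rewrites "hardy (disk \<times> disk) (\<lambda>(m, n) (z1, z2). z1 ^ m * z2 ^ n) = hardy_bidisk"
proof -
  show "hardy_basis (disk \<times> disk) (\<lambda>(m, n) (z1, z2). z1 ^ m * z2 ^ n)"
  proof
    fix x :: "complex \<times> complex" assume "x \<in> disk \<times> disk"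
    then show "(\<lambda>i. (case i of (m, n) \<Rightarrow> \<lambda>(z1, z2). z1 ^ m * z2 ^ n) x) \<in> fspace ell2"
      by (cases x) (simp only: basis_pair tensor_fam_mem monomials_ell2 mem_Times_iff fst_conv snd_conv)
  next
    fix f a b
    assume a: "l2_expansion (disk \<times> disk) (\<lambda>(m, n) (z1, z2). z1 ^ m * z2 ^ n) f a"
      and b: "l2_expansion (disk \<times> disk) (\<lambda>(m, n) (z1, z2). z1 ^ m * z2 ^ n) f b"
    have 0: "0 \<in> disk" by (simp add: disk_def)
    have m: "a \<in> fspace ell2" "b \<in> fspace ell2"
      using expansion_rows(1)[OF a 0 0] expansion_rows(1)[OF b 0 0] .
    \<comment> \<open>Uniqueness in two stages: for fixed \<open>z2\<close> the power series in
      \<open>z1\<close> determines its coefficients, and these, as functions of \<open>z2\<close>,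
      determine the rows.\<close>
    have "(\<lambda>m. disk.synth (fam_row a m) z2) = (\<lambda>m. disk.synth (fam_row b m) z2)" if "z2 \<in> disk" for z2
    proof (rule power_series_unique[where f = "\<lambda>z1. f (z1, z2)"])
      fix z1 assume z1: "z1 \<in> disk"
      show "(\<lambda>m. disk.synth (fam_row a m) z2 * z1 ^ m) sums f (z1, z2)"
        by (rule has_sum_imp_sums[OF expansion_rows(2)[OF a z1 that]])
      show "(\<lambda>m. disk.synth (fam_row b m) z2 * z1 ^ m) sums f (z1, z2)"
        by (rule has_sum_imp_sums[OF expansion_rows(2)[OF b z1 that]])
    qed
    then have "disk.synth (fam_row a m) z2 = disk.synth (fam_row b m) z2" for m z2
      by (cases "z2 \<in> disk") (metis, simp add: disk.synth_def)
    then have "disk.synth (fam_row a m) = disk.synth (fam_row b m)" for m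
      by blast
    then have "fam_row a m = fam_row b m" for m
      by (rule iffD1[OF disk.synth_inj[OF row_mem[OF m(1)] row_mem[OF m(2)]]])
    then show "a = b" by (rule row_eqI)
  qed
qed (simp add: hardy_bidisk_def)

lemma bidisk_synth_rows:
  assumes "a \<in> fspace ell2" "z1 \<in> disk" "z2 \<in> disk"
  shows "((\<lambda>m. disk.synth (fam_row a m) z2 * z1 ^ m) has_sum bidisk.synth a (z1, z2)) UNIV"
  using expansion_rows(2)[OF bidisk.expansion_synth] assms by blast

text \<open>Row \<open>m\<close> of the tensor is \<open>u m\<close> times \<open>v\<close>, so the
  row sums share the factor \<open>disk.synth v z2\<close>. Off the bidisk one factor on the right
  vanishes.\<close>

lemma bidisk_synth_tensor_fam:
  assumes u: "u \<in> fspace ell2" and v: "v \<in> fspace ell2"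
  shows "bidisk.synth (tensor_fam u v) = elem_tensor (disk.synth u) (disk.synth v)"
proof
  fix p :: "complex \<times> complex"
  obtain z1 z2 where p: "p = (z1, z2)" by (cases p)
  show "bidisk.synth (tensor_fam u v) p = elem_tensor (disk.synth u) (disk.synth v) p"
  proof (cases "z1 \<in> disk \<and> z2 \<in> disk")
    case True
    then have "((\<lambda>m. disk.synth v z2 * (u m * z1 ^ m)) has_sum bidisk.synth (tensor_fam u v) p) UNIV"
      using bidisk_synth_rows[of "tensor_fam u v" z1 z2] u v
      by (simp add: p row_tensor_fam disk.synth_scale) (simp add: fscale_def mult_ac)
    moreover have "((\<lambda>m. disk.synth v z2 * (u m * z1 ^ m)) has_sum disk.synth v z2 * disk.synth u z1) UNIV"
      using True u by (intro has_sum_cmult_right disk.synth_has_sum) auto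
    ultimately show ?thesis
      by (simp add: p elem_tensor_def has_sum_unique mult.commute)
  qed (auto simp: p elem_tensor_def bidisk.synth_def disk.synth_def)
qed

lemma bidisk_synth_swap:
  assumes a: "a \<in> fspace ell2"
  shows "bidisk.synth (swap_fam a) (z2, z1) = bidisk.synth a (z1, z2)"
proof (cases "z1 \<in> disk \<and> z2 \<in> disk")
  case True
  let ?g = "\<lambda>q. a q * (case q of (m, n) \<Rightarrow> \<lambda>(z1, z2). z1 ^ m * z2 ^ n) (z1, z2)"
  have "((\<lambda>p. swap_fam a p * (case p of (m, n) \<Rightarrow> \<lambda>(z1, z2). z1 ^ m * z2 ^ n) (z2, z1)) has_sum
      bidisk.synth (swap_fam a) (z2, z1)) UNIV"
    using True a by (intro bidisk.synth_has_sum) auto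
  moreover have "(\<lambda>p. swap_fam a p * (case p of (m, n) \<Rightarrow> \<lambda>(z1, z2). z1 ^ m * z2 ^ n) (z2, z1)) =
      (\<lambda>p. ?g (prod.swap p))"
    by (auto simp: swap_fam_def mult_ac fun_eq_iff)
  ultimately have "((\<lambda>p. ?g (prod.swap p)) has_sum bidisk.synth (swap_fam a) (z2, z1)) UNIV"
    by (simp only:)
  then have "(?g has_sum bidisk.synth (swap_fam a) (z2, z1)) UNIV"
    by (rule has_sum_swap_fam[of ?g, THEN iffD1])
  then show ?thesis
    using bidisk.synth_has_sum[OF a, of "(z1, z2)"] True by (auto dest: has_sum_unique)
qed (auto simp: bidisk.synth_def)

text \<open>For fixed \<open>z2\<close> the factor \<open>h z2\<close> is a scalar and can be moved
  into each coefficient of the power series in \<open>z1\<close>, where the one-variable formula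
  applies.\<close>

lemma mult_op_lift2:
  assumes W: "ell2.operator W"
    and mult: "\<And>b. b \<in> fspace ell2 \<Longrightarrow> mult_op h (disk.synth b) = disk.synth (W b)"
    and a: "a \<in> fspace ell2"
  shows "mult_op (\<lambda>p. h (snd p)) (bidisk.synth a) = bidisk.synth (lift2 W a)"
proof
  fix p :: "complex \<times> complex"
  obtain z1 z2 where p: "p = (z1, z2)" by (cases p)
  show "mult_op (\<lambda>p. h (snd p)) (bidisk.synth a) p = bidisk.synth (lift2 W a) p"
  proof (cases "z1 \<in> disk \<and> z2 \<in> disk")
    case True
    have "((\<lambda>m. h z2 * (disk.synth (fam_row a m) z2 * z1 ^ m)) has_sum h z2 * bidisk.synth a (z1, z2)) UNIV"
      using True a by (intro has_sum_cmult_right bidisk_synth_rows) auto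
    moreover have "h z2 * (disk.synth (fam_row a m) z2 * z1 ^ m) = disk.synth (fam_row (lift2 W a) m) z2 * z1 ^ m" for m
      using mult[OF row_mem[OF a], THEN fun_cong, of m z2] by (simp add: mult_op_def mult_ac)
    moreover have "((\<lambda>m. disk.synth (fam_row (lift2 W a) m) z2 * z1 ^ m) has_sum bidisk.synth (lift2 W a) (z1, z2)) UNIV"
      using True a ell2.op_mem[OF operator_lift2[OF W]] by (intro bidisk_synth_rows) auto
    ultimately show ?thesis
      by (simp add: p mult_op_def has_sum_unique)
  qed (auto simp: p mult_op_def bidisk.synth_def)
qed

lemma mult_op_lift1:
  assumes W: "ell2.operator W"
    and mult: "\<And>b. b \<in> fspace ell2 \<Longrightarrow> mult_op h (disk.synth b) = disk.synth (W b)"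
    and a: "a \<in> fspace ell2"
  shows "mult_op (\<lambda>p. h (fst p)) (bidisk.synth a) = bidisk.synth (lift1 W a)"
proof
  fix p :: "complex \<times> complex"
  obtain z1 z2 where p: "p = (z1, z2)" by (cases p)
  have "mult_op (\<lambda>p. h (fst p)) (bidisk.synth a) p =
      mult_op (\<lambda>p. h (snd p)) (bidisk.synth (swap_fam a)) (z2, z1)"
    using a by (simp add: p mult_op_def bidisk_synth_swap)
  also have "\<dots> = bidisk.synth (lift2 W (swap_fam a)) (z2, z1)"
    using a by (subst mult_op_lift2[OF W mult]) auto
  also have "\<dots> = bidisk.synth (lift1 W a) p"
    using a ell2.op_mem[OF operator_lift2[OF W], of "swap_fam a"]
    by (simp add: p lift1_def bidisk_synth_swap)
  finally show "mult_op (\<lambda>p. h (fst p)) (bidisk.synth a) p = bidisk.synth (lift1 W a) p" .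
qed

text \<open>Square-summable coefficients give absolutely convergent power series inside the disk, so
  the Cauchy product applies and its coefficients are the convolution.\<close>

lemma mult_op_conv:
  assumes c: "isometric_coeffs c" and h: "\<And>z. z \<in> disk \<Longrightarrow> (\<lambda>n. c n * z ^ n) sums h z"
    and a: "a \<in> fspace ell2"
  shows "mult_op h (disk.synth a) = disk.synth (conv c a)"
proof
  interpret isometric_coeffs c by fact
  fix z
  show "mult_op h (disk.synth a) z = disk.synth (conv c a) z"
  proof (cases "z \<in> disk")
    case True
    have abs: "summable (\<lambda>n. norm (b n * z ^ n))" if "b \<in> fspace ell2" for b
      using ell2_abs_summable[OF that disk.cnj_basis_ell2[OF True]]
      by (simp add: summable_on_UNIV_nonneg_real_iff)
    have s: "(\<Sum>n. a n * z ^ n) = disk.synth a z" "(\<Sum>n. c n * z ^ n) = h z"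
      using has_sum_imp_sums[OF disk.synth_has_sum[OF a True]] h[OF True] by (auto simp: sums_iff)
    have "(\<lambda>m. \<Sum>i\<le>m. (a i * z ^ i) * (c (m - i) * z ^ (m - i))) sums (disk.synth a z * h z)"
      using Cauchy_product_sums[OF abs[OF a] abs[OF mem]] by (simp only: s)
    moreover have "(\<Sum>i\<le>m. (a i * z ^ i) * (c (m - i) * z ^ (m - i))) = conv c a m * z ^ m" for m
      unfolding conv_def sum_distrib_right
      by (intro sum.cong) (auto simp flip: power_add)
    ultimately have "(\<lambda>m. conv c a m * z ^ m) sums (disk.synth a z * h z)" by simp
    moreover have "(\<lambda>m. conv c a m * z ^ m) sums disk.synth (conv c a) z"
      by (intro has_sum_imp_sums disk.synth_has_sum conv_bounded a True)
    ultimately show ?thesis by (simp add: mult_op_def sums_unique2 mult.commute)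
  qed (auto simp: mult_op_def disk.synth_def)
qed

section \<open>Pairs of commuting projections\<close>

context ip_space
begin

text \<open>Counterpart of \<open>op_eq_on_closure\<close> for maps that are controlled on
  \<open>M\<close> only. The candidates in the definition of \<open>tensor_op\<close> are of this
  kind.\<close>

lemma bounded_linear_map_eq:
  assumes M: "closed_subspace H M" and B: "B \<subseteq> M"
    and T: "bounded_linear_map H M T" and U: "bounded_linear_map H M U"
    and eq: "\<And>f. f \<in> B \<Longrightarrow> T f = U f" and f: "f \<in> M" "f \<in> fclosure H (fvs.span B)"
  shows "T f = U f"
proof -
  note M' = M[unfolded closed_subspace_def]
  note sub = M'[THEN conjunct2, THEN conjunct1]
  have diff: "R (g - h) = R g - R h" if "bounded_linear_map H M R" "g \<in> M" "h \<in> M" for R g h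
  proof -
    have "R ((g - h) + h) = R (g - h) + R h"
      using that fvs.subspace_diff[OF sub that(2,3)] unfolding bounded_linear_map_def by blast
    then show ?thesis by simp
  qed
  have lim: "(\<lambda>n. fnorm H (R (s n) - R f)) \<longlonglongrightarrow> 0"
    if R: "bounded_linear_map H M R" and s: "\<And>n. s n \<in> M" and lim: "(\<lambda>n. fnorm H (s n - f)) \<longlonglongrightarrow> 0" for R s
  proof -
    obtain C where C: "\<And>g. g \<in> M \<Longrightarrow> fnorm H (R g) \<le> C * fnorm H g"
      using R unfolding bounded_linear_map_def by metis
    have sf: "s n - f \<in> M" for n
      using fvs.subspace_diff[OF sub s f(1)] .
    have R_mem: "R g \<in> fspace H" if "g \<in> M" for g
      using R that unfolding bounded_linear_map_def by blast
    show ?thesis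
    proof (rule Lim_null_comparison)
      show "(\<lambda>n. C * fnorm H (s n - f)) \<longlonglongrightarrow> 0"
        using tendsto_mult_left[OF lim, of C] by simp
      show "\<forall>\<^sub>F n in sequentially. norm (fnorm H (R (s n) - R f)) \<le> C * fnorm H (s n - f)"
      proof (intro always_eventually allI)
        fix n
        have "0 \<le> fnorm H (R (s n) - R f)"
          by (intro fnorm_nonneg mem_diff R_mem s f)
        then show "norm (fnorm H (R (s n) - R f)) \<le> C * fnorm H (s n - f)"
          using C[OF sf[of n]] unfolding diff[OF R s f(1)] by simp
      qed
    qed
  qed
  have "fvs.subspace {g \<in> M. T g = U g}"
    unfolding fvs.subspace_def
  proof (intro conjI ballI allI)
    have "R 0 = 0" if "bounded_linear_map H M R" for R
      using diff[OF that f(1) f(1)] by simp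
    then show "0 \<in> {g \<in> M. T g = U g}"
      using T U fvs.subspace_0[OF sub] by simp
  next
    fix g h assume "g \<in> {g \<in> M. T g = U g}" "h \<in> {g \<in> M. T g = U g}"
    then have gh: "g \<in> M" "h \<in> M" "T g = U g" "T h = U h" by auto
    have "T (g + h) = T g + T h" "U (g + h) = U g + U h"
      using T U gh(1,2) unfolding bounded_linear_map_def by blast+
    then show "g + h \<in> {g \<in> M. T g = U g}"
      using fvs.subspace_add[OF sub gh(1,2)] by (simp only: gh mem_Collect_eq)
  next
    fix c g assume "g \<in> {g \<in> M. T g = U g}"
    then have g: "g \<in> M" "T g = U g" by auto
    have "T (fscale c g) = fscale c (T g)" "U (fscale c g) = fscale c (U g)"
      using T U g(1) unfolding bounded_linear_map_def by blast+
    then show "fscale c g \<in> {g \<in> M. T g = U g}"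
      using fvs.subspace_scale[OF sub g(1)] by (simp only: g mem_Collect_eq)
  qed
  then have span: "fvs.span B \<subseteq> {g \<in> M. T g = U g}"
    using B eq by (intro fvs.span_minimal) auto
  obtain s where s: "\<And>n. s n \<in> fvs.span B" and lim_s: "(\<lambda>n. fnorm H (s n - f)) \<longlonglongrightarrow> 0"
    using f(2) unfolding fclosure_def by blast
  have sM: "s n \<in> M" and TU: "T (s n) = U (s n)" for n
    using s span by auto
  have mem: "T g \<in> fspace H" "U g \<in> fspace H" if "g \<in> M" for g
    using T U that unfolding bounded_linear_map_def by blast+
  show ?thesis
  proof (rule limit_unique)
    show "(\<lambda>n. fnorm H (T (s n) - T f)) \<longlonglongrightarrow> 0" by (rule lim[OF T sM lim_s])
    show "(\<lambda>n. fnorm H (T (s n) - U f)) \<longlonglongrightarrow> 0"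
      unfolding TU by (rule lim[OF U sM lim_s])
  qed (use mem f(1) sM in auto)
qed

lemma bounded_linear_map_restrict:
  assumes U: "operator U" and M: "closed_subspace H M"
  shows "bounded_linear_map H M (restrict U M)"
proof -
  have sub: "fvs.subspace M" "M \<subseteq> fspace H" using M by (auto simp: closed_subspace_def)
  have add: "f + g \<in> M" and scale: "fscale c f \<in> M" if "f \<in> M" "g \<in> M" for f g c
    using fvs.subspace_add[OF sub(1)] fvs.subspace_scale[OF sub(1)] that by auto
  obtain C where "\<And>f. f \<in> fspace H \<Longrightarrow> fnorm H (U f) \<le> C * fnorm H f"
    using op_bound[OF U] by blast
  then have C: "\<exists>C. \<forall>f\<in>M. fnorm H (restrict U M f) \<le> C * fnorm H f"
    using sub(2) by (intro exI[of _ C]) auto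
  have m: "f \<in> fspace H" if "f \<in> M" for f using that sub(2) by auto
  show ?thesis
    unfolding bounded_linear_map_def
  proof (intro conjI C ballI allI)
    show "restrict U M ` M \<subseteq> fspace H" using op_mem[OF U] sub(2) by auto
    show "restrict U M (f + g) = restrict U M f + restrict U M g" if "f \<in> M" "g \<in> M" for f g
      using add[OF that] that op_add[OF U m m] by (simp only: restrict_apply' simp_thms if_True)
    show "restrict U M (fscale c f) = fscale c (restrict U M f)" if "f \<in> M" for c f
      using scale[OF that that] that op_scale[OF U m] by (simp only: restrict_apply' simp_thms if_True)
  qed
qed

text \<open>Idempotence puts \<open>f - P f\<close> into the kernel; self-adjointness makes
  \<open>P f\<close> orthogonal to it.\<close>

lemma orth_proj_kernel:
  assumes P: "operator P" and idem: "\<And>f. f \<in> fspace H \<Longrightarrow> P (P f) = P f"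
    and selfadjoint: "\<And>f g. f \<in> fspace H \<Longrightarrow> g \<in> fspace H \<Longrightarrow> fip H (P f) g = fip H f (P g)"
    and f: "f \<in> fspace H"
  shows "orth_proj H {f \<in> fspace H. P f = 0} f = f - P f"
proof (rule orth_proj_eq)
  have m: "P f \<in> fspace H" using op_mem[OF P f] .
  show "f - P f \<in> {f \<in> fspace H. P f = 0}"
    using op_diff[OF P f m] mem_diff[OF f m] idem[OF f] by simp
  fix h assume h: "h \<in> {f \<in> fspace H. P f = 0}"
  have "fip H (f - (f - P f)) h = fip H (P f) h" by simp
  also have "\<dots> = fip H f (P h)" using f h by (simp add: selfadjoint)
  also have "\<dots> = 0" using f h by simp
  finally show "fip H (f - (f - P f)) h = 0" .
qed (use closed_subspace_kernel[OF P] f in \<open>auto simp: closed_subspace_def\<close>)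

text \<open>The assumptions say that \<open>P\<close> is the projection onto the range of
  \<open>V\<close>. Applied to multiplication by an inner function, on the disk and on the bidisk,
  it turns the model space into a kernel.\<close>

lemma ominus_range:
  assumes P: "operator P"
    and selfadjoint: "\<And>f g. f \<in> fspace H \<Longrightarrow> g \<in> fspace H \<Longrightarrow> fip H (P f) g = fip H f (P g)"
    and V: "\<And>g. g \<in> fspace H \<Longrightarrow> V g \<in> fspace H" "\<And>g. g \<in> fspace H \<Longrightarrow> P (V g) = V g"
    and range: "\<And>f. f \<in> fspace H \<Longrightarrow> P f \<in> V ` fspace H"
  shows "ominus H (fspace H) (V ` fspace H) = {f \<in> fspace H. P f = 0}"
proof (intro equalityI subsetI)
  fix f assume "f \<in> ominus H (fspace H) (V ` fspace H)"
  then have f: "f \<in> fspace H" and orth: "\<And>g. g \<in> V ` fspace H \<Longrightarrow> fip H f g = 0"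
    by (auto simp: ominus_def)
  have m: "P f \<in> fspace H" using op_mem[OF P f] .
  have "P (P f) = P f" using range[OF f] V(2) by auto
  then have "fip H (P f) (P f) = fip H f (P f)" using selfadjoint[OF f m] by simp
  also have "\<dots> = 0" by (rule orth[OF range[OF f]])
  finally show "f \<in> {f \<in> fspace H. P f = 0}" using ip_definite[OF m] f by simp
next
  fix f assume f: "f \<in> {f \<in> fspace H. P f = 0}"
  have "fip H f (V g) = 0" if g: "g \<in> fspace H" for g
  proof -
    have "fip H f (V g) = fip H (P f) (V g)"
      using selfadjoint[of f "V g"] f V g by simp
    then show ?thesis using f V(1)[OF g] by simp
  qed
  then show "f \<in> ominus H (fspace H) (V ` fspace H)" using f by (auto simp: ominus_def)
qed

end

text \<open>\<open>P\<close> and \<open>Z\<close> belong to one variable and \<open>Q\<close> to the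
  other, so \<open>Q\<close> commutes with both. The last axiom says that no nonzero vector has its
  whole \<open>Z\<close>-orbit in the kernel of \<open>P\<close>.\<close>

locale commuting_projections = ip_space +
  fixes P Q Z :: "('a \<Rightarrow> complex) \<Rightarrow> 'a \<Rightarrow> complex"
  assumes P: "operator P" and Q: "operator Q" and Z: "operator Z"
    and P_idem: "\<And>f. f \<in> fspace H \<Longrightarrow> P (P f) = P f"
    and Q_idem: "\<And>f. f \<in> fspace H \<Longrightarrow> Q (Q f) = Q f"
    and P_selfadjoint: "\<And>f g. f \<in> fspace H \<Longrightarrow> g \<in> fspace H \<Longrightarrow> fip H (P f) g = fip H f (P g)"
    and Q_selfadjoint: "\<And>f g. f \<in> fspace H \<Longrightarrow> g \<in> fspace H \<Longrightarrow> fip H (Q f) g = fip H f (Q g)"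
    and P_Q: "\<And>f. f \<in> fspace H \<Longrightarrow> P (Q f) = Q (P f)"
    and Z_Q: "\<And>f. f \<in> fspace H \<Longrightarrow> Z (Q f) = Q (Z f)"
    and no_invariant: "\<And>f. f \<in> fspace H \<Longrightarrow> (\<And>n. P ((Z ^^ n) f) = 0) \<Longrightarrow> f = 0"
begin

definition K where "K = {f \<in> fspace H. P (Q f) = 0}"
definition Kmax where "Kmax = {f \<in> fspace H. Q f = 0}"
definition Kmin where "Kmin = {f \<in> fspace H. P f = 0 \<and> Q f = f}"

text \<open>On \<open>Kmin\<close> this is the compression of \<open>Z\<close> to \<open>K\<close>:
  there \<open>Q\<close> fixes \<open>Z f\<close>, so \<open>1 - P Q\<close> acts on
  \<open>Z f\<close> as \<open>1 - P\<close>.\<close>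

definition compression where "compression f = Z f - P (Z f)"

lemmas mems = op_mem[OF P] op_mem[OF Q] op_mem[OF Z]

lemma closed_subspace_K: "closed_subspace H K"
  unfolding K_def by (rule closed_subspace_kernel[OF operator_comp[OF P Q]])

lemma closed_subspace_Kmax: "closed_subspace H Kmax"
  unfolding Kmax_def by (rule closed_subspace_kernel[OF Q])

text \<open>\<open>Kmin\<close> is the fixed space of the projection \<open>Q - P Q\<close>, hence
  the kernel of its complement.\<close>

lemma closed_subspace_Kmin: "closed_subspace H Kmin"
proof -
  have op: "operator (\<lambda>f. f - (Q f - P (Q f)))"
    by (rule operator_diff[OF operator_id operator_diff[OF Q operator_comp[OF P Q]]])
  have "Kmin = {f \<in> fspace H. f - (Q f - P (Q f)) = 0}"
  proof (intro equalityI subsetI)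
    fix f assume "f \<in> {f \<in> fspace H. f - (Q f - P (Q f)) = 0}"
    then have f: "f \<in> fspace H" and eq: "f = Q f - P (Q f)" by auto
    have "P f = P (Q f) - P (P (Q f))"
      by (subst eq) (intro op_diff[OF P] mems f)
    moreover have "Q f = Q (Q f) - Q (P (Q f))"
      by (subst eq) (intro op_diff[OF Q] mems f)
    ultimately have "P f = 0" "Q f = f"
      using eq f by (simp_all add: P_idem Q_idem mems P_Q[symmetric])
    then show "f \<in> Kmin" using f by (simp add: Kmin_def)
  qed (auto simp: Kmin_def)
  then show ?thesis using closed_subspace_kernel[OF op] by (simp only:)
qed

lemma PQ_idem: "f \<in> fspace H \<Longrightarrow> P (Q (P (Q f))) = P (Q f)"
  by (simp add: P_Q mems P_idem Q_idem)

lemma orth_proj_K: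
  assumes f: "f \<in> fspace H"
  shows "orth_proj H K f = f - P (Q f)"
  unfolding K_def
proof (rule orth_proj_kernel[OF operator_comp[OF P Q] _ _ f])
  fix f g assume "f \<in> fspace H" "g \<in> fspace H"
  then show "fip H (P (Q f)) g = fip H f (P (Q g))"
    by (simp add: P_selfadjoint Q_selfadjoint mems P_Q)
qed (rule PQ_idem)

text \<open>If the orbit of \<open>f\<close> stays in \<open>K\<close>, then \<open>P Q\<close>
  annihilates it; moving \<open>Q\<close> past the powers of \<open>Z\<close> shows that
  \<open>P\<close> annihilates the orbit of \<open>Q f\<close>, so \<open>Q f = 0\<close>.\<close>

lemma Kmax_greatest:
  "(GREATEST M. closed_subspace H M \<and> M \<subseteq> K \<and> Z ` M \<subseteq> M) = Kmax"
proof (rule Greatest_equality)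
  have "Kmax \<subseteq> K" using op_zero[OF P] by (auto simp: Kmax_def K_def)
  moreover have "Z ` Kmax \<subseteq> Kmax"
    using Z_Q op_zero[OF Z] by (auto simp: Kmax_def mems) metis
  ultimately show "closed_subspace H Kmax \<and> Kmax \<subseteq> K \<and> Z ` Kmax \<subseteq> Kmax"
    using closed_subspace_Kmax by blast
next
  fix M assume M: "closed_subspace H M \<and> M \<subseteq> K \<and> Z ` M \<subseteq> M"
  show "M \<subseteq> Kmax"
  proof
    fix f assume f: "f \<in> M"
    then have fm: "f \<in> fspace H" using M by (auto simp: closed_subspace_def)
    have Zf: "(Z ^^ n) f \<in> M" for n using M f by (induction n) auto
    then have Zfm: "(Z ^^ n) f \<in> fspace H" for n using M by (auto simp: closed_subspace_def)
    have "(Z ^^ n) (Q f) = Q ((Z ^^ n) f)" for n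
      by (induction n) (simp_all add: Z_Q Zfm)
    moreover have "P (Q ((Z ^^ n) f)) = 0" for n
      using Zf[of n] M by (auto simp: K_def)
    ultimately have "P ((Z ^^ n) (Q f)) = 0" for n by (simp only:)
    then have "Q f = 0" by (rule no_invariant[OF mems(2)[OF fm]])
    then show "f \<in> Kmax" using fm by (simp add: Kmax_def)
  qed
qed

lemma orth_Kmax_Kmin:
  assumes "f \<in> Kmax" "g \<in> Kmin"
  shows "fip H f g = 0" "fip H g f = 0"
proof -
  have m: "f \<in> fspace H" "g \<in> fspace H" using assms by (auto simp: Kmax_def Kmin_def)
  have "fip H f g = fip H (Q f) g"
    using assms m Q_selfadjoint[OF m] by (simp add: Kmin_def)
  then show "fip H f g = 0" using assms m by (simp add: Kmax_def)
  then show "fip H g f = 0" using ip_sym[OF m] by simp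
qed

lemma Q_mem_Kmin: "f \<in> K \<Longrightarrow> Q f \<in> Kmin"
  by (auto simp: K_def Kmin_def mems Q_idem)

lemma diff_Q_mem_Kmax: "f \<in> K \<Longrightarrow> f - Q f \<in> Kmax"
  by (simp add: K_def Kmax_def mems Q_idem op_diff[OF Q] del: minus_apply)

lemma Kmax_subset: "Kmax \<subseteq> K" and Kmin_subset: "Kmin \<subseteq> K"
  using op_zero[OF P] by (auto simp: Kmax_def Kmin_def K_def)

lemma K_mem: "f \<in> K \<Longrightarrow> f \<in> fspace H"
  by (simp add: K_def)

text \<open>For \<open>f\<close> in the complement, \<open>f - Q f\<close> lies in
  \<open>Kmax\<close>; it is orthogonal to \<open>f\<close> by assumption and to \<open>Q f\<close>
  because that lies in \<open>Kmin\<close>, so it vanishes.\<close>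

lemma ominus_Kmax: "ominus H K Kmax = Kmin"
proof (intro equalityI subsetI)
  fix f assume f: "f \<in> ominus H K Kmax"
  then have fK: "f \<in> K" by (simp add: ominus_def)
  note m = K_mem[OF fK] mems(2)[OF K_mem[OF fK]]
  note d = diff_Q_mem_Kmax[OF fK]
  have "fip H (f - Q f) (f - Q f) = fip H f (f - Q f) - fip H (Q f) (f - Q f)"
    using m by (intro ip_diff mem_diff)
  also have "fip H f (f - Q f) = 0" using f d by (simp add: ominus_def)
  also have "fip H (Q f) (f - Q f) = 0" using orth_Kmax_Kmin(2)[OF d Q_mem_Kmin[OF fK]] .
  finally have "fip H (f - Q f) (f - Q f) = 0" by (simp only: diff_zero)
  then have "f - Q f = 0" by (rule ip_definite[OF mem_diff[OF m]])
  then have "f = Q f" by simp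
  then show "f \<in> Kmin" using Q_mem_Kmin[OF fK] by (simp only:)
next
  fix f assume "f \<in> Kmin"
  then show "f \<in> ominus H K Kmax"
    using Kmin_subset orth_Kmax_Kmin(2) by (auto simp: ominus_def)
qed

lemma ominus_Kmin: "ominus H K Kmin = Kmax"
proof (intro equalityI subsetI)
  fix f assume f: "f \<in> ominus H K Kmin"
  then have fK: "f \<in> K" by (simp add: ominus_def)
  note m = K_mem[OF fK] mems(2)[OF K_mem[OF fK]]
  have "fip H (Q f) (Q f) = fip H f (Q f)"
    using m by (simp add: Q_selfadjoint Q_idem)
  also have "\<dots> = 0" using f Q_mem_Kmin[OF fK] by (simp add: ominus_def)
  finally have "Q f = 0" using m by (intro ip_definite)
  then show "f \<in> Kmax" using m by (simp add: Kmax_def)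
next
  fix f assume "f \<in> Kmax"
  then show "f \<in> ominus H K Kmin"
    using Kmax_subset orth_Kmax_Kmin(1) by (auto simp: ominus_def)
qed

lemma K_decomposition: "K = {f + g |f g. f \<in> Kmax \<and> g \<in> Kmin}"
proof (intro equalityI subsetI)
  fix f assume f: "f \<in> K"
  have "f = (f - Q f) + Q f" by simp
  then show "f \<in> {f + g |f g. f \<in> Kmax \<and> g \<in> Kmin}"
    using diff_Q_mem_Kmax[OF f] Q_mem_Kmin[OF f] by blast
next
  fix h assume "h \<in> {f + g |f g. f \<in> Kmax \<and> g \<in> Kmin}"
  then show "h \<in> K"
    using Kmax_subset Kmin_subset closed_subspace_K fvs.subspace_add unfolding closed_subspace_def by blast
qed

lemma orth_decomp_Kmax_Kmin: "orth_decomp H K Kmax Kmin"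
  unfolding orth_decomp_def
  using closed_subspace_Kmax closed_subspace_Kmin orth_Kmax_Kmin(1) K_decomposition by blast

lemma orth_decomp_Kmin_Kmax: "orth_decomp H K Kmin Kmax"
proof -
  have "K = {f + g |f g. f \<in> Kmin \<and> g \<in> Kmax}"
    unfolding K_decomposition by (rule Collect_cong) (metis add.commute)
  then show ?thesis
    unfolding orth_decomp_def
    using closed_subspace_Kmax closed_subspace_Kmin orth_Kmax_Kmin(2) by blast
qed

lemma operator_compression: "operator compression"
  unfolding compression_def[abs_def] by (rule operator_diff[OF Z operator_comp[OF P Z]])

lemma compression_mem: "f \<in> Kmin \<Longrightarrow> compression f \<in> Kmin"
proof -
  assume f: "f \<in> Kmin"
  then have m: "f \<in> fspace H" "Z f \<in> fspace H" and Qf: "Q f = f" by (auto simp: Kmin_def mems)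
  have QZ: "Q (Z f) = Z f" using Z_Q[OF m(1)] by (simp only: Qf)
  then have "Q (P (Z f)) = P (Z f)" using P_Q[OF m(2)] by simp
  then show ?thesis
    using m QZ unfolding Kmin_def compression_def
    by (simp add: op_diff[OF P] op_diff[OF Q] mems P_idem del: minus_apply)
qed

lemma Z_mem_Kmax: "f \<in> Kmax \<Longrightarrow> Z f \<in> Kmax"
  using Z_Q[of f] op_zero[OF Z] by (simp add: Kmax_def mems)

text \<open>\<open>Q\<close> kills \<open>Z f\<close> and fixes \<open>Z g\<close>, so subtracting
  \<open>P Q\<close> of the sum affects only \<open>Z g\<close>. This is where the off-diagonal
  entries vanish.\<close>

lemma orth_proj_Z:
  assumes f: "f \<in> Kmax" and g: "g \<in> Kmin"
  shows "orth_proj H K (Z (f + g)) = Z f + compression g"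
proof -
  have m: "f \<in> fspace H" "g \<in> fspace H" "Z f \<in> fspace H" "Z g \<in> fspace H"
    and QZf: "Q (Z f) = 0" and Qg: "Q g = g"
    using f g Z_mem_Kmax[OF f] by (auto simp: Kmax_def Kmin_def mems)
  have QZg: "Q (Z g) = Z g" using Z_Q[OF m(2)] by (simp only: Qg)
  have "Z (f + g) = Z f + Z g" by (rule op_add[OF Z m(1,2)])
  moreover have "Q (Z f + Z g) = Z g"
    unfolding op_add[OF Q m(3,4)] QZf QZg by simp
  ultimately have "orth_proj H K (Z (f + g)) = (Z f + Z g) - P (Z g)"
    using orth_proj_K[OF mem_add[OF m(3,4)]] by (simp only:)
  then show ?thesis by (simp add: compression_def add_diff_eq)
qed

lemma has_block_matrix_Kmax_Kmin:
  assumes "\<And>f. f \<in> K \<Longrightarrow> S f = orth_proj H K (Z f)" "\<And>g. g \<in> Kmin \<Longrightarrow> A g = compression g"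
  shows "has_block_matrix H K Kmax Kmin S Z 0 0 A"
  unfolding has_block_matrix_def
proof (intro conjI ballI orth_decomp_Kmax_Kmin)
  have 0: "0 \<in> Kmax" "0 \<in> Kmin"
    using closed_subspace_Kmax closed_subspace_Kmin fvs.subspace_0 unfolding closed_subspace_def by blast+
  show "Z ` Kmax \<subseteq> Kmax" "A ` Kmin \<subseteq> Kmin"
    using Z_mem_Kmax compression_mem assms(2) by auto
  show "0 ` Kmin \<subseteq> Kmax" "0 ` Kmax \<subseteq> Kmin"
    using 0 by (auto simp only: zero_fun_apply)
  fix f g assume fg: "f \<in> Kmax" "g \<in> Kmin"
  then have "f + g \<in> K" unfolding K_decomposition by blast
  then show "S (f + g) = (Z f + 0 g) + (0 f + A g)"
    using orth_proj_Z[OF fg] assms fg by (simp only: zero_fun_apply add_0 add_0_right)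
qed

lemma has_block_matrix_Kmin_Kmax:
  assumes "\<And>f. f \<in> K \<Longrightarrow> S f = orth_proj H K (Z f)" "\<And>g. g \<in> Kmin \<Longrightarrow> A g = compression g"
  shows "has_block_matrix H K Kmin Kmax S A 0 0 Z"
  unfolding has_block_matrix_def
proof (intro conjI ballI orth_decomp_Kmin_Kmax)
  note block = has_block_matrix_Kmax_Kmin[OF assms, unfolded has_block_matrix_def]
  show "A ` Kmin \<subseteq> Kmin" "0 ` Kmax \<subseteq> Kmin" "0 ` Kmin \<subseteq> Kmax" "Z ` Kmax \<subseteq> Kmax"
    using block by blast+
  fix g f assume "g \<in> Kmin" "f \<in> Kmax"
  then have "S (f + g) = (Z f + 0 g) + (0 f + A g)"
    using block by blast
  then show "S (g + f) = (A g + 0 f) + (0 g + Z f)"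
    by (simp only: add.commute[of g f] zero_fun_apply add_0 add_0_right add.commute[of "A g"])
qed

lemma reducing_Kmax_Kmin:
  assumes S: "\<And>f. f \<in> K \<Longrightarrow> S f = orth_proj H K (Z f)"
  shows "reducing H K S Kmax" "reducing H K S Kmin"
proof -
  have 0: "0 \<in> Kmax" "0 \<in> Kmin"
    using closed_subspace_Kmax closed_subspace_Kmin fvs.subspace_0 unfolding closed_subspace_def by blast+
  have "S ` Kmax \<subseteq> Kmax"
  proof clarify
    fix f assume f: "f \<in> Kmax"
    have "S f = Z f"
      using orth_proj_Z[OF f 0(2)] S f Kmax_subset op_zero[OF operator_compression]
      by (simp only: add_0_right subset_iff)
    then show "S f \<in> Kmax" using Z_mem_Kmax[OF f] by (simp only:)
  qed
  moreover have "S ` Kmin \<subseteq> Kmin"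
  proof clarify
    fix g assume g: "g \<in> Kmin"
    have "S g = compression g"
      using orth_proj_Z[OF 0(1) g] S g Kmin_subset op_zero[OF Z]
      by (simp only: add_0 subset_iff)
    then show "S g \<in> Kmin" using compression_mem[OF g] by (simp only:)
  qed
  ultimately show "reducing H K S Kmax" "reducing H K S Kmin"
    unfolding reducing_def ominus_Kmax ominus_Kmin
    using closed_subspace_Kmax closed_subspace_Kmin Kmax_subset Kmin_subset by blast+
qed

text \<open>\<open>Q - P Q\<close> maps the span of \<open>E\<close> into the span of
  \<open>T\<close> and fixes \<open>Kmin\<close>. Applied to a sequence from the span of
  \<open>E\<close> that approximates an element of \<open>Kmin\<close>, it gives one from the span
  of \<open>T\<close>. With \<open>E\<close> the monomials and \<open>T\<close> elementary tensors,
  \<open>Kmin\<close> becomes a tensor product.\<close>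

lemma Kmin_eq_closure:
  assumes T: "T \<subseteq> Kmin" and E: "E \<subseteq> fspace H" and dense: "fclosure H (fvs.span E) = fspace H"
    and ET: "\<And>e. e \<in> E \<Longrightarrow> Q e - P (Q e) \<in> T"
  shows "fclosure H (fvs.span T) = Kmin"
proof
  have sub: "fvs.subspace Kmin" "fclosure H Kmin \<subseteq> Kmin"
    using closed_subspace_Kmin by (auto simp: closed_subspace_def)
  have "fvs.span T \<subseteq> Kmin" using T sub(1) by (rule fvs.span_minimal)
  then have "fclosure H (fvs.span T) \<subseteq> fclosure H Kmin"
    unfolding fclosure_def by blast
  then show "fclosure H (fvs.span T) \<subseteq> Kmin" using sub(2) by blast
  let ?R = "\<lambda>f. Q f - P (Q f)"
  have R: "operator ?R"
    by (rule operator_diff[OF Q operator_comp[OF P Q]])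
  show "Kmin \<subseteq> fclosure H (fvs.span T)"
  proof
    fix f assume f: "f \<in> Kmin"
    then have m: "f \<in> fspace H" and Rf: "?R f = f" by (auto simp: Kmin_def)
    obtain s where s: "\<And>n. s n \<in> fvs.span E" and lim: "(\<lambda>n. fnorm H (s n - f)) \<longlonglongrightarrow> 0"
      using m dense unfolding fclosure_def by blast
    have "fvs.subspace {g \<in> fspace H. ?R g \<in> fvs.span T}"
      unfolding fvs.subspace_def
    proof (intro conjI ballI allI)
      show "0 \<in> {g \<in> fspace H. ?R g \<in> fvs.span T}"
        using op_zero[OF R] fvs.span_zero[of T] by (simp only: mem_Collect_eq mem_zero simp_thms)
    next
      fix g h assume "g \<in> {g \<in> fspace H. ?R g \<in> fvs.span T}" "h \<in> {g \<in> fspace H. ?R g \<in> fvs.span T}"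
      then have "g \<in> fspace H" "h \<in> fspace H" "?R g \<in> fvs.span T" "?R h \<in> fvs.span T" by auto
      then show "g + h \<in> {g \<in> fspace H. ?R g \<in> fvs.span T}"
        using op_add[OF R] fvs.span_add by (simp only: mem_Collect_eq mem_add simp_thms)
    next
      fix c g assume "g \<in> {g \<in> fspace H. ?R g \<in> fvs.span T}"
      then have "g \<in> fspace H" "?R g \<in> fvs.span T" by auto
      then show "fscale c g \<in> {g \<in> fspace H. ?R g \<in> fvs.span T}"
        using op_scale[OF R] fvs.span_scale by (simp only: mem_Collect_eq mem_scale simp_thms)
    qed
    moreover have "E \<subseteq> {g \<in> fspace H. ?R g \<in> fvs.span T}"
      using E ET fvs.span_base by blast
    ultimately have span: "fvs.span E \<subseteq> {g \<in> fspace H. ?R g \<in> fvs.span T}"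
      by (intro fvs.span_minimal)
    then have sm: "s n \<in> fspace H" "?R (s n) \<in> fvs.span T" for n
      using s[of n] by auto
    have "(\<lambda>n. fnorm H (?R (s n) - ?R f)) \<longlonglongrightarrow> 0"
      by (rule op_limit[OF R m sm(1) lim])
    then show "f \<in> fclosure H (fvs.span T)"
      unfolding Rf fclosure_def using m sm(2) by (auto intro!: exI[of _ "\<lambda>n. ?R (s n)"])
  qed
qed

end

section \<open>The model space of a product of inner functions\<close>

text \<open>Holomorphy supplies the power series; boundedness and radial limits supply
  orthonormality. Only these coefficient facts are carried forward.\<close>

lemma inner_function_coeffs:
  assumes "inner_function \<phi>"
  obtains c where "isometric_coeffs c" "\<And>z. z \<in> disk \<Longrightarrow> (\<lambda>n. c n * z ^ n) sums \<phi> z"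
proof -
  let ?c = "\<lambda>n. (deriv ^^ n) \<phi> 0 / fact n"
  have s: "(\<lambda>n. ?c n * z ^ n) sums \<phi> z" if "z \<in> disk" for z
    using holomorphic_power_series[of \<phi> 0 1 z] assms that by (simp add: inner_function_def disk_def)
  have "isometric_coeffs ?c"
  proof
    show "?c \<in> fspace ell2"
      using assms by (intro coeffs_orthonormal(1)[of ?c \<phi>] s) (auto simp: inner_function_def)
    show "((\<lambda>n. ?c (n + k) * cnj (?c n)) has_sum (if k = 0 then 1 else 0)) UNIV" for k
      using assms by (intro coeffs_orthonormal(2)[of ?c \<phi>] s) (auto simp: inner_function_def)
  qed
  then show ?thesis using that s by blast
qed

locale inner_multiplier = isometric_coeffs c for c +
  fixes \<phi> :: "complex \<Rightarrow> complex"
  assumes power_series: "\<And>z. z \<in> disk \<Longrightarrow> (\<lambda>n. c n * z ^ n) sums \<phi> z"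
begin

lemma mult_op_synth: "a \<in> fspace ell2 \<Longrightarrow> mult_op \<phi> (disk.synth a) = disk.synth (conv c a)"
  by (rule mult_op_conv[OF isometric_coeffs_axioms power_series])

lemma range_mem: "a \<in> fspace ell2 \<Longrightarrow> range_proj a \<in> fspace ell2"
  by (rule ell2.op_mem[OF operator_range_proj])

abbreviation hardy_proj :: "(complex \<Rightarrow> complex) \<Rightarrow> complex \<Rightarrow> complex" where
  "hardy_proj \<equiv> disk.transport range_proj"

lemma operator_hardy_proj: "disk.operator hardy_proj"
  by (rule disk.operator_transport[OF operator_range_proj])

lemma hardy_proj_selfadjoint:
  assumes "f \<in> fspace hardy_disk" "g \<in> fspace hardy_disk"
  shows "fip hardy_disk (hardy_proj f) g = fip hardy_disk f (hardy_proj g)"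
  using assms by (auto simp: disk.fspace_hardy disk.fip_synth range_mem range_proj_selfadjoint)

lemma hardy_proj_idem: "f \<in> fspace hardy_disk \<Longrightarrow> hardy_proj (hardy_proj f) = hardy_proj f"
  by (auto simp: disk.fspace_hardy range_mem range_proj_idem)

lemma
  assumes "f \<in> fspace hardy_disk"
  shows mult_op_mem: "mult_op \<phi> f \<in> fspace hardy_disk"
    and hardy_proj_mult_op: "hardy_proj (mult_op \<phi> f) = mult_op \<phi> f"
    and hardy_proj_in_range: "hardy_proj f \<in> mult_op \<phi> ` fspace hardy_disk"
proof -
  from assms obtain a where a: "a \<in> fspace ell2" "f = disk.synth a" by (auto simp: disk.fspace_hardy)
  show "mult_op \<phi> f \<in> fspace hardy_disk" using a by (simp add: mult_op_synth conv_bounded)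
  show "hardy_proj (mult_op \<phi> f) = mult_op \<phi> f"
    using a by (simp add: mult_op_synth conv_bounded range_proj_conv)
  have "hardy_proj f = mult_op \<phi> (disk.synth (adj (conv c) a))"
    using a by (simp add: mult_op_synth adj_mem range_proj_def)
  then show "hardy_proj f \<in> mult_op \<phi> ` fspace hardy_disk"
    using a by (simp add: adj_mem)
qed

lemma model_space_eq: "model_space hardy_disk \<phi> = {f \<in> fspace hardy_disk. hardy_proj f = 0}"
  unfolding model_space_def
  by (rule disk.ominus_range[OF operator_hardy_proj hardy_proj_selfadjoint mult_op_mem
        hardy_proj_mult_op hardy_proj_in_range])

lemma diff_hardy_proj_mem:
  assumes f: "f \<in> fspace hardy_disk"
  shows "f - hardy_proj f \<in> model_space hardy_disk \<phi>"
proof -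
  have m: "hardy_proj f \<in> fspace hardy_disk" by (rule disk.op_mem[OF operator_hardy_proj f])
  show ?thesis
    unfolding model_space_eq
    using disk.mem_diff[OF f m] disk.op_diff[OF operator_hardy_proj f m] hardy_proj_idem[OF f] by simp
qed

lemma compressed_mult_eq:
  assumes "mult_op p f \<in> fspace hardy_disk"
  shows "compressed_mult hardy_disk \<phi> p f = mult_op p f - hardy_proj (mult_op p f)"
  unfolding compressed_mult_def model_space_eq
  by (rule disk.orth_proj_kernel[OF operator_hardy_proj hardy_proj_idem hardy_proj_selfadjoint assms])

text \<open>Both lifts act on each row separately, so the one-variable statement applies row by
  row.\<close>

lemma lift2_no_invariant:
  assumes a: "a \<in> fspace ell2" and orth: "\<And>n. lift2 range_proj ((lift2 shift ^^ n) a) = 0"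
  shows "a = 0"
proof (rule row_eqI)
  fix m
  have "fam_row ((lift2 shift ^^ n) a) m = (shift ^^ n) (fam_row a m)" for n
    by (induction n) simp_all
  then have "range_proj ((shift ^^ n) (fam_row a m)) = fam_row (lift2 range_proj ((lift2 shift ^^ n) a)) m" for n
    by simp
  also have "fam_row (lift2 range_proj ((lift2 shift ^^ n) a)) m = 0" for n
    unfolding orth by (simp add: fam_row_def fun_eq_iff)
  finally have "fam_row a m = 0"
    by (rule eq_0_if_shifts_orthogonal[OF row_mem[OF a]])
  then show "fam_row a m = fam_row 0 m" by (simp add: fam_row_def fun_eq_iff)
qed

lemma lift1_no_invariant:
  assumes a: "a \<in> fspace ell2" and orth: "\<And>n. lift1 range_proj ((lift1 shift ^^ n) a) = 0"
  shows "a = 0"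
proof -
  have 0: "swap_fam x = 0 \<longleftrightarrow> x = 0" for x :: "nat \<times> 'b \<Rightarrow> complex"
    by (auto simp: swap_fam_def fun_eq_iff)
  have swap0': "swap_fam x = 0 \<Longrightarrow> x = 0" for x :: "'b \<times> nat \<Rightarrow> complex"
    by (auto simp: swap_fam_def fun_eq_iff)
  have eq: "(lift1 shift ^^ n) a = swap_fam ((lift2 shift ^^ n) (swap_fam a))" for n
    by (induction n) (simp_all add: lift1_def)
  have "swap_fam a = 0"
  proof (rule lift2_no_invariant)
    show "lift2 range_proj ((lift2 shift ^^ n) (swap_fam a)) = 0" for n
      using orth[of n] unfolding eq lift1_def swap_swap_fam by (rule swap0')
  qed (use a in simp)
  then show ?thesis by (simp add: 0)
qed

end

section \<open>Coordinate multiplications and elementary tensors\<close>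

lemma lift2_cong:
  assumes "\<And>b. b \<in> fspace ell2 \<Longrightarrow> W b = U b" "a \<in> fspace ell2"
  shows "lift2 W a = lift2 U a"
  using assms by (auto intro!: row_eqI)

lemma lift1_cong:
  assumes "\<And>b. b \<in> fspace ell2 \<Longrightarrow> W b = U b" "a \<in> fspace ell2"
  shows "lift1 W a = lift1 U a"
  unfolding lift1_def using assms by (intro arg_cong[where f = swap_fam] lift2_cong) auto

lemma monomial_power_series: "(\<lambda>n. unit_fam (Suc 0) n * z ^ n) sums (z :: complex)"
proof -
  have "(\<lambda>n. if n = Suc 0 then z ^ n else 0) sums (z ^ Suc 0)" by (rule sums_single)
  moreover have "(\<lambda>n. unit_fam (Suc 0) n * z ^ n) = (\<lambda>n. if n = Suc 0 then z ^ n else 0)"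
    by (auto simp: unit_fam_def)
  ultimately show ?thesis by simp
qed

interpretation coordinate: inner_multiplier "unit_fam (Suc 0)" "\<lambda>z. z"
  by unfold_locales (rule monomial_power_series)

lemma mult_op_fst: "a \<in> fspace ell2 \<Longrightarrow> mult_op fst (bidisk.synth a) = bidisk.synth (lift1 shift a)"
  using mult_op_lift1[OF shift.operator_conv coordinate.mult_op_synth] by simp

lemma mult_op_snd: "a \<in> fspace ell2 \<Longrightarrow> mult_op snd (bidisk.synth a) = bidisk.synth (lift2 shift a)"
  using mult_op_lift2[OF shift.operator_conv coordinate.mult_op_synth] by simp

lemma elem_tensor_zero: "elem_tensor 0 g = 0" "elem_tensor f 0 = 0"
  and elem_tensor_diff: "elem_tensor (f1 - f2) g = elem_tensor f1 g - elem_tensor f2 g"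
    "elem_tensor f (g1 - g2) = elem_tensor f g1 - elem_tensor f g2"
  and mult_op_elem_tensor: "mult_op fst (elem_tensor f g) = elem_tensor (mult_op (\<lambda>z. z) f) g"
    "mult_op snd (elem_tensor f g) = elem_tensor f (mult_op (\<lambda>z. z) g)"
  by (auto simp: elem_tensor_def mult_op_def algebra_simps fun_eq_iff)

lemma elem_tensor_mem:
  assumes "f \<in> fspace hardy_disk" "g \<in> fspace hardy_disk"
  shows "elem_tensor f g \<in> fspace hardy_bidisk"
  using assms by (auto simp: disk.fspace_hardy simp flip: bidisk_synth_tensor_fam)

text \<open>Restricting \<open>U\<close> to the tensor space yields an admissible map, extensional
  by \<open>restrict\<close>. Any other admissible map agrees with it on elementary tensors, whose
  span is dense there. Tensor entries are thus computed by finding an operator on the whole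
  space.\<close>

lemma tensor_op_eq:
  assumes M: "M \<subseteq> fspace hardy_disk" and N: "N \<subseteq> fspace hardy_disk"
    and closed: "closed_subspace hardy_bidisk (tensor_space M N)"
    and U: "bidisk.operator U"
    and elem: "\<And>f g. f \<in> M \<Longrightarrow> g \<in> N \<Longrightarrow> U (elem_tensor f g) = elem_tensor (A f) (B g)"
    and h: "h \<in> tensor_space M N"
  shows "tensor_op M N A B h = U h"
proof -
  let ?T = "tensor_space M N" and ?E = "{elem_tensor f g |f g. f \<in> M \<and> g \<in> N}"
  have E: "?E \<subseteq> ?T"
  proof
    fix x assume x: "x \<in> ?E"
    then have "x \<in> fspace hardy_bidisk" using M N elem_tensor_mem by blast
    moreover have "(\<lambda>n :: nat. fnorm hardy_bidisk (x - x)) \<longlonglongrightarrow> 0" by simp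
    ultimately show "x \<in> ?T"
      unfolding tensor_space_def fclosure_def using fvs.span_base[OF x]
      by (auto intro!: exI[of _ "\<lambda>_. x"])
  qed
  have "tensor_op M N A B = restrict U ?T"
    unfolding tensor_op_def
  proof (rule the_equality)
    have "restrict U ?T (elem_tensor f g) = elem_tensor (A f) (B g)" if "f \<in> M" "g \<in> N" for f g
      using E elem[OF that] that by auto
    then show "restrict U ?T \<in> extensional ?T \<and> bounded_linear_map hardy_bidisk ?T (restrict U ?T) \<and>
        (\<forall>f\<in>M. \<forall>g\<in>N. restrict U ?T (elem_tensor f g) = elem_tensor (A f) (B g))"
      using bidisk.bounded_linear_map_restrict[OF U closed] by blast
    note U' = this
    fix T assume T: "T \<in> extensional ?T \<and> bounded_linear_map hardy_bidisk ?T T \<and>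
        (\<forall>f\<in>M. \<forall>g\<in>N. T (elem_tensor f g) = elem_tensor (A f) (B g))"
    show "T = restrict U ?T"
    proof (rule extensionalityI)
      fix x assume x: "x \<in> ?T"
      show "T x = restrict U ?T x"
      proof (rule bidisk.bounded_linear_map_eq[where T = T and U = "restrict U ?T" and f = x, OF closed E])
        fix y assume "y \<in> ?E"
        then obtain f g where fg: "f \<in> M" "g \<in> N" "y = elem_tensor f g" by blast
        then have "T y = elem_tensor (A f) (B g)" using T by blast
        moreover have "restrict U ?T y = elem_tensor (A f) (B g)" using U' fg by blast
        ultimately show "T y = restrict U ?T y" by (rule trans_sym)
      qed (use T U' x in \<open>auto simp: tensor_space_def\<close>)
    qed (use T U' in auto)
  qed
  then show ?thesis using h by simp
qed

locale inner_pair = first: inner_multiplier c \<phi> + second: inner_multiplier d \<psi> for c \<phi> d \<psi> +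
  fixes \<theta> :: "complex \<times> complex \<Rightarrow> complex"
  assumes product: "\<And>z1 z2. z1 \<in> disk \<Longrightarrow> z2 \<in> disk \<Longrightarrow> \<theta> (z1, z2) = \<phi> z1 * \<psi> z2"
begin

section \<open>The two projections on the bidisk\<close>

definition proj1 :: "(complex \<times> complex \<Rightarrow> complex) \<Rightarrow> complex \<times> complex \<Rightarrow> complex" where
  "proj1 = bidisk.transport (lift1 first.range_proj)"
definition proj2 :: "(complex \<times> complex \<Rightarrow> complex) \<Rightarrow> complex \<times> complex \<Rightarrow> complex" where
  "proj2 = bidisk.transport (lift2 second.range_proj)"

lemmas op_lift = operator_lift1[OF first.operator_range_proj] operator_lift2[OF second.operator_range_proj]
  operator_lift1[OF first.operator_conv] operator_lift2[OF second.operator_conv]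
  operator_lift1[OF operator_adj[OF first.operator_conv]] operator_lift2[OF operator_adj[OF second.operator_conv]]
  operator_lift1[OF shift.operator_conv] operator_lift2[OF shift.operator_conv]

lemmas lift_mem = op_lift[THEN ell2.op_mem]

lemma proj_synth:
  "a \<in> fspace ell2 \<Longrightarrow> proj1 (bidisk.synth a) = bidisk.synth (lift1 first.range_proj a)"
  "a \<in> fspace ell2 \<Longrightarrow> proj2 (bidisk.synth a) = bidisk.synth (lift2 second.range_proj a)"
  by (simp_all add: proj1_def proj2_def)

lemma operators: "bidisk.operator proj1" "bidisk.operator proj2"
    "bidisk.operator (mult_op fst)" "bidisk.operator (mult_op snd)"
proof -
  show "bidisk.operator proj1" "bidisk.operator proj2"
    unfolding proj1_def proj2_def by (intro bidisk.operator_transport op_lift)+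
  show "bidisk.operator (mult_op fst)"
    by (rule bidisk.operatorI_synth[OF op_lift(7) mult_op_fst])
  show "bidisk.operator (mult_op snd)"
    by (rule bidisk.operatorI_synth[OF op_lift(8) mult_op_snd])
qed

lemma funpow_mult_op:
  assumes "a \<in> fspace ell2"
  shows "(mult_op fst ^^ n) (bidisk.synth a) = bidisk.synth ((lift1 shift ^^ n) a)"
    "(mult_op snd ^^ n) (bidisk.synth a) = bidisk.synth ((lift2 shift ^^ n) a)"
    "(lift1 shift ^^ n) a \<in> fspace ell2" "(lift2 shift ^^ n) a \<in> fspace ell2"
proof -
  have 1: "(lift1 shift ^^ n) a \<in> fspace ell2" for n
    using assms by (induction n) (simp_all add: lift_mem)
  have 2: "(lift2 shift ^^ n) a \<in> fspace ell2" for n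
    using assms by (induction n) (simp_all add: lift_mem)
  show "(mult_op fst ^^ n) (bidisk.synth a) = bidisk.synth ((lift1 shift ^^ n) a)"
    using 1 by (induction n) (simp_all add: mult_op_fst)
  show "(mult_op snd ^^ n) (bidisk.synth a) = bidisk.synth ((lift2 shift ^^ n) a)"
    using 2 by (induction n) (simp_all add: mult_op_snd)
  show "(lift1 shift ^^ n) a \<in> fspace ell2" "(lift2 shift ^^ n) a \<in> fspace ell2"
    using 1 2 by auto
qed

lemma proj_laws:
  assumes f: "f \<in> fspace hardy_bidisk"
  shows "proj1 (proj1 f) = proj1 f" "proj2 (proj2 f) = proj2 f" "proj1 (proj2 f) = proj2 (proj1 f)"
    "mult_op fst (proj2 f) = proj2 (mult_op fst f)" "mult_op snd (proj1 f) = proj1 (mult_op snd f)"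
proof -
  obtain a where a: "a \<in> fspace ell2" and fa: "f = bidisk.synth a" using f by (auto simp: bidisk.fspace_hardy)
  have "lift1 first.range_proj (lift1 first.range_proj a) = lift1 first.range_proj a"
    unfolding lift1_lift1 using a by (intro lift1_cong first.range_proj_idem)
  then show "proj1 (proj1 f) = proj1 f" using a by (simp add: fa proj_synth lift_mem)
  have "lift2 second.range_proj (lift2 second.range_proj a) = lift2 second.range_proj a"
    unfolding lift2_lift2 using a by (intro lift2_cong second.range_proj_idem)
  then show "proj2 (proj2 f) = proj2 f" using a by (simp add: fa proj_synth lift_mem)
  show "proj1 (proj2 f) = proj2 (proj1 f)"
    using a lift1_lift2_commute[OF first.operator_range_proj second.operator_range_proj a]
    by (simp add: fa proj_synth lift_mem)
  show "mult_op fst (proj2 f) = proj2 (mult_op fst f)"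
    using a lift1_lift2_commute[OF shift.operator_conv second.operator_range_proj a]
    by (simp add: fa proj_synth lift_mem mult_op_fst)
  show "mult_op snd (proj1 f) = proj1 (mult_op snd f)"
    using a lift1_lift2_commute[OF first.operator_range_proj shift.operator_conv a]
    by (simp add: fa proj_synth lift_mem mult_op_snd)
qed

lemma proj_selfadjoint:
  assumes "f \<in> fspace hardy_bidisk" "g \<in> fspace hardy_bidisk"
  shows "fip hardy_bidisk (proj1 f) g = fip hardy_bidisk f (proj1 g)"
    "fip hardy_bidisk (proj2 f) g = fip hardy_bidisk f (proj2 g)"
proof -
  obtain a b where ab: "a \<in> fspace ell2" "b \<in> fspace ell2" and fg: "f = bidisk.synth a" "g = bidisk.synth b"
    using assms by (auto simp: bidisk.fspace_hardy)
  show "fip hardy_bidisk (proj1 f) g = fip hardy_bidisk f (proj1 g)"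
    using fip_lift1[OF first.operator_range_proj first.operator_range_proj ab first.range_proj_selfadjoint] ab
    by (simp add: fg proj_synth lift_mem bidisk.fip_synth)
  show "fip hardy_bidisk (proj2 f) g = fip hardy_bidisk f (proj2 g)"
    using fip_lift2[OF second.operator_range_proj second.operator_range_proj ab second.range_proj_selfadjoint] ab
    by (simp add: fg proj_synth lift_mem bidisk.fip_synth)
qed

lemma no_invariant:
  assumes f: "f \<in> fspace hardy_bidisk"
  shows "(\<And>n. proj1 ((mult_op fst ^^ n) f) = 0) \<Longrightarrow> f = 0"
    "(\<And>n. proj2 ((mult_op snd ^^ n) f) = 0) \<Longrightarrow> f = 0"
proof -
  obtain a where a: "a \<in> fspace ell2" and fa: "f = bidisk.synth a" using f by (auto simp: bidisk.fspace_hardy)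
  have 0: "x = 0" if "x \<in> fspace ell2" "bidisk.synth x = 0" for x
    by (rule iffD1[OF bidisk.synth_inj[OF that(1) ell2.mem_zero] trans[OF that(2) bidisk.synth_zero[symmetric]]])
  show "f = 0" if orth: "\<And>n. proj1 ((mult_op fst ^^ n) f) = 0"
  proof -
    have "lift1 first.range_proj ((lift1 shift ^^ n) a) = 0" for n
      using orth[of n] funpow_mult_op[OF a] by (intro 0 lift_mem) (simp_all only: fa proj_synth)
    then have "a = 0" by (rule first.lift1_no_invariant[OF a])
    then show ?thesis by (simp only: fa bidisk.synth_zero)
  qed
  show "f = 0" if orth: "\<And>n. proj2 ((mult_op snd ^^ n) f) = 0"
  proof -
    have "lift2 second.range_proj ((lift2 shift ^^ n) a) = 0" for n
      using orth[of n] funpow_mult_op[OF a] by (intro 0 lift_mem) (simp_all only: fa proj_synth)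
    then have "a = 0" by (rule second.lift2_no_invariant[OF a])
    then show ?thesis by (simp only: fa bidisk.synth_zero)
  qed
qed

text \<open>Here \<open>z1.Kmax\<close> is the kernel of \<open>proj2\<close>. The next instance
  exchanges the variables, so \<open>z2.Kmax\<close> is the kernel of \<open>proj1\<close>, and the
  second matrix needs no separate argument.\<close>

sublocale z1: commuting_projections hardy_bidisk proj1 proj2 "mult_op fst"
  by unfold_locales (intro operators | simp only: proj_laws | (rule proj_selfadjoint; assumption) | (rule no_invariant; blast))+

sublocale z2: commuting_projections hardy_bidisk proj2 proj1 "mult_op snd"
  by unfold_locales (intro operators | simp only: proj_laws | (rule proj_selfadjoint; assumption) | (rule no_invariant; blast))+

text \<open>On the bidisk this is the factorisation of \<open>\<theta>\<close>; elsewhere both sides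
  vanish together with \<open>bidisk.synth a\<close>.\<close>

lemma mult_op_product:
  assumes a: "a \<in> fspace ell2"
  shows "mult_op \<theta> (bidisk.synth a) = bidisk.synth (lift1 (conv c) (lift2 (conv d) a))"
proof -
  have "mult_op \<theta> (bidisk.synth a) = mult_op (\<lambda>p. \<phi> (fst p)) (mult_op (\<lambda>p. \<psi> (snd p)) (bidisk.synth a))"
  proof
    fix p show "mult_op \<theta> (bidisk.synth a) p = mult_op (\<lambda>p. \<phi> (fst p)) (mult_op (\<lambda>p. \<psi> (snd p)) (bidisk.synth a)) p"
      using product by (cases p) (auto simp: mult_op_def bidisk.synth_def)
  qed
  then show ?thesis
    using mult_op_lift1[OF first.operator_conv first.mult_op_synth lift_mem(4)[OF a]]
      mult_op_lift2[OF second.operator_conv second.mult_op_synth a] by simp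
qed

text \<open>Multiplication by \<open>\<theta>\<close> is the tensor product of the two one-variable
  isometries, so the projection onto its range is \<open>proj1\<close> after
  \<open>proj2\<close>.\<close>

lemma K_space_eq: "K_space \<theta> = z1.K" "K_space \<theta> = z2.K"
proof -
  show K: "K_space \<theta> = z1.K"
    unfolding K_space_def model_space_def z1.K_def
  proof (rule bidisk.ominus_range)
    show "bidisk.operator (\<lambda>f. proj1 (proj2 f))"
      by (rule bidisk.operator_comp[OF operators(1,2)])
    show "fip hardy_bidisk (proj1 (proj2 f)) g = fip hardy_bidisk f (proj1 (proj2 g))"
      if "f \<in> fspace hardy_bidisk" "g \<in> fspace hardy_bidisk" for f g
      using that by (simp add: proj_selfadjoint z1.mems proj_laws)
    fix f assume "f \<in> fspace hardy_bidisk"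
    then obtain a where a: "a \<in> fspace ell2" and fa: "f = bidisk.synth a" by (auto simp: bidisk.fspace_hardy)
    show "mult_op \<theta> f \<in> fspace hardy_bidisk"
      using a by (simp add: fa mult_op_product lift_mem)
    let ?P = "first.range_proj" and ?Q = "second.range_proj" and ?V = "conv c" and ?W = "conv d"
    have "lift1 ?P (lift2 ?Q (lift1 ?V (lift2 ?W a))) = lift1 ?P (lift1 ?V (lift2 ?Q (lift2 ?W a)))"
      using lift1_lift2_commute[OF first.operator_conv second.operator_range_proj lift_mem(4)[OF a]] by simp
    also have "lift2 ?Q (lift2 ?W a) = lift2 ?W a"
      unfolding lift2_lift2 using a by (intro lift2_cong second.range_proj_conv)
    also have "lift1 ?P (lift1 ?V (lift2 ?W a)) = lift1 ?V (lift2 ?W a)"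
      unfolding lift1_lift1 using a by (intro lift1_cong first.range_proj_conv lift_mem)
    finally show "proj1 (proj2 (mult_op \<theta> f)) = mult_op \<theta> f"
      using a by (simp add: fa mult_op_product proj_synth lift_mem)
    \<comment> \<open>The adjoint of multiplication by \<open>\<theta>\<close>, applied to
      \<open>a\<close>: it is the preimage that exhibits the projection of \<open>f\<close> as a
      multiple of \<open>\<theta>\<close>.\<close>
    let ?b = "lift1 (adj ?V) (lift2 (adj ?W) a)"
    have b: "?b \<in> fspace ell2" using a by (intro lift_mem)
    have "lift1 ?P (lift2 ?Q a) = lift1 ?V (lift1 (adj ?V) (lift2 ?W (lift2 (adj ?W) a)))"
      unfolding lift1_lift1 lift2_lift2 by (simp add: first.range_proj_def[abs_def] second.range_proj_def[abs_def])
    also have "\<dots> = lift1 ?V (lift2 ?W ?b)"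
      using lift1_lift2_commute[OF operator_adj[OF first.operator_conv] second.operator_conv lift_mem(6)[OF a]] by simp
    finally have "proj1 (proj2 f) = mult_op \<theta> (bidisk.synth ?b)"
      using a b by (simp add: fa mult_op_product proj_synth lift_mem)
    then show "proj1 (proj2 f) \<in> mult_op \<theta> ` fspace hardy_bidisk"
      using b by simp
  qed
  show "K_space \<theta> = z2.K"
    unfolding K z1.K_def z2.K_def using proj_laws(3) by auto
qed

section \<open>Extremal subspaces, tensor products and matrix entries\<close>

lemma Smax1_eq: "Smax1 \<theta> = z1.Kmax"
  unfolding Smax1_def K_space_eq(1) by (rule z1.Kmax_greatest)

lemma Smax2_eq: "Smax2 \<theta> = z2.Kmax"
  unfolding Smax2_def K_space_eq(2) by (rule z2.Kmax_greatest)

lemma proj_elem_tensor: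
  assumes "f \<in> fspace hardy_disk" "g \<in> fspace hardy_disk"
  shows "proj1 (elem_tensor f g) = elem_tensor (first.hardy_proj f) g"
    "proj2 (elem_tensor f g) = elem_tensor f (second.hardy_proj g)"
proof -
  obtain u v where uv: "u \<in> fspace ell2" "v \<in> fspace ell2" and fg: "f = disk.synth u" "g = disk.synth v"
    using assms by (auto simp: disk.fspace_hardy)
  have elem: "elem_tensor f g = bidisk.synth (tensor_fam u v)"
    using uv by (simp add: fg bidisk_synth_tensor_fam)
  show "proj1 (elem_tensor f g) = elem_tensor (first.hardy_proj f) g"
    unfolding elem proj_synth(1)[OF tensor_fam_mem[OF uv]] lift1_tensor_fam[OF first.operator_range_proj uv(1)]
    using uv by (simp add: fg first.range_mem bidisk_synth_tensor_fam)
  show "proj2 (elem_tensor f g) = elem_tensor f (second.hardy_proj g)"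
    unfolding elem proj_synth(2)[OF tensor_fam_mem[OF uv]] lift2_tensor_fam[OF second.operator_range_proj uv(2)]
    using uv by (simp add: fg second.range_mem bidisk_synth_tensor_fam)
qed

lemma model_subset:
  "model_space hardy_disk \<phi> \<subseteq> fspace hardy_disk" "model_space hardy_disk \<psi> \<subseteq> fspace hardy_disk"
  "mult_op \<phi> ` fspace hardy_disk \<subseteq> fspace hardy_disk" "mult_op \<psi> ` fspace hardy_disk \<subseteq> fspace hardy_disk"
  using first.mult_op_mem second.mult_op_mem by (auto simp: first.model_space_eq second.model_space_eq)

lemma basis_elem_tensor:
  assumes "e \<in> range (\<lambda>p. bidisk.synth (unit_fam p))"
  obtains f g where "f \<in> fspace hardy_disk" "g \<in> fspace hardy_disk" "e = elem_tensor f g"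
proof -
  obtain m n where "e = bidisk.synth (unit_fam (m, n))" using assms by auto
  then have "e = elem_tensor (disk.synth (unit_fam m)) (disk.synth (unit_fam n))"
    by (simp add: unit_fam_pair bidisk_synth_tensor_fam)
  then show ?thesis by (rule that[OF disk.synth_mem[OF unit_fam_mem] disk.synth_mem[OF unit_fam_mem]])
qed

text \<open>Monomials are elementary tensors, and \<open>Q - P Q\<close> sends such a tensor of
  \<open>f\<close> and \<open>g\<close> to that of \<open>f\<close> minus its projection and the
  projection of \<open>g\<close>, which lie in the model space of \<open>\<phi>\<close> and the
  range of \<open>\<psi>\<close>.\<close>

lemma tensor_space_Kmin1:
  "tensor_space (model_space hardy_disk \<phi>) (mult_op \<psi> ` fspace hardy_disk) = z1.Kmin"
  unfolding tensor_space_def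
proof (rule z1.Kmin_eq_closure[OF _ _ bidisk.span_basis_dense])
  show "{elem_tensor f g |f g. f \<in> model_space hardy_disk \<phi> \<and> g \<in> mult_op \<psi> ` fspace hardy_disk} \<subseteq> z1.Kmin"
  proof clarify
    fix f g assume f: "f \<in> model_space hardy_disk \<phi>" and g: "g \<in> fspace hardy_disk"
    have m: "f \<in> fspace hardy_disk" "mult_op \<psi> g \<in> fspace hardy_disk"
      using f g model_subset by auto
    have "first.hardy_proj f = 0" using f by (simp add: first.model_space_eq)
    then show "elem_tensor f (mult_op \<psi> g) \<in> z1.Kmin"
      using proj_elem_tensor[OF m] elem_tensor_mem[OF m] second.hardy_proj_mult_op[OF g]
      by (simp only: z1.Kmin_def elem_tensor_zero mem_Collect_eq simp_thms)
  qed
  fix e assume "e \<in> range (\<lambda>p. bidisk.synth (unit_fam p))"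
  then obtain f g where fg: "f \<in> fspace hardy_disk" "g \<in> fspace hardy_disk" and e: "e = elem_tensor f g"
    by (rule basis_elem_tensor)
  have "proj2 e - proj1 (proj2 e) = elem_tensor (f - first.hardy_proj f) (second.hardy_proj g)"
    using fg disk.op_mem[OF second.operator_hardy_proj fg(2)]
    by (simp only: e proj_elem_tensor elem_tensor_diff)
  then show "proj2 e - proj1 (proj2 e) \<in>
      {elem_tensor f g |f g. f \<in> model_space hardy_disk \<phi> \<and> g \<in> mult_op \<psi> ` fspace hardy_disk}"
    using first.diff_hardy_proj_mem[OF fg(1)] second.hardy_proj_in_range[OF fg(2)] by blast
qed auto

lemma tensor_space_Kmin2:
  "tensor_space (mult_op \<phi> ` fspace hardy_disk) (model_space hardy_disk \<psi>) = z2.Kmin"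
  unfolding tensor_space_def
proof (rule z2.Kmin_eq_closure[OF _ _ bidisk.span_basis_dense])
  show "{elem_tensor f g |f g. f \<in> mult_op \<phi> ` fspace hardy_disk \<and> g \<in> model_space hardy_disk \<psi>} \<subseteq> z2.Kmin"
  proof clarify
    fix f g assume f: "f \<in> fspace hardy_disk" and g: "g \<in> model_space hardy_disk \<psi>"
    have m: "mult_op \<phi> f \<in> fspace hardy_disk" "g \<in> fspace hardy_disk"
      using f g model_subset by auto
    have "second.hardy_proj g = 0" using g by (simp add: second.model_space_eq)
    then show "elem_tensor (mult_op \<phi> f) g \<in> z2.Kmin"
      using proj_elem_tensor[OF m] elem_tensor_mem[OF m] first.hardy_proj_mult_op[OF f]
      by (simp only: z2.Kmin_def elem_tensor_zero mem_Collect_eq simp_thms)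
  qed
  fix e assume "e \<in> range (\<lambda>p. bidisk.synth (unit_fam p))"
  then obtain f g where fg: "f \<in> fspace hardy_disk" "g \<in> fspace hardy_disk" and e: "e = elem_tensor f g"
    by (rule basis_elem_tensor)
  have "proj1 e - proj2 (proj1 e) = elem_tensor (first.hardy_proj f) (g - second.hardy_proj g)"
    using fg disk.op_mem[OF first.operator_hardy_proj fg(1)]
    by (simp only: e proj_elem_tensor elem_tensor_diff)
  then show "proj1 e - proj2 (proj1 e) \<in>
      {elem_tensor f g |f g. f \<in> mult_op \<phi> ` fspace hardy_disk \<and> g \<in> model_space hardy_disk \<psi>}"
    using second.diff_hardy_proj_mem[OF fg(2)] first.hardy_proj_in_range[OF fg(1)] by blast
qed auto

text \<open>\<open>z1.compression\<close> is bounded on the whole Hardy space and leaves the second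
  factor of an elementary tensor alone, so it is the operator whose restriction
  \<open>tensor_op\<close> picks out.\<close>

lemma tensor_op_compression1:
  assumes "h \<in> z1.Kmin"
  shows "tensor_op (model_space hardy_disk \<phi>) (mult_op \<psi> ` fspace hardy_disk)
    (compressed_mult hardy_disk \<phi> (\<lambda>z. z)) (\<lambda>g. g) h = z1.compression h"
proof (rule tensor_op_eq[OF model_subset(1,4) _ z1.operator_compression])
  fix f g assume "f \<in> model_space hardy_disk \<phi>" "g \<in> mult_op \<psi> ` fspace hardy_disk"
  then have m: "f \<in> fspace hardy_disk" "g \<in> fspace hardy_disk" using model_subset by auto
  note zf = coordinate.mult_op_mem[OF m(1)]
  show "z1.compression (elem_tensor f g) = elem_tensor (compressed_mult hardy_disk \<phi> (\<lambda>z. z) f) g"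
    by (simp only: z1.compression_def mult_op_elem_tensor proj_elem_tensor[OF zf m(2)]
        elem_tensor_diff first.compressed_mult_eq[OF zf])
qed (use assms z1.closed_subspace_Kmin in \<open>simp_all only: tensor_space_Kmin1\<close>)

lemma tensor_op_compression2:
  assumes "h \<in> z2.Kmin"
  shows "tensor_op (mult_op \<phi> ` fspace hardy_disk) (model_space hardy_disk \<psi>)
    (\<lambda>f. f) (compressed_mult hardy_disk \<psi> (\<lambda>z. z)) h = z2.compression h"
proof (rule tensor_op_eq[OF model_subset(3,2) _ z2.operator_compression])
  fix f g assume "f \<in> mult_op \<phi> ` fspace hardy_disk" "g \<in> model_space hardy_disk \<psi>"
  then have m: "f \<in> fspace hardy_disk" "g \<in> fspace hardy_disk" using model_subset by auto
  note zg = coordinate.mult_op_mem[OF m(2)]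
  show "z2.compression (elem_tensor f g) = elem_tensor f (compressed_mult hardy_disk \<psi> (\<lambda>z. z) g)"
    by (simp only: z2.compression_def mult_op_elem_tensor proj_elem_tensor[OF m(1) zg]
        elem_tensor_diff second.compressed_mult_eq[OF zg])
qed (use assms z2.closed_subspace_Kmin in \<open>simp_all only: tensor_space_Kmin2\<close>)

lemma Smin1_eq: "Smin1 \<theta> = z2.Kmin"
  unfolding Smin1_def K_space_eq(2) Smax2_eq by (rule z2.ominus_Kmax)

lemma Smin2_eq: "Smin2 \<theta> = z1.Kmin"
  unfolding Smin2_def K_space_eq(1) Smax1_eq by (rule z1.ominus_Kmax)

lemma S_z1_eq: "S_z1 \<theta> f = orth_proj hardy_bidisk z1.K (mult_op fst f)"
  by (simp only: S_z1_def compressed_mult_def K_space_eq(1)[symmetric] K_space_def)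

lemma S_z2_eq: "S_z2 \<theta> f = orth_proj hardy_bidisk z2.K (mult_op snd f)"
  by (simp only: S_z2_def compressed_mult_def K_space_eq(2)[symmetric] K_space_def)

end

text \<open>The equations for \<open>Smin2\<close> and \<open>Smin1\<close> belong to the conclusion
  because \<open>tensor_op\<close> lives on a tensor space: they make the tensor entries operators
  on the summands of the decompositions.\<close>

theorem proposition2p2:
  fixes \<phi> \<psi> :: "complex \<Rightarrow> complex" and \<theta> :: "complex \<times> complex \<Rightarrow> complex"
  assumes "inner_function \<phi>" and "inner_function \<psi>"
    and "\<And>z1 z2. z1 \<in> disk \<Longrightarrow> z2 \<in> disk \<Longrightarrow> \<theta> (z1, z2) = \<phi> z1 * \<psi> z2"
  shows
    "Smin2 \<theta> = tensor_space (model_space hardy_disk \<phi>) (mult_op \<psi> ` fspace hardy_disk) \<and>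
     has_block_matrix hardy_bidisk (K_space \<theta>) (Smax1 \<theta>) (Smin2 \<theta>) (S_z1 \<theta>)
       (mult_op fst) 0
       0 (tensor_op (model_space hardy_disk \<phi>) (mult_op \<psi> ` fspace hardy_disk)
            (compressed_mult hardy_disk \<phi> (\<lambda>z. z)) (\<lambda>g. g)) \<and>
     Smin1 \<theta> = tensor_space (mult_op \<phi> ` fspace hardy_disk) (model_space hardy_disk \<psi>) \<and>
     has_block_matrix hardy_bidisk (K_space \<theta>) (Smin1 \<theta>) (Smax2 \<theta>) (S_z2 \<theta>)
       (tensor_op (mult_op \<phi> ` fspace hardy_disk) (model_space hardy_disk \<psi>)
            (\<lambda>g. g) (compressed_mult hardy_disk \<psi> (\<lambda>z. z))) 0
       0 (mult_op snd) \<and>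
     reducing hardy_bidisk (K_space \<theta>) (S_z1 \<theta>) (Smax1 \<theta>) \<and>
     reducing hardy_bidisk (K_space \<theta>) (S_z1 \<theta>) (Smin2 \<theta>) \<and>
     reducing hardy_bidisk (K_space \<theta>) (S_z2 \<theta>) (Smin1 \<theta>) \<and>
     reducing hardy_bidisk (K_space \<theta>) (S_z2 \<theta>) (Smax2 \<theta>)"
proof -
  obtain c where "isometric_coeffs c" "\<And>z. z \<in> disk \<Longrightarrow> (\<lambda>n. c n * z ^ n) sums \<phi> z"
    using inner_function_coeffs[OF assms(1)] by blast
  moreover obtain d where "isometric_coeffs d" "\<And>z. z \<in> disk \<Longrightarrow> (\<lambda>n. d n * z ^ n) sums \<psi> z"
    using inner_function_coeffs[OF assms(2)] by blast
  ultimately interpret inner_pair c \<phi> d \<psi> \<theta>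
    using assms(3) by (simp add: inner_pair_def inner_pair_axioms_def inner_multiplier_def
        inner_multiplier_axioms_def)
  show ?thesis
    unfolding Smax1_eq Smax2_eq Smin1_eq Smin2_eq tensor_space_Kmin1 tensor_space_Kmin2
  proof (intro conjI refl)
    show "has_block_matrix hardy_bidisk (K_space \<theta>) z1.Kmax z1.Kmin (S_z1 \<theta>) (mult_op fst) 0 0
        (tensor_op (model_space hardy_disk \<phi>) (mult_op \<psi> ` fspace hardy_disk)
          (compressed_mult hardy_disk \<phi> (\<lambda>z. z)) (\<lambda>g. g))"
      unfolding K_space_eq(1)
      by (rule z1.has_block_matrix_Kmax_Kmin[OF S_z1_eq tensor_op_compression1])
    show "has_block_matrix hardy_bidisk (K_space \<theta>) z2.Kmin z2.Kmax (S_z2 \<theta>)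
        (tensor_op (mult_op \<phi> ` fspace hardy_disk) (model_space hardy_disk \<psi>)
          (\<lambda>g. g) (compressed_mult hardy_disk \<psi> (\<lambda>z. z))) 0 0 (mult_op snd)"
      unfolding K_space_eq(2)
      by (rule z2.has_block_matrix_Kmin_Kmax[OF S_z2_eq tensor_op_compression2])
    show "reducing hardy_bidisk (K_space \<theta>) (S_z1 \<theta>) z1.Kmax"
      "reducing hardy_bidisk (K_space \<theta>) (S_z1 \<theta>) z1.Kmin"
      unfolding K_space_eq(1) by (rule z1.reducing_Kmax_Kmin[OF S_z1_eq])+
    show "reducing hardy_bidisk (K_space \<theta>) (S_z2 \<theta>) z2.Kmin"
      "reducing hardy_bidisk (K_space \<theta>) (S_z2 \<theta>) z2.Kmax"
      unfolding K_space_eq(2) by (rule z2.reducing_Kmax_Kmin[OF S_z2_eq])+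
  qed
qed

end
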